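(* Let $k$ be an algebraically closed field, $G$ a group, $a\in Z(G)$, $\chi:G\to k^{\times}$ a linear character with $q:=\chi(a)\neq 1$, and let $H=kG(\chi^{-1},a,0)$ be the corresponding Hopf-Ore extension of $kG$. All modules are finite dimensional. Then the following hold. (1) If $|\chi|=\infty$, then $\{V_i\mid i\in I\}$ is a complete set of representatives of the isomorphism classes of simple $H$-modules. (2) If $|\chi|=|q|=s<\infty$, then $\{V_i,\ V(j,\beta)\mid i\in I,\ [j]\in I_0,\ \beta\in k^{\times}\}$ is a complete set of representatives of the isomorphism classes of simple $H$-modules (where one representative $j$ is taken from each class $[j]\in I_0$).
   Context: $k^{\times}=k\setminus\{0\}$; $\hat G$ is the group of linear characters $G\to k^{\times}$; $|\chi|$ is the order of $\chi$ in $\hat G$ and $|q|$ the order of $q$ in $k^{\times}$ (possibly $\infty$). $H=kG(\chi^{-1},a,0)$ is the Hopf algebra generated as an algebra by $G$ and $x$ with relations $xg=\chi^{-1}(g)gx$ ($g\in G$) in addition to those of $kG$; it has $k$-basis $\{gx^i\mid g\in G, i\ge 0\}$, and $\Delta(x)=x\otimes a+1\otimes x$, $\varepsilon(x)=0$, $S(x)=-xa^{-1}$, $\Delta(g)=g\otimes g$, $\varepsilon(g)=1$, $S(g)=g^{-1}$. All modules are finite dimensional left modules (except the auxiliary induced modules $M(V_i)$ below). $\{V_i\mid i\in I\}$ is a complete set of representatives of isomorphism classes of (finite dimensional) simple $kG$-modules. Each $V_i$ is viewed as an $H$-module by letting $x$ act as $0$. For $\lambda\in\hat G$, $V_\lambda$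 is the corresponding one-dimensional module, so $\hat G\subseteq I$. Let $\sigma$ be the permutation of $I$ with $V_\chi\otimes V_i\cong V_{\sigma(i)}$. Define $i\sim j$ iff $i=\sigma^t(j)$ for some $t\in\mathbb Z$; $[i]$ is the class of $i$ and $I_0$ is the set of classes. For $i\in I$ put $M(V_i)=H\otimes_{kG}V_i$. If $|\chi|=s<\infty$ and $\beta\in k$, then $x^s$ is central in $H$, and $V(i,\beta):=M(V_i)/(x^s-\beta)M(V_i)$. *)

theory Defs
  imports
    "HOL-Algebra.Algebraic_Closure_Type"
    "HOL-Algebra.Free_Abelian_Groups"
    "HOL-Algebra.Multiplicative_Group"
    "HOL-Algebra.Bij"
begin

section \<open>Algebras on finitely supported functions\<close>

definition pm_scale :: "'k::field \<Rightarrow> ('b \<Rightarrow>\<^sub>0 'k) \<Rightarrow> ('b \<Rightarrow>\<^sub>0 'k)" where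
  "pm_scale c u = Poly_Mapping.map ((*) c) u"

definition lin_extend :: "('b \<Rightarrow> ('c \<Rightarrow>\<^sub>0 'k)) \<Rightarrow> ('b \<Rightarrow>\<^sub>0 'k::field) \<Rightarrow> ('c \<Rightarrow>\<^sub>0 'k)" where
  "lin_extend f u = (\<Sum>p\<in>Poly_Mapping.keys u. pm_scale (Poly_Mapping.lookup u p) (f p))"

text \<open>
  The free \<open>k\<close>-module on the elements of a monoid \<open>B\<close>, where the product of the basis elements
  \<open>p\<close> and \<open>q\<close> is \<open>c p q\<close> times the basis element \<open>p q\<close>. It is associative and unital when
  \<open>c\<close> is a normalised 2-cocycle. A \<open>k\<close>-algebra is recorded as a HOL-Algebra \<open>module\<close> record,
  i.e. as a ring together with scalar multiplication (the HOL-Algebra locale \<open>algebra\<close> is not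
  used since it demands commutativity).
\<close>

definition twisted_algebra ::
  "('b, 'z) monoid_scheme \<Rightarrow> ('b \<Rightarrow> 'b \<Rightarrow> 'k::field) \<Rightarrow> ('k, 'b \<Rightarrow>\<^sub>0 'k) module" where
  "twisted_algebra B c =
    \<lparr>carrier = {u. Poly_Mapping.keys u \<subseteq> carrier B},
     monoid.mult = (\<lambda>u v. lin_extend (\<lambda>p. lin_extend (\<lambda>q.
                     Poly_Mapping.single (p \<otimes>\<^bsub>B\<^esub> q) (c p q)) v) u),
     one = Poly_Mapping.single \<one>\<^bsub>B\<^esub> 1,
     ring.zero = 0,
     add = (+),
     module.smult = pm_scale\<rparr>"

lemma lookup_pm_scale [simp]:
  "Poly_Mapping.lookup (pm_scale c u) x = c * Poly_Mapping.lookup u x"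
  by (simp add: pm_scale_def Poly_Mapping.map.rep_eq when_def)

lemma pm_scale_simps [simp]:
  "pm_scale c 0 = 0" "pm_scale 0 u = 0" "pm_scale 1 u = u"
  "pm_scale c (pm_scale d u) = pm_scale (c * d) u"
  "pm_scale c (Poly_Mapping.single x d) = Poly_Mapping.single x (c * d)"
  by (auto intro!: poly_mapping_eqI simp: lookup_single when_def)

lemma pm_scale_add:
  "pm_scale c (u + v) = pm_scale c u + pm_scale c v"
  "pm_scale (c + d) u = pm_scale c u + pm_scale d u"
  by (auto intro!: poly_mapping_eqI simp: lookup_add algebra_simps)

lemma pm_scale_sum: "pm_scale c (sum f A) = (\<Sum>x\<in>A. pm_scale c (f x))"
  by (induction A rule: infinite_finite_induct) (auto simp: pm_scale_add)

lemma lin_extend_superset: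
  assumes "finite S" "Poly_Mapping.keys u \<subseteq> S"
  shows "lin_extend f u = (\<Sum>p\<in>S. pm_scale (Poly_Mapping.lookup u p) (f p))"
  unfolding lin_extend_def
  by (rule sum.mono_neutral_left) (use assms in \<open>auto simp: in_keys_iff\<close>)

lemma lin_extend_add: "lin_extend f (u + v) = lin_extend f u + lin_extend f v"
proof -
  let ?S = "Poly_Mapping.keys u \<union> Poly_Mapping.keys v"
  have "Poly_Mapping.keys (u + v) \<subseteq> ?S" by (rule keys_add)
  then show ?thesis
    by (simp add: lin_extend_superset[of ?S] lookup_add pm_scale_add sum.distrib)
qed

lemma lin_extend_zero [simp]: "lin_extend f 0 = 0"
  by (simp add: lin_extend_def)

lemma lin_extend_scale: "lin_extend f (pm_scale c u) = pm_scale c (lin_extend f u)"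
proof -
  have "Poly_Mapping.keys (pm_scale c u) \<subseteq> Poly_Mapping.keys u"
    by (auto simp: in_keys_iff)
  then show ?thesis
    by (simp add: lin_extend_superset[of "Poly_Mapping.keys u"] pm_scale_sum)
qed

lemma lin_extend_single [simp]: "lin_extend f (Poly_Mapping.single p c) = pm_scale c (f p)"
  by (simp add: lin_extend_superset[of "{p}"])

lemma lin_extend_sum: "lin_extend f (sum g A) = (\<Sum>x\<in>A. lin_extend f (g x))"
  by (induction A rule: infinite_finite_induct) (auto simp: lin_extend_add)

lemma lin_extend_fun_add:
  "lin_extend (\<lambda>p. f p + g p) u = lin_extend f u + lin_extend g u"
  by (simp add: lin_extend_def pm_scale_add sum.distrib)

lemma lin_extend_fun_scale:
  "lin_extend (\<lambda>p. pm_scale c (f p)) u = pm_scale c (lin_extend f u)"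
  by (simp add: lin_extend_def pm_scale_sum mult.commute)

lemma lin_extend_compose:
  "lin_extend f (lin_extend g u) = lin_extend (\<lambda>p. lin_extend f (g p)) u"
  by (simp add: lin_extend_def[of g] lin_extend_def[of "\<lambda>p. lin_extend f (g p)"]
      lin_extend_sum lin_extend_scale)

lemma lin_extend_cong:
  "(\<And>p. p \<in> Poly_Mapping.keys u \<Longrightarrow> f p = g p) \<Longrightarrow> lin_extend f u = lin_extend g u"
  by (simp add: lin_extend_def)

lemma lin_extend_id: "lin_extend (\<lambda>p. Poly_Mapping.single p 1) u = u"
  by (rule poly_mapping_eqI)
    (auto simp: lin_extend_def lookup_sum lookup_single when_def in_keys_iff sum.delta)

lemma keys_lin_extend:
  assumes "\<And>p. p \<in> Poly_Mapping.keys u \<Longrightarrow> Poly_Mapping.keys (f p) \<subseteq> S"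
  shows "Poly_Mapping.keys (lin_extend f u) \<subseteq> S"
proof -
  have "Poly_Mapping.keys (lin_extend f u) \<subseteq>
      (\<Union>p\<in>Poly_Mapping.keys u. Poly_Mapping.keys (pm_scale (Poly_Mapping.lookup u p) (f p)))"
    unfolding lin_extend_def by (rule keys_sum)
  also have "\<dots> \<subseteq> S"
    using assms by (force simp: in_keys_iff)
  finally show ?thesis .
qed

lemma twisted_algebra_ring:
  fixes c :: "'b \<Rightarrow> 'b \<Rightarrow> 'k::field" and A :: "('k, 'b \<Rightarrow>\<^sub>0 'k, 'z) module_scheme"
  assumes "Group.monoid B"
    and cocycle: "\<And>p q r. \<lbrakk>p \<in> carrier B; q \<in> carrier B; r \<in> carrier B\<rbrakk> \<Longrightarrow>
      c p q * c (p \<otimes>\<^bsub>B\<^esub> q) r = c p (q \<otimes>\<^bsub>B\<^esub> r) * c q r"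
    and unit: "\<And>p. p \<in> carrier B \<Longrightarrow> c \<one>\<^bsub>B\<^esub> p = 1 \<and> c p \<one>\<^bsub>B\<^esub> = 1"
    and A: "module.truncate A = twisted_algebra B c"
  shows "ring A"
proof -
  interpret B: Group.monoid B by fact
  have A_simps:
    "carrier A = {u. Poly_Mapping.keys u \<subseteq> carrier B}"
    "monoid.mult A = (\<lambda>u v. lin_extend (\<lambda>p. lin_extend (\<lambda>q.
                     Poly_Mapping.single (p \<otimes>\<^bsub>B\<^esub> q) (c p q)) v) u)"
    "one A = Poly_Mapping.single \<one>\<^bsub>B\<^esub> 1"
    "ring.zero A = 0" "add A = (+)"
    using A by (simp_all add: twisted_algebra_def module.defs)
  show ?thesis
  proof (rule ringI)
    show "abelian_group A"
    proof (rule abelian_groupI)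
      fix x y assume "x \<in> carrier A" "y \<in> carrier A"
      then show "x \<oplus>\<^bsub>A\<^esub> y \<in> carrier A"
        using keys_add[of x y] by (auto simp: A_simps)
    next
      fix x assume "x \<in> carrier A"
      then show "\<exists>y\<in>carrier A. y \<oplus>\<^bsub>A\<^esub> x = \<zero>\<^bsub>A\<^esub>"
        by (intro bexI[of _ "- x"]) (auto simp: A_simps)
    qed (auto simp: A_simps algebra_simps)
  next
    show "Group.monoid A"
    proof (rule Group.monoidI)
      fix u v assume "u \<in> carrier A" "v \<in> carrier A"
      then show "u \<otimes>\<^bsub>A\<^esub> v \<in> carrier A"
        unfolding A_simps mem_Collect_eq
        by (intro keys_lin_extend) (auto simp: subset_eq)
    next
      show "\<one>\<^bsub>A\<^esub> \<in> carrier A" by (simp add: A_simps)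
    next
      fix u v w assume "u \<in> carrier A" "v \<in> carrier A" "w \<in> carrier A"
      then have k: "Poly_Mapping.keys u \<subseteq> carrier B" "Poly_Mapping.keys v \<subseteq> carrier B"
        "Poly_Mapping.keys w \<subseteq> carrier B" by (auto simp: A_simps)
      show "u \<otimes>\<^bsub>A\<^esub> v \<otimes>\<^bsub>A\<^esub> w = u \<otimes>\<^bsub>A\<^esub> (v \<otimes>\<^bsub>A\<^esub> w)"
        unfolding A_simps
        apply (simp add: lin_extend_compose lin_extend_fun_scale[symmetric])
        apply (intro lin_extend_cong)
        using k by (simp add: subset_eq B.m_assoc cocycle mult.commute)
    next
      fix u assume "u \<in> carrier A"
      then have k: "Poly_Mapping.keys u \<subseteq> carrier B" by (auto simp: A_simps)
      have *: "lin_extend f u = u" if "\<And>p. p \<in> carrier B \<Longrightarrow> f p = Poly_Mapping.single p 1" for f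
        using lin_extend_cong[of u f "\<lambda>p. Poly_Mapping.single p 1"] that k
        by (auto simp: lin_extend_id)
      show "\<one>\<^bsub>A\<^esub> \<otimes>\<^bsub>A\<^esub> u = u" "u \<otimes>\<^bsub>A\<^esub> \<one>\<^bsub>A\<^esub> = u"
        by (simp_all add: A_simps * unit)
    qed
  qed (simp_all add: A_simps lin_extend_add lin_extend_fun_add)
qed

text \<open>
  Hopf algebras are recorded with a chosen basis \<open>'b\<close>; the tensor square of the algebra is then
  carried by the finitely supported functions on pairs of basis elements.
\<close>

record ('k, 'u, 't) hopf_algebra = "('k, 'u) module" +
  comult :: "'u \<Rightarrow> 't"
  counit :: "'u \<Rightarrow> 'k"
  antipode :: "'u \<Rightarrow> 'u"

type_synonym ('k, 'b) hopf = "('k, 'b \<Rightarrow>\<^sub>0 'k, 'b \<times> 'b \<Rightarrow>\<^sub>0 'k) hopf_algebra"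

definition group_algebra :: "('g, 'z) monoid_scheme \<Rightarrow> ('k::field, 'g) hopf" where
  "group_algebra G = module.extend (twisted_algebra G (\<lambda>_ _. 1))
    (hopf_algebra.fields
      (lin_extend (\<lambda>g. Poly_Mapping.single (g, g) 1))
      (\<lambda>u. \<Sum>g\<in>Poly_Mapping.keys u. Poly_Mapping.lookup u g)
      (lin_extend (\<lambda>g. Poly_Mapping.single (inv\<^bsub>G\<^esub> g) 1)))"

section \<open>Characters and the Hopf-Ore extension\<close>

text \<open>
  The order \<open>|\<chi>|\<close> is \<open>group.ord (character_group G) \<chi>\<close>; elements of infinite order have
  \<open>ord\<close> equal to \<open>0\<close>. Characters are extensional so that equality in the group is equality on \<open>G\<close>.
\<close>

definition character_group :: "('g, 'z) monoid_scheme \<Rightarrow> ('g \<Rightarrow> 'k::field) monoid" where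
  "character_group G =
    \<lparr>carrier = hom G (mult_of ring_of_type_algebra) \<inter> extensional (carrier G),
     monoid.mult = (\<lambda>\<chi> \<psi>. \<lambda>g\<in>carrier G. \<chi> g * \<psi> g),
     one = (\<lambda>g\<in>carrier G. 1)\<rparr>"

text \<open>
  The pair \<open>(g, i)\<close> stands for the basis element \<open>g x\<^sup>i\<close>. The relation
  \<open>x h = \<chi>\<^sup>-\<^sup>1(h) h x\<close> gives \<open>(g x\<^sup>i)(h x\<^sup>j) = \<chi>\<^sup>-\<^sup>1(h)\<^sup>i (g h) x\<^sup>i\<^sup>+\<^sup>j\<close>.
\<close>

definition ore_basis :: "('g, 'z) monoid_scheme \<Rightarrow> ('g \<times> nat) monoid" where
  "ore_basis G = G \<times>\<times> \<lparr>carrier = UNIV, monoid.mult = (+), one = (0::nat)\<rparr>"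

definition ore_factor :: "('g \<Rightarrow> 'k::field) \<Rightarrow> 'g \<times> nat \<Rightarrow> 'g \<times> nat \<Rightarrow> 'k" where
  "ore_factor \<chi> p q = inverse (\<chi> (fst q)) ^ snd p"

definition ore_algebra ::
  "('g, 'z) monoid_scheme \<Rightarrow> ('g \<Rightarrow> 'k::field) \<Rightarrow> ('k, 'g \<times> nat \<Rightarrow>\<^sub>0 'k) module" where
  "ore_algebra G \<chi> = twisted_algebra (ore_basis G) (ore_factor \<chi>)"

definition ore_tensor_square ::
  "('g, 'z) monoid_scheme \<Rightarrow> ('g \<Rightarrow> 'k::field) \<Rightarrow> ('k, ('g \<times> nat) \<times> ('g \<times> nat) \<Rightarrow>\<^sub>0 'k) module" where
  "ore_tensor_square G \<chi> = twisted_algebra (ore_basis G \<times>\<times> ore_basis G)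
     (\<lambda>p q. ore_factor \<chi> (fst p) (fst q) * ore_factor \<chi> (snd p) (snd q))"

definition ore_group :: "'g \<Rightarrow> ('g \<times> nat \<Rightarrow>\<^sub>0 'k::field)" where
  "ore_group g = Poly_Mapping.single (g, 0) 1"

definition ore_var :: "('g, 'z) monoid_scheme \<Rightarrow> ('g \<times> nat \<Rightarrow>\<^sub>0 'k::field)" where
  "ore_var G = Poly_Mapping.single (\<one>\<^bsub>G\<^esub>, 1) 1"

text \<open>
  The Hopf algebra \<open>kG(\<chi>\<^sup>-\<^sup>1, a, 0)\<close>. The comultiplication and the antipode are the linear
  extensions of \<open>g x\<^sup>i \<mapsto> (g \<otimes> g)(x \<otimes> a + 1 \<otimes> x)\<^sup>i\<close> and \<open>g x\<^sup>i \<mapsto> (- x a\<^sup>-\<^sup>1)\<^sup>i g\<^sup>-\<^sup>1\<close>.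
\<close>

definition hopf_ore ::
  "('g, 'z) monoid_scheme \<Rightarrow> ('g \<Rightarrow> 'k::field) \<Rightarrow> 'g \<Rightarrow> ('k, 'g \<times> nat) hopf" where
  "hopf_ore G \<chi> a =
    (let A = ore_algebra G \<chi>; T = ore_tensor_square G \<chi> in
     module.extend A
      (hopf_algebra.fields
        (lin_extend (\<lambda>(g, i).
           Poly_Mapping.single ((g, 0), (g, 0)) 1 \<otimes>\<^bsub>T\<^esub>
           (Poly_Mapping.single ((\<one>\<^bsub>G\<^esub>, 1), (a, 0)) 1 \<oplus>\<^bsub>T\<^esub>
            Poly_Mapping.single ((\<one>\<^bsub>G\<^esub>, 0), (\<one>\<^bsub>G\<^esub>, 1)) 1) [^]\<^bsub>T\<^esub> i))
        (\<lambda>u. \<Sum>p\<in>Poly_Mapping.keys u. if snd p = 0 then Poly_Mapping.lookup u p else 0)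
        (lin_extend (\<lambda>(g, i).
           (\<ominus>\<^bsub>A\<^esub> (ore_var G \<otimes>\<^bsub>A\<^esub> ore_group (inv\<^bsub>G\<^esub> a))) [^]\<^bsub>A\<^esub> i \<otimes>\<^bsub>A\<^esub> ore_group (inv\<^bsub>G\<^esub> g)))))"

definition group_to_ore :: "('g \<Rightarrow>\<^sub>0 'k::field) \<Rightarrow> ('g \<times> nat \<Rightarrow>\<^sub>0 'k)" where
  "group_to_ore = lin_extend ore_group"

text \<open>The algebra map \<open>H \<rightarrow> kG\<close> which is the identity on \<open>G\<close> and sends \<open>x\<close> to \<open>0\<close>.\<close>

definition ore_to_group :: "('g \<times> nat \<Rightarrow>\<^sub>0 'k::field) \<Rightarrow> ('g \<Rightarrow>\<^sub>0 'k)" where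
  "ore_to_group = lin_extend (\<lambda>(g, i). if i = 0 then Poly_Mapping.single g 1 else 0)"

lemma group_algebra_ring:
  assumes "group G"
  shows "ring (group_algebra G :: ('k::field, 'g) hopf)"
proof -
  interpret group G by fact
  show ?thesis
    by (rule twisted_algebra_ring[of G "\<lambda>_ _. 1"])
      (auto intro: is_monoid simp: group_algebra_def module.defs hopf_algebra.defs twisted_algebra_def)
qed

lemma ore_basis_monoid: "group G \<Longrightarrow> Group.monoid (ore_basis G)"
  unfolding ore_basis_def
  by (intro DirProd_monoid group.is_monoid Group.monoidI) auto

lemma hopf_ore_simps:
  "carrier (hopf_ore G \<chi> a) = {u. Poly_Mapping.keys u \<subseteq> carrier G \<times> UNIV}"
  "\<one>\<^bsub>hopf_ore G \<chi> a\<^esub> = ore_group \<one>\<^bsub>G\<^esub>"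
  "\<zero>\<^bsub>hopf_ore G \<chi> a\<^esub> = 0"
  "u \<oplus>\<^bsub>hopf_ore G \<chi> a\<^esub> v = u + v"
  "c \<odot>\<^bsub>hopf_ore G \<chi> a\<^esub> u = pm_scale c u"
  "Poly_Mapping.single (g, i) c \<otimes>\<^bsub>hopf_ore G \<chi> a\<^esub> Poly_Mapping.single (h, j) d =
     Poly_Mapping.single (g \<otimes>\<^bsub>G\<^esub> h, i + j) (c * d * inverse (\<chi> h) ^ i)"
  by (simp_all add: hopf_ore_def Let_def module.defs hopf_algebra.defs ore_algebra_def twisted_algebra_def
      ore_basis_def ore_factor_def ore_group_def DirProd_def mult_ac)

lemma character_nonzero:
  assumes "\<chi> \<in> carrier (character_group G)" "g \<in> carrier G"
  shows "\<chi> g \<noteq> 0"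
  using assms by (auto simp: character_group_def hom_def ring_of_type_algebra_def)

lemma character_mult:
  assumes "\<chi> \<in> carrier (character_group G)" "g \<in> carrier G" "h \<in> carrier G"
  shows "\<chi> (g \<otimes>\<^bsub>G\<^esub> h) = \<chi> g * \<chi> h"
  using assms by (auto simp: character_group_def hom_def ring_of_type_algebra_def)

lemma character_one:
  assumes "group G" "\<chi> \<in> carrier (character_group G)"
  shows "\<chi> \<one>\<^bsub>G\<^esub> = 1"
proof -
  interpret group G by fact
  have "\<chi> \<one>\<^bsub>G\<^esub> * \<chi> \<one>\<^bsub>G\<^esub> = \<chi> \<one>\<^bsub>G\<^esub>"
    using character_mult[OF assms(2), of "\<one>\<^bsub>G\<^esub>" "\<one>\<^bsub>G\<^esub>"] by simp
  then show ?thesis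
    using character_nonzero[OF assms(2), of "\<one>\<^bsub>G\<^esub>"] by simp
qed

lemma ore_ring:
  fixes A :: "('k::field, 'g \<times> nat \<Rightarrow>\<^sub>0 'k, 'z) module_scheme"
  assumes "group G" "\<chi> \<in> carrier (character_group G)" "module.truncate A = ore_algebra G \<chi>"
  shows "ring A"
proof -
  interpret group G by fact
  show ?thesis
  proof (rule twisted_algebra_ring[of "ore_basis G" "ore_factor \<chi>"])
    show "Group.monoid (ore_basis G)" by (rule ore_basis_monoid) fact
    show "module.truncate A = twisted_algebra (ore_basis G) (ore_factor \<chi>)"
      using assms(3) by (simp add: ore_algebra_def)
  qed (auto simp: ore_basis_def ore_factor_def DirProd_def character_mult[OF assms(2)]
      character_one[OF assms(1,2)] power_add power_mult_distrib mult_ac)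
qed

lemma hopf_ore_ring:
  assumes "group G" "\<chi> \<in> carrier (character_group G)"
  shows "ring (hopf_ore G \<chi> a)"
  by (rule ore_ring[OF assms])
    (simp add: hopf_ore_def Let_def module.defs hopf_algebra.defs ore_algebra_def twisted_algebra_def)

text \<open>The defining relation, and the values of the structure maps on the generators.\<close>

lemma hopf_ore_relation:
  assumes "group G" "\<chi> \<in> carrier (character_group G)" "g \<in> carrier G"
  shows "ore_var G \<otimes>\<^bsub>hopf_ore G \<chi> a\<^esub> ore_group g =
    inverse (\<chi> g) \<odot>\<^bsub>hopf_ore G \<chi> a\<^esub> (ore_group g \<otimes>\<^bsub>hopf_ore G \<chi> a\<^esub> ore_var G)"
proof -
  interpret group G by fact
  show ?thesis
    using assms(3) by (simp add: ore_var_def ore_group_def hopf_ore_simps character_one[OF assms(1,2)])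
qed

lemma hopf_ore_monomial:
  assumes "group G" "\<chi> \<in> carrier (character_group G)" "g \<in> carrier G"
  shows "ore_group g \<otimes>\<^bsub>hopf_ore G \<chi> a\<^esub> (ore_var G [^]\<^bsub>hopf_ore G \<chi> a\<^esub> i) =
    Poly_Mapping.single (g, i) 1"
proof -
  interpret group G by fact
  have "ore_var G [^]\<^bsub>hopf_ore G \<chi> a\<^esub> i = Poly_Mapping.single (\<one>\<^bsub>G\<^esub>, i) 1"
    by (induction i)
      (simp_all add: nat_pow_def hopf_ore_simps ore_group_def ore_var_def character_one[OF assms(1,2)])
  then show ?thesis
    using assms(3) by (simp add: ore_group_def hopf_ore_simps character_one[OF assms(1,2)])
qed

lemma hopf_ore_structure_maps:
  assumes "group G" "\<chi> \<in> carrier (character_group G)" "a \<in> carrier G" "g \<in> carrier G"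
  shows "comult (hopf_ore G \<chi> a) (ore_group g) = Poly_Mapping.single ((g, 0), (g, 0)) 1"
    and "comult (hopf_ore G \<chi> a) (ore_var G) =
      Poly_Mapping.single ((\<one>\<^bsub>G\<^esub>, 1), (a, 0)) 1 + Poly_Mapping.single ((\<one>\<^bsub>G\<^esub>, 0), (\<one>\<^bsub>G\<^esub>, 1)) 1"
    and "counit (hopf_ore G \<chi> a) (ore_group g) = 1"
    and "counit (hopf_ore G \<chi> a) (ore_var G) = 0"
    and "antipode (hopf_ore G \<chi> a) (ore_group g) = ore_group (inv\<^bsub>G\<^esub> g)"
    and "antipode (hopf_ore G \<chi> a) (ore_var G) =
      - (ore_var G \<otimes>\<^bsub>hopf_ore G \<chi> a\<^esub> ore_group (inv\<^bsub>G\<^esub> a))"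
  proof -
  interpret group G by fact
  interpret A: ring "ore_algebra G \<chi>"
    by (rule ore_ring[OF assms(1,2)]) (simp add: module.defs ore_algebra_def twisted_algebra_def)
  note one = character_one[OF assms(1,2)]
  have minus: "\<ominus>\<^bsub>ore_algebra G \<chi>\<^esub> u = - u" if "Poly_Mapping.keys u \<subseteq> carrier G \<times> UNIV" for u
    by (rule A.minus_equality)
      (use that in \<open>auto simp: ore_algebra_def twisted_algebra_def ore_basis_def DirProd_def\<close>)
  show "comult (hopf_ore G \<chi> a) (ore_group g) = Poly_Mapping.single ((g, 0), (g, 0)) 1"
    "comult (hopf_ore G \<chi> a) (ore_var G) =
      Poly_Mapping.single ((\<one>\<^bsub>G\<^esub>, 1), (a, 0)) 1 + Poly_Mapping.single ((\<one>\<^bsub>G\<^esub>, 0), (\<one>\<^bsub>G\<^esub>, 1)) 1"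
    using assms(3,4)
    by (simp_all add: hopf_ore_def Let_def module.defs hopf_algebra.defs ore_group_def ore_var_def
        ore_tensor_square_def twisted_algebra_def ore_basis_def ore_factor_def DirProd_def nat_pow_def
        lin_extend_add one)
  show "counit (hopf_ore G \<chi> a) (ore_group g) = 1" "counit (hopf_ore G \<chi> a) (ore_var G) = 0"
    by (simp_all add: hopf_ore_def Let_def module.defs hopf_algebra.defs ore_group_def ore_var_def)
  have var_a: "ore_var G \<otimes>\<^bsub>ore_algebra G \<chi>\<^esub> ore_group (inv\<^bsub>G\<^esub> a) =
      Poly_Mapping.single (inv\<^bsub>G\<^esub> a, 1) (inverse (\<chi> (inv\<^bsub>G\<^esub> a)))"
    using assms(3)
    by (simp add: ore_group_def ore_var_def ore_algebra_def twisted_algebra_def ore_basis_def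
        ore_factor_def DirProd_def)
  have one_A: "ore_group \<one>\<^bsub>G\<^esub> = \<one>\<^bsub>ore_algebra G \<chi>\<^esub>"
    by (simp add: ore_algebra_def twisted_algebra_def ore_basis_def ore_group_def DirProd_def)
  have group_closed: "ore_group h \<in> carrier (ore_algebra G \<chi>)" if "h \<in> carrier G" for h
    using that by (simp add: ore_algebra_def twisted_algebra_def ore_basis_def ore_group_def DirProd_def)
  have "ore_var G \<in> carrier (ore_algebra G \<chi>)"
    by (simp add: ore_algebra_def twisted_algebra_def ore_basis_def ore_var_def DirProd_def)
  then have var_closed: "\<ominus>\<^bsub>ore_algebra G \<chi>\<^esub> (ore_var G \<otimes>\<^bsub>ore_algebra G \<chi>\<^esub> ore_group (inv\<^bsub>G\<^esub> a))
      \<in> carrier (ore_algebra G \<chi>)"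
    using assms(3) by (intro A.a_inv_closed A.m_closed group_closed) auto
  have antipode: "antipode (hopf_ore G \<chi> a) (Poly_Mapping.single (h, n) 1) =
      (\<ominus>\<^bsub>ore_algebra G \<chi>\<^esub> (ore_var G \<otimes>\<^bsub>ore_algebra G \<chi>\<^esub> ore_group (inv\<^bsub>G\<^esub> a))) [^]\<^bsub>ore_algebra G \<chi>\<^esub> n
        \<otimes>\<^bsub>ore_algebra G \<chi>\<^esub> ore_group (inv\<^bsub>G\<^esub> h)" for h n
    by (simp add: hopf_ore_def Let_def module.defs hopf_algebra.defs)
  have mult_eq: "monoid.mult (hopf_ore G \<chi> a) = monoid.mult (ore_algebra G \<chi>)"
    by (simp add: hopf_ore_def Let_def module.defs hopf_algebra.defs)
  show "antipode (hopf_ore G \<chi> a) (ore_group g) = ore_group (inv\<^bsub>G\<^esub> g)"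
    unfolding ore_group_def[of g] antipode using assms(4) group_closed by simp
  have "antipode (hopf_ore G \<chi> a) (ore_var G) =
      \<ominus>\<^bsub>ore_algebra G \<chi>\<^esub> (ore_var G \<otimes>\<^bsub>ore_algebra G \<chi>\<^esub> ore_group (inv\<^bsub>G\<^esub> a))"
    unfolding ore_var_def[of G] antipode
    unfolding ore_var_def[of G, symmetric] inv_one one_A
    using var_closed by simp
  also have "\<dots> = - (ore_var G \<otimes>\<^bsub>hopf_ore G \<chi> a\<^esub> ore_group (inv\<^bsub>G\<^esub> a))"
    unfolding mult_eq by (rule minus) (use assms(3) in \<open>auto simp: var_a\<close>)
  finally show "antipode (hopf_ore G \<chi> a) (ore_var G) =
      - (ore_var G \<otimes>\<^bsub>hopf_ore G \<chi> a\<^esub> ore_group (inv\<^bsub>G\<^esub> a))" .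
qed

section \<open>Modules\<close>

text \<open>
  A left module is recorded by a HOL-Algebra \<open>module\<close> record whose fields \<open>mult\<close> and \<open>one\<close> are
  irrelevant; unlike in the locale \<open>module\<close>, the ring need not be commutative.
\<close>

locale left_module = R: ring R + M: abelian_group M
  for R :: "('r, 'y) ring_scheme" and M :: "('r, 'm, 'z) module_scheme" +
  assumes smult_closed: "\<lbrakk>r \<in> carrier R; x \<in> carrier M\<rbrakk> \<Longrightarrow> r \<odot>\<^bsub>M\<^esub> x \<in> carrier M"
    and smult_l_distr: "\<lbrakk>r \<in> carrier R; t \<in> carrier R; x \<in> carrier M\<rbrakk> \<Longrightarrow>
      (r \<oplus>\<^bsub>R\<^esub> t) \<odot>\<^bsub>M\<^esub> x = r \<odot>\<^bsub>M\<^esub> x \<oplus>\<^bsub>M\<^esub> t \<odot>\<^bsub>M\<^esub> x"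
    and smult_r_distr: "\<lbrakk>r \<in> carrier R; x \<in> carrier M; y \<in> carrier M\<rbrakk> \<Longrightarrow>
      r \<odot>\<^bsub>M\<^esub> (x \<oplus>\<^bsub>M\<^esub> y) = r \<odot>\<^bsub>M\<^esub> x \<oplus>\<^bsub>M\<^esub> r \<odot>\<^bsub>M\<^esub> y"
    and smult_assoc: "\<lbrakk>r \<in> carrier R; t \<in> carrier R; x \<in> carrier M\<rbrakk> \<Longrightarrow>
      (r \<otimes>\<^bsub>R\<^esub> t) \<odot>\<^bsub>M\<^esub> x = r \<odot>\<^bsub>M\<^esub> (t \<odot>\<^bsub>M\<^esub> x)"
    and smult_one: "x \<in> carrier M \<Longrightarrow> \<one>\<^bsub>R\<^esub> \<odot>\<^bsub>M\<^esub> x = x"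

definition module_isomorphic ::
  "('r, 'y) ring_scheme \<Rightarrow> ('r, 'm) module \<Rightarrow> ('r, 'n) module \<Rightarrow> bool" where
  "module_isomorphic R M N \<longleftrightarrow>
    (\<exists>f. bij_betw f (carrier M) (carrier N) \<and>
      (\<forall>x\<in>carrier M. \<forall>y\<in>carrier M. f (x \<oplus>\<^bsub>M\<^esub> y) = f x \<oplus>\<^bsub>N\<^esub> f y) \<and>
      (\<forall>r\<in>carrier R. \<forall>x\<in>carrier M. f (r \<odot>\<^bsub>M\<^esub> x) = r \<odot>\<^bsub>N\<^esub> f x))"

definition simple_module :: "('r, 'y) ring_scheme \<Rightarrow> ('r, 'm) module \<Rightarrow> bool" where
  "simple_module R M \<longleftrightarrow> left_module R M \<and> carrier M \<noteq> {\<zero>\<^bsub>M\<^esub>} \<and>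
    (\<forall>N. submodule N R M \<longrightarrow> N = {\<zero>\<^bsub>M\<^esub>} \<or> N = carrier M)"

definition restrict_scalars :: "('t \<Rightarrow> 'r) \<Rightarrow> ('r, 'm) module \<Rightarrow> ('t, 'm) module" where
  "restrict_scalars f M =
    \<lparr>carrier = carrier M, monoid.mult = monoid.mult M, one = one M, ring.zero = \<zero>\<^bsub>M\<^esub>,
     add = add M, module.smult = (\<lambda>t. module.smult M (f t))\<rparr>"

text \<open>The vector space underlying a module over the \<open>k\<close>-algebra \<open>A\<close>.\<close>

definition scalar_module :: "('k, 'r, 'y) module_scheme \<Rightarrow> ('r, 'm) module \<Rightarrow> ('k, 'm) module" where
  "scalar_module A M = restrict_scalars (\<lambda>c. c \<odot>\<^bsub>A\<^esub> \<one>\<^bsub>A\<^esub>) M"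

definition finite_dim :: "('k::field, 'r, 'y) module_scheme \<Rightarrow> ('r, 'm) module \<Rightarrow> bool" where
  "finite_dim A M \<longleftrightarrow> (\<exists>S. finite S \<and> S \<subseteq> carrier M \<and>
    (\<forall>W. submodule W (ring_of_type_algebra :: 'k ring) (scalar_module A M) \<and> S \<subseteq> W \<longrightarrow>
      W = carrier M))"

definition simple_fd :: "('k::field, 'r, 'y) module_scheme \<Rightarrow> ('r, 'm) module \<Rightarrow> bool" where
  "simple_fd A M \<longleftrightarrow> simple_module A M \<and> finite_dim A M"

definition nonisomorphic_simples ::
  "('k::field, 'r, 'y) module_scheme \<Rightarrow> 'i set \<Rightarrow> ('i \<Rightarrow> ('r, 'v) module) \<Rightarrow> bool" where
  "nonisomorphic_simples A I V \<longleftrightarrow> (\<forall>i\<in>I. simple_fd A (V i)) \<and>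
    (\<forall>i\<in>I. \<forall>j\<in>I. module_isomorphic A (V i) (V j) \<longrightarrow> i = j)"

text \<open>
  Completeness has to refer to a type \<open>'u\<close> in which the carriers of the modules to be represented
  lie. It is meaningful for all finite-dimensional modules as soon as \<open>'u\<close> contains a copy of each
  \<open>k\<^sup>n\<close>, as \<open>nat \<Rightarrow> 'k\<close> does.
\<close>

definition complete_simples ::
  "'u itself \<Rightarrow> ('k::field, 'r, 'y) module_scheme \<Rightarrow> 'i set \<Rightarrow> ('i \<Rightarrow> ('r, 'v) module) \<Rightarrow> bool" where
  "complete_simples U A I V \<longleftrightarrow> nonisomorphic_simples A I V \<and>
    (\<forall>M :: ('r, 'u) module. simple_fd A M \<longrightarrow> (\<exists>i\<in>I. module_isomorphic A M (V i)))"

definition quotient_module :: "('r, 'm) module \<Rightarrow> 'm set \<Rightarrow> ('r, 'm set) module" where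
  "quotient_module M N =
    \<lparr>carrier = a_rcosets\<^bsub>M\<^esub> N, monoid.mult = undefined, one = undefined, ring.zero = N,
     add = set_add M, module.smult = (\<lambda>r Y. \<Union>x\<in>Y. N +>\<^bsub>M\<^esub> (r \<odot>\<^bsub>M\<^esub> x))\<rparr>"

subsection \<open>Tensor products\<close>

text \<open>
  The tensor product of a right \<open>R\<close>-module \<open>M\<close> and a left \<open>R\<close>-module \<open>N\<close> is the free abelian
  group on \<open>M \<times> N\<close> modulo the subgroup generated by the usual relations. In the record of the
  right module \<open>M\<close>, the scalar multiplication \<open>r \<odot> m\<close> denotes \<open>m r\<close>.
\<close>

definition tensor_relations ::
  "('r, 'y) ring_scheme \<Rightarrow> ('r, 'm) module \<Rightarrow> ('r, 'n) module \<Rightarrow> ('m \<times> 'n \<Rightarrow>\<^sub>0 int) set" where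
  "tensor_relations R M N =
    {frag_of (m \<oplus>\<^bsub>M\<^esub> m', n) - frag_of (m, n) - frag_of (m', n) | m m' n.
       m \<in> carrier M \<and> m' \<in> carrier M \<and> n \<in> carrier N} \<union>
    {frag_of (m, n \<oplus>\<^bsub>N\<^esub> n') - frag_of (m, n) - frag_of (m, n') | m n n'.
       m \<in> carrier M \<and> n \<in> carrier N \<and> n' \<in> carrier N} \<union>
    {frag_of (r \<odot>\<^bsub>M\<^esub> m, n) - frag_of (m, r \<odot>\<^bsub>N\<^esub> n) | r m n.
       r \<in> carrier R \<and> m \<in> carrier M \<and> n \<in> carrier N}"

text \<open>
  Here \<open>act h (m, n)\<close> is a representative, in the free abelian group, of the action of \<open>h\<close> on the
  pure tensor of \<open>m\<close> and \<open>n\<close>.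
\<close>

definition tensor_module ::
  "('r, 'y) ring_scheme \<Rightarrow> ('r, 'm) module \<Rightarrow> ('r, 'n) module \<Rightarrow>
   ('h \<Rightarrow> 'm \<times> 'n \<Rightarrow> ('m \<times> 'n \<Rightarrow>\<^sub>0 int)) \<Rightarrow> ('h, ('m \<times> 'n \<Rightarrow>\<^sub>0 int) set) module" where
  "tensor_module R M N act =
    (let F = free_Abelian_group (carrier M \<times> carrier N);
         S = generate F (tensor_relations R M N)
     in \<lparr>carrier = carrier (F Mod S), monoid.mult = undefined, one = undefined,
         ring.zero = \<one>\<^bsub>F Mod S\<^esub>, add = monoid.mult (F Mod S),
         module.smult = (\<lambda>h Y. \<Union>t\<in>Y. S #>\<^bsub>F\<^esub> frag_extend (act h) t)\<rparr>)"

text \<open>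
  Tensor product over \<open>k\<close> of modules over a Hopf algebra: \<open>h (v \<otimes> w) = \<Sum> h\<^sub>1 v \<otimes> h\<^sub>2 w\<close>.
\<close>

definition hopf_tensor ::
  "('k::field, 'b) hopf \<Rightarrow> ('b \<Rightarrow>\<^sub>0 'k, 'm) module \<Rightarrow> ('b \<Rightarrow>\<^sub>0 'k, 'n) module \<Rightarrow>
   ('b \<Rightarrow>\<^sub>0 'k, ('m \<times> 'n \<Rightarrow>\<^sub>0 int) set) module" where
  "hopf_tensor A M N =
    tensor_module (ring_of_type_algebra :: 'k ring) (scalar_module A M) (scalar_module A N)
      (\<lambda>h (v, w). \<Sum>(b, c)\<in>Poly_Mapping.keys (comult A h).
         frag_of (Poly_Mapping.single b (Poly_Mapping.lookup (comult A h) (b, c)) \<odot>\<^bsub>M\<^esub> v,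
                  Poly_Mapping.single c 1 \<odot>\<^bsub>N\<^esub> w))"

section \<open>The modules of the classification\<close>

text \<open>The module \<open>V\<^sub>\<mu>\<close> for a linear character \<open>\<mu>\<close>.\<close>

definition char_module :: "('g \<Rightarrow> 'k::field) \<Rightarrow> ('g \<Rightarrow>\<^sub>0 'k, 'k) module" where
  "char_module \<mu> =
    \<lparr>carrier = UNIV, monoid.mult = undefined, one = undefined, ring.zero = 0, add = (+),
     module.smult = (\<lambda>u z. (\<Sum>g\<in>Poly_Mapping.keys u. Poly_Mapping.lookup u g * \<mu> g) * z)\<rparr>"

text \<open>A \<open>kG\<close>-module viewed as an \<open>H\<close>-module on which \<open>x\<close> acts as \<open>0\<close>.\<close>

definition inflate :: "('g \<Rightarrow>\<^sub>0 'k::field, 'v) module \<Rightarrow> ('g \<times> nat \<Rightarrow>\<^sub>0 'k, 'v) module" where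
  "inflate V = restrict_scalars ore_to_group V"

text \<open>\<open>M(V) = H \<otimes>\<^bsub>kG\<^esub> V\<close>, where \<open>H\<close> is the Hopf-Ore extension of \<open>kG\<close>.\<close>

definition induced_module ::
  "('g, 'z) monoid_scheme \<Rightarrow> ('k::field, 'g \<times> nat) hopf \<Rightarrow> ('g \<Rightarrow>\<^sub>0 'k, 'v) module \<Rightarrow>
   ('g \<times> nat \<Rightarrow>\<^sub>0 'k, (('g \<times> nat \<Rightarrow>\<^sub>0 'k) \<times> 'v \<Rightarrow>\<^sub>0 int) set) module" where
  "induced_module G H V =
    tensor_module (group_algebra G :: ('k, 'g) hopf)
      \<lparr>carrier = carrier H, monoid.mult = monoid.mult H, one = one H, ring.zero = \<zero>\<^bsub>H\<^esub>,
       add = add H, module.smult = (\<lambda>r h. h \<otimes>\<^bsub>H\<^esub> group_to_ore r)\<rparr>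
      V
      (\<lambda>h (u, v). frag_of (h \<otimes>\<^bsub>H\<^esub> u, v))"

definition induced_quotient ::
  "('g, 'z) monoid_scheme \<Rightarrow> ('k::field, 'g \<times> nat) hopf \<Rightarrow> nat \<Rightarrow> ('g \<Rightarrow>\<^sub>0 'k, 'v) module \<Rightarrow> 'k \<Rightarrow>
   ('g \<times> nat \<Rightarrow>\<^sub>0 'k, (('g \<times> nat \<Rightarrow>\<^sub>0 'k) \<times> 'v \<Rightarrow>\<^sub>0 int) set set) module" where
  "induced_quotient G H s V \<beta> =
    (let M = induced_module G H V in
     quotient_module M
       {(ore_var G [^]\<^bsub>H\<^esub> s \<ominus>\<^bsub>H\<^esub> \<beta> \<odot>\<^bsub>H\<^esub> \<one>\<^bsub>H\<^esub>) \<odot>\<^bsub>M\<^esub> m | m. m \<in> carrier M})"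

text \<open>The permutation \<open>\<sigma>\<close> of \<open>I\<close> determined by \<open>V\<^sub>\<chi> \<otimes> V\<^sub>i \<cong> V\<^bsub>\<sigma>(i)\<^esub>\<close>.\<close>

definition twist_perm ::
  "('g, 'z) monoid_scheme \<Rightarrow> ('g \<Rightarrow> 'k::field) \<Rightarrow> 'i set \<Rightarrow> ('i \<Rightarrow> ('g \<Rightarrow>\<^sub>0 'k, 'v) module) \<Rightarrow> 'i \<Rightarrow> 'i" where
  "twist_perm G \<chi> I V = (\<lambda>i\<in>I. THE j. j \<in> I \<and>
     module_isomorphic (group_algebra G :: ('k, 'g) hopf)
       (hopf_tensor (group_algebra G) (char_module \<chi>) (V i)) (V j))"

text \<open>The equivalence relation \<open>i \<sim> j \<longleftrightarrow> i = \<sigma>\<^sup>t(j)\<close> for some \<open>t \<in> \<int>\<close>, for a permutation \<open>\<sigma>\<close> of \<open>I\<close>.\<close>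

definition orbit_rel :: "'i set \<Rightarrow> ('i \<Rightarrow> 'i) \<Rightarrow> 'i rel" where
  "orbit_rel I \<sigma> = {(i, j) \<in> I \<times> I. \<exists>t::int. i = (\<sigma> [^]\<^bsub>BijGroup I\<^esub> t) j}"

definition transversal :: "'i set \<Rightarrow> 'i rel \<Rightarrow> 'i set \<Rightarrow> bool" where
  "transversal I r J \<longleftrightarrow> J \<subseteq> I \<and> (\<forall>C\<in>I // r. \<exists>!j. j \<in> J \<inter> C)"

end

theory Submission
  imports Defs
begin

text \<open>
  Let \<open>M\<close> be a finite-dimensional simple \<open>H\<close>-module. As \<open>x\<close> commutes with \<open>kG\<close> up to the automorphisms
  \<open>g \<mapsto> \<chi>(g)\<^sup>i g\<close>, the kernel of \<open>x\<close> on \<open>M\<close> is a submodule, so \<open>x\<close> acts as zero or injectively. If it acts as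
  zero, then \<open>M\<close> is a simple \<open>kG\<close>-module (\<open>x_zero_complete\<close>). If it acts injectively, then it maps the
  eigenvectors of \<open>g \<in> G\<close> with eigenvalue \<open>\<mu>\<close> to eigenvectors with eigenvalue \<open>\<chi>(g) \<mu>\<close>. There are at most
  \<open>dim M\<close> eigenvalues, so the order of \<open>\<chi>(g)\<close> is bounded independently of \<open>g\<close> and \<open>\<chi>\<close> has finite order
  (\<open>injective_x_finite_order\<close>). This is the case \<open>|\<chi>| = \<infinity>\<close>.

  Now let \<open>|\<chi>| = |q| = s\<close>. The module \<open>V(j, \<beta>)\<close> receives a \<open>kG\<close>-linear map from \<open>V\<^sub>j\<close>, which is injective
  because \<open>H \<rightarrow> kG\<close>, \<open>g x\<^sup>i \<mapsto> \<beta>\<^sup>i\<^sup>/\<^sup>s g\<close> or \<open>0\<close>, is right \<open>kG\<close>-linear (\<open>emb_inj\<close>), and it is universal among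
  \<open>kG\<close>-linear maps from \<open>V\<^sub>j\<close> to \<open>H\<close>-modules on which \<open>x\<^sup>s\<close> is \<open>\<beta>\<close> (\<open>Q_universal\<close>). It is the sum of the
  subspaces \<open>x\<^sup>i V\<^sub>j\<close> with \<open>i < s\<close> (\<open>carrier_Q_layers\<close>). The central element \<open>a\<close> acts on \<open>V\<^sub>j\<close> as a scalar
  \<open>\<alpha>\<close> by Schur's lemma, hence on \<open>x\<^sup>i V\<^sub>j\<close> as \<open>\<alpha> q\<^sup>i\<close>, and these \<open>s\<close> scalars are distinct since \<open>|q| = s\<close>. A
  submodule therefore contains the components of its elements, and multiplying a nonzero component
  \<open>x\<^sup>i v\<close> by \<open>x\<^sup>s\<^sup>-\<^sup>i\<close> shows that a nonzero submodule meets \<open>V\<^sub>j\<close>: the module is simple (\<open>Q_simple\<close>).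

  An isomorphism \<open>V(j, \<beta>) \<rightarrow> V(l, \<gamma>)\<close> maps \<open>V\<^sub>j\<close> into an eigenspace of \<open>a\<close>, so into one \<open>x\<^sup>i V\<^sub>l\<close>. The latter
  is \<open>V\<^sub>l\<close> with the action of \<open>g\<close> multiplied by \<open>\<chi>(g)\<^sup>i\<close>, which is \<open>V\<close> at the index \<open>\<sigma>\<^sup>i(l)\<close>; so \<open>j \<sim> l\<close>
  (\<open>induced_iso_unique\<close>). Conversely, if \<open>x\<close> acts injectively on \<open>M\<close>, then the central element \<open>x\<^sup>s\<close> acts as
  a scalar \<open>\<beta> \<noteq> 0\<close>, and some \<open>V\<^sub>i\<close> embeds into \<open>M\<close> over \<open>kG\<close>. If \<open>j = \<sigma>\<^sup>n(i)\<close> represents the class of \<open>i\<close>,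
  then \<open>V\<^sub>j \<cong> x\<^sup>n V\<^sub>i \<subseteq> M\<close>, and the universal property gives a nonzero map \<open>V(j, \<beta>) \<rightarrow> M\<close> between simple
  modules (\<open>induced_complete\<close>).

  Completeness of \<open>(V\<^sub>i)\<close> is assumed for modules carried by functions on \<open>nat\<close> only. It extends to all types,
  because an injection of a finite-dimensional module into these functions transports the structure
  (\<open>complete_simples_any_type\<close>).
\<close>

section \<open>Finite-dimensional vector spaces given by records\<close>

lemma ring_of_type_algebra_simps [simp]:
  "carrier ring_of_type_algebra = UNIV"
  "x \<otimes>\<^bsub>ring_of_type_algebra\<^esub> y = x * y"
  "\<one>\<^bsub>ring_of_type_algebra\<^esub> = 1"
  "x \<oplus>\<^bsub>ring_of_type_algebra\<^esub> y = x + y"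
  "\<zero>\<^bsub>ring_of_type_algebra\<^esub> = 0"
  by (simp_all add: ring_of_type_algebra_def)

locale vspace = module "ring_of_type_algebra :: 'k::field ring" W
  for W :: "('k::field, 'm) module"
begin

lemma scale_closed [simp]: "x \<in> carrier W \<Longrightarrow> c \<odot>\<^bsub>W\<^esub> x \<in> carrier W"
  by (rule smult_closed) simp_all

lemma scale_left_distrib: "x \<in> carrier W \<Longrightarrow> (c + d) \<odot>\<^bsub>W\<^esub> x = c \<odot>\<^bsub>W\<^esub> x \<oplus>\<^bsub>W\<^esub> d \<odot>\<^bsub>W\<^esub> x"
  using smult_l_distr[of c d x] by simp

lemma scale_right_distrib:
  "\<lbrakk>x \<in> carrier W; y \<in> carrier W\<rbrakk> \<Longrightarrow> c \<odot>\<^bsub>W\<^esub> (x \<oplus>\<^bsub>W\<^esub> y) = c \<odot>\<^bsub>W\<^esub> x \<oplus>\<^bsub>W\<^esub> c \<odot>\<^bsub>W\<^esub> y"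
  using smult_r_distr[of c x y] by simp

lemma scale_scale: "x \<in> carrier W \<Longrightarrow> c \<odot>\<^bsub>W\<^esub> (d \<odot>\<^bsub>W\<^esub> x) = (c * d) \<odot>\<^bsub>W\<^esub> x"
  using smult_assoc1[of c d x] by simp

lemma scale_one [simp]: "x \<in> carrier W \<Longrightarrow> 1 \<odot>\<^bsub>W\<^esub> x = x"
  using smult_one[of x] by simp

lemma scale_zero_left [simp]: "x \<in> carrier W \<Longrightarrow> 0 \<odot>\<^bsub>W\<^esub> x = \<zero>\<^bsub>W\<^esub>"
  using smult_l_null[of x] by simp

lemma scale_zero_right [simp]: "c \<odot>\<^bsub>W\<^esub> \<zero>\<^bsub>W\<^esub> = \<zero>\<^bsub>W\<^esub>"
  using smult_r_null[of c] by simp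

lemma scale_minus: "x \<in> carrier W \<Longrightarrow> (- c) \<odot>\<^bsub>W\<^esub> x = \<ominus>\<^bsub>W\<^esub> (c \<odot>\<^bsub>W\<^esub> x)"
proof (rule minus_equality[symmetric])
  assume "x \<in> carrier W"
  then show "(- c) \<odot>\<^bsub>W\<^esub> x \<oplus>\<^bsub>W\<^esub> c \<odot>\<^bsub>W\<^esub> x = \<zero>\<^bsub>W\<^esub>"
    using scale_left_distrib[of x "- c" c] by simp
qed simp_all

lemma scale_eq_zero: "\<lbrakk>x \<in> carrier W; c \<odot>\<^bsub>W\<^esub> x = \<zero>\<^bsub>W\<^esub>; c \<noteq> 0\<rbrakk> \<Longrightarrow> x = \<zero>\<^bsub>W\<^esub>"
  using scale_scale[of x "inverse c" c] by simp

lemma subspaceI: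
  assumes "U \<subseteq> carrier W" "\<zero>\<^bsub>W\<^esub> \<in> U" "\<And>x y. \<lbrakk>x \<in> U; y \<in> U\<rbrakk> \<Longrightarrow> x \<oplus>\<^bsub>W\<^esub> y \<in> U"
    "\<And>c x. x \<in> U \<Longrightarrow> c \<odot>\<^bsub>W\<^esub> x \<in> U"
  shows "submodule U ring_of_type_algebra W"
proof (rule submoduleI)
  fix x assume "x \<in> U"
  then have "(- 1) \<odot>\<^bsub>W\<^esub> x \<in> U" "x \<in> carrier W" using assms by auto
  then show "\<ominus>\<^bsub>W\<^esub> x \<in> U" using scale_minus[of x 1] by simp
qed (use assms in auto)

end

definition spanned_by :: "('k::field, 'm) module \<Rightarrow> 'm set \<Rightarrow> bool" where
  "spanned_by W S \<longleftrightarrow> finite S \<and> S \<subseteq> carrier W \<and>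
    (\<forall>U. submodule U (ring_of_type_algebra :: 'k ring) W \<and> S \<subseteq> U \<longrightarrow> U = carrier W)"

lemma finite_dim_iff_spanned: "finite_dim A M \<longleftrightarrow> (\<exists>S. spanned_by (scalar_module A M) S)"
  by (simp add: finite_dim_def spanned_by_def scalar_module_def restrict_scalars_def)

text \<open>
  The polynomials serve as the coordinate space. They form a vector space on a type, so that
  independence and dimension in the sense of the theory \<open>Vector_Spaces\<close> apply to them, and a space is
  finite-dimensional iff it is a linear image of the polynomials of degree less than some \<open>n\<close>.
\<close>

definition linear_from_poly :: "('k::field, 'm) module \<Rightarrow> ('k poly \<Rightarrow> 'm) \<Rightarrow> bool" where
  "linear_from_poly W L \<longleftrightarrow> (\<forall>p. L p \<in> carrier W) \<and> (\<forall>p q. L (p + q) = L p \<oplus>\<^bsub>W\<^esub> L q) \<and>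
    (\<forall>c p. L (smult c p) = c \<odot>\<^bsub>W\<^esub> L p)"

abbreviation low_degree :: "nat \<Rightarrow> 'k::field poly set" where
  "low_degree n \<equiv> {p. \<forall>i\<ge>n. Polynomial.coeff p i = 0}"

definition poly_cover :: "('k::field, 'm) module \<Rightarrow> nat \<Rightarrow> ('k poly \<Rightarrow> 'm) \<Rightarrow> bool" where
  "poly_cover W n L \<longleftrightarrow> linear_from_poly W L \<and> L ` low_degree n = carrier W"

interpretation poly_vs: vector_space "smult :: 'k::field \<Rightarrow> 'k poly \<Rightarrow> 'k poly"
  by unfold_locales (auto simp: smult_add_right smult_add_left)

lemma low_degree_span: "low_degree n = poly_vs.span (Polynomial.monom (1::'k::field) ` {..<n})"
proof
  show "low_degree n \<subseteq> poly_vs.span (Polynomial.monom (1::'k::field) ` {..<n})"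
  proof
    fix p :: "'k poly" assume p: "p \<in> low_degree n"
    have "p = (\<Sum>i<n. smult (Polynomial.coeff p i) (Polynomial.monom 1 i))"
      by (rule poly_eqI) (use p in \<open>auto simp: Polynomial.coeff_sum sum.delta not_less if_distrib cong: if_cong\<close>)
    then show "p \<in> poly_vs.span (Polynomial.monom (1::'k::field) ` {..<n})"
      by (metis (no_types, lifting) image_eqI poly_vs.span_base poly_vs.span_scale poly_vs.span_sum)
  qed
  show "poly_vs.span (Polynomial.monom (1::'k::field) ` {..<n}) \<subseteq> low_degree n"
    by (rule poly_vs.span_minimal) (auto simp: poly_vs.subspace_def)
qed

lemma low_degree_independent_bound:
  assumes "poly_vs.independent B" "B \<subseteq> low_degree n"
  shows "finite B \<and> card B \<le> n"
proof -
  have *: "finite B \<and> card B \<le> card (Polynomial.monom (1::'a) ` {..<n})"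
    using assms unfolding low_degree_span by (intro poly_vs.independent_span_bound) auto
  have "card (Polynomial.monom (1::'a) ` {..<n}) \<le> n" using card_image_le[of "{..<n}"] by fastforce
  with * show ?thesis by linarith
qed

lemma submodule_zero: "submodule U R M \<Longrightarrow> \<zero>\<^bsub>M\<^esub> \<in> U"
  using subgroup.one_closed[OF submodule.axioms(1)] by fastforce

context vspace
begin

lemma linear_from_poly_zero: "linear_from_poly W L \<Longrightarrow> L 0 = \<zero>\<^bsub>W\<^esub>"
  unfolding linear_from_poly_def by (metis scale_zero_left smult_0_left)

lemma preimage_subspace:
  assumes "linear_from_poly W L" "submodule U ring_of_type_algebra W"
  shows "poly_vs.subspace {p \<in> low_degree n. L p \<in> U}"
  using assms submoduleE[OF assms(2)] linear_from_poly_zero[OF assms(1)]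
  unfolding poly_vs.subspace_def linear_from_poly_def
  by (auto simp: submodule_zero[OF assms(2)])

lemma linear_combination_from_poly:
  assumes w: "\<And>i. i < n \<Longrightarrow> w i \<in> carrier W"
  shows "linear_from_poly W (\<lambda>p. \<Oplus>\<^bsub>W\<^esub>i\<in>{..<n}. Polynomial.coeff p i \<odot>\<^bsub>W\<^esub> w i)"
  unfolding linear_from_poly_def
proof (intro conjI allI)
  show "(\<Oplus>\<^bsub>W\<^esub>i\<in>{..<n}. Polynomial.coeff p i \<odot>\<^bsub>W\<^esub> w i) \<in> carrier W" for p
    by (rule finsum_closed) (auto simp: w)
  show "(\<Oplus>\<^bsub>W\<^esub>i\<in>{..<n}. Polynomial.coeff (p + q) i \<odot>\<^bsub>W\<^esub> w i) =
      (\<Oplus>\<^bsub>W\<^esub>i\<in>{..<n}. Polynomial.coeff p i \<odot>\<^bsub>W\<^esub> w i) \<oplus>\<^bsub>W\<^esub> (\<Oplus>\<^bsub>W\<^esub>i\<in>{..<n}. Polynomial.coeff q i \<odot>\<^bsub>W\<^esub> w i)"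
    for p q
    by (subst finsum_addf[symmetric]) (simp_all add: w scale_left_distrib Pi_def cong: finsum_cong)
  show "(\<Oplus>\<^bsub>W\<^esub>i\<in>{..<n}. Polynomial.coeff (smult c p) i \<odot>\<^bsub>W\<^esub> w i) =
      c \<odot>\<^bsub>W\<^esub> (\<Oplus>\<^bsub>W\<^esub>i\<in>{..<n}. Polynomial.coeff p i \<odot>\<^bsub>W\<^esub> w i)" for c p
    by (subst finsum_smult_ldistr) (auto simp: w scale_scale intro!: finsum_cong')
qed

text \<open>
  The coefficients of a polynomial are the coordinates with respect to a list of spanning vectors.
\<close>

lemma poly_cover_exists:
  assumes "spanned_by W S"
  shows "\<exists>n L. poly_cover W n L"
proof -
  have S: "finite S" "S \<subseteq> carrier W" using assms by (auto simp: spanned_by_def)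
  obtain xs where xs: "set xs = S" using S finite_list by blast
  define L where "L = (\<lambda>p. \<Oplus>\<^bsub>W\<^esub>i\<in>{..<length xs}. Polynomial.coeff p i \<odot>\<^bsub>W\<^esub> (xs ! i))"
  have nth: "xs ! i \<in> carrier W" if "i < length xs" for i using that xs S by auto
  have L: "linear_from_poly W L"
    unfolding L_def by (rule linear_combination_from_poly) (rule nth)
  have "L ` low_degree (length xs) = carrier W"
  proof -
    have "submodule (L ` low_degree (length xs)) ring_of_type_algebra W"
    proof (rule subspaceI)
      show "\<zero>\<^bsub>W\<^esub> \<in> L ` low_degree (length xs)"
        by (rule image_eqI[of _ _ 0]) (simp_all add: linear_from_poly_zero[OF L])
    next
      fix x y assume "x \<in> L ` low_degree (length xs)" "y \<in> L ` low_degree (length xs)"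
      then obtain p q where "x = L p" "y = L q" "p \<in> low_degree (length xs)" "q \<in> low_degree (length xs)"
        by blast
      then show "x \<oplus>\<^bsub>W\<^esub> y \<in> L ` low_degree (length xs)"
        using L by (intro image_eqI[of _ _ "p + q"]) (auto simp: linear_from_poly_def)
    next
      fix c x assume "x \<in> L ` low_degree (length xs)"
      then obtain p where "x = L p" "p \<in> low_degree (length xs)" by blast
      then show "c \<odot>\<^bsub>W\<^esub> x \<in> L ` low_degree (length xs)"
        using L by (intro image_eqI[of _ _ "smult c p"]) (auto simp: linear_from_poly_def)
    qed (use L in \<open>auto simp: linear_from_poly_def\<close>)
    moreover have "S \<subseteq> L ` low_degree (length xs)"
    proof
      fix x assume "x \<in> S"
      then obtain i where i: "i < length xs" "x = xs ! i" using xs by (metis in_set_conv_nth)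
      have "L (Polynomial.monom 1 i) = (\<Oplus>\<^bsub>W\<^esub>j\<in>{..<length xs}. if i = j then xs ! j else \<zero>\<^bsub>W\<^esub>)"
        unfolding L_def by (rule finsum_cong') (auto simp: nth)
      also have "\<dots> = x"
        using i nth by (subst finsum_singleton) auto
      finally show "x \<in> L ` low_degree (length xs)"
        using i by (intro image_eqI[of _ _ "Polynomial.monom 1 i"]) auto
    qed
    ultimately show ?thesis using assms by (auto simp: spanned_by_def)
  qed
  then show ?thesis using L by (auto simp: poly_cover_def)
qed

lemma poly_cover_lift:
  assumes "poly_cover W n L" "x \<in> carrier W"
  obtains p where "p \<in> low_degree n" "L p = x"
proof -
  from assms have "x \<in> L ` low_degree n" by (simp add: poly_cover_def)
  then show thesis using that by blast
qed

text \<open>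
  More than \<open>n\<close> vectors in an \<open>n\<close>-dimensional space are dependent; here the vectors are the values
  of a linear map at the powers of the indeterminate.
\<close>

lemma linear_from_poly_kernel:
  assumes cover: "poly_cover W n P" and L: "linear_from_poly W L"
  shows "\<exists>p. p \<noteq> 0 \<and> Polynomial.degree p \<le> n \<and> L p = \<zero>\<^bsub>W\<^esub>"
proof -
  have P: "linear_from_poly W P" "P ` low_degree n = carrier W"
    using cover by (auto simp: poly_cover_def)
  have "\<forall>i. \<exists>q. q \<in> low_degree n \<and> P q = L (Polynomial.monom 1 i)"
  proof
    fix i
    have "L (Polynomial.monom 1 i) \<in> carrier W" using L by (simp add: linear_from_poly_def)
    then obtain q where "q \<in> low_degree n" "P q = L (Polynomial.monom 1 i)"
      by (rule poly_cover_lift[OF cover])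
    then show "\<exists>q. q \<in> low_degree n \<and> P q = L (Polynomial.monom 1 i)" by blast
  qed
  from choice[OF this] obtain q where
    q: "q i \<in> low_degree n" "P (q i) = L (Polynomial.monom 1 i)" for i by blast
  have sum: "L (\<Sum>i\<in>A. smult (c i) (Polynomial.monom 1 i)) = P (\<Sum>i\<in>A. smult (c i) (q i))" for c and A :: "nat set"
  proof (induction A rule: infinite_finite_induct)
    case (insert i A)
    then show ?case using L P(1) q(2) by (simp add: linear_from_poly_def)
  qed (simp_all add: linear_from_poly_zero[OF L] linear_from_poly_zero[OF P(1)])
  \<comment> \<open>The lifts of the \<open>n + 1\<close> vectors are dependent, or two of them coincide.\<close>
  have "\<exists>c :: nat \<Rightarrow> 'k. (\<exists>i\<le>n. c i \<noteq> 0) \<and> (\<Sum>i\<le>n. smult (c i) (q i)) = 0"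
  proof (cases "inj_on q {..n}")
    case True
    have "q ` {..n} \<subseteq> low_degree n" using q(1) by blast
    moreover have "card (q ` {..n}) = Suc n" using card_image[OF True] by simp
    ultimately have "poly_vs.dependent (q ` {..n})"
      using low_degree_independent_bound[of "q ` {..n}" n] by linarith
    moreover have "finite (q ` {..n})" by simp
    ultimately obtain u where u: "\<exists>v\<in>q ` {..n}. u v \<noteq> 0" "(\<Sum>v\<in>q ` {..n}. smult (u v) v) = 0"
      using poly_vs.dependent_finite by blast
    have "(\<Sum>i\<le>n. smult (u (q i)) (q i)) = 0"
      using u(2) by (simp add: sum.reindex[OF True])
    then show ?thesis using u(1) by (intro exI[of _ "\<lambda>i. u (q i)"]) auto
  next
    case False
    then obtain i j where ij: "i \<le> n" "j \<le> n" "i \<noteq> j" "q i = q j" by (auto simp: inj_on_def)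
    let ?c = "\<lambda>l. (if l = i then 1 else 0) - (if l = j then 1 else 0 :: 'k)"
    have "(\<Sum>l\<le>n. smult (?c l) (q l)) = (\<Sum>l\<le>n. if l = i then q l else 0) - (\<Sum>l\<le>n. if l = j then q l else 0)"
      unfolding sum_subtractf[symmetric] by (rule sum.cong) auto
    also have "\<dots> = 0" using ij by (simp add: sum.delta)
    finally have "(\<Sum>l\<le>n. smult (?c l) (q l)) = 0" .
    moreover have "?c i \<noteq> 0" using ij by simp
    ultimately show ?thesis by (intro exI[of _ ?c] conjI exI[of _ i]) (use ij in auto)
  qed
  then obtain c :: "nat \<Rightarrow> 'k" where c: "\<exists>i\<le>n. c i \<noteq> 0" "(\<Sum>i\<le>n. smult (c i) (q i)) = 0" by blast
  define p where "p = (\<Sum>i\<le>n. smult (c i) (Polynomial.monom 1 i))"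
  have cf: "Polynomial.coeff p i = (if i \<le> n then c i else 0)" for i
  proof -
    have "Polynomial.coeff p i = (\<Sum>l\<le>n. if l = i then c l else 0)"
      unfolding p_def Polynomial.coeff_sum by (rule sum.cong) auto
    then show ?thesis by (simp add: sum.delta)
  qed
  from c(1) obtain i where "i \<le> n" "c i \<noteq> 0" by blast
  then have "Polynomial.coeff p i \<noteq> 0" by (simp add: cf)
  then have "p \<noteq> 0" by auto
  moreover have "Polynomial.degree p \<le> n" by (rule Polynomial.degree_le) (auto simp: cf)
  moreover have "L p = \<zero>\<^bsub>W\<^esub>"
    unfolding p_def sum c(2) by (rule linear_from_poly_zero[OF P(1)])
  ultimately show ?thesis by blast
qed

text \<open>
  The preimage of a subspace under the covering map has a finite basis, whose image spans the subspace.
\<close>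

lemma subspace_spanned_by_finite:
  assumes cover: "poly_cover W n L" and U: "submodule U ring_of_type_algebra W"
  shows "\<exists>S. finite S \<and> S \<subseteq> U \<and> (\<forall>U'. submodule U' ring_of_type_algebra W \<and> S \<subseteq> U' \<longrightarrow> U \<subseteq> U')"
proof -
  have L: "linear_from_poly W L" "L ` low_degree n = carrier W"
    using cover by (auto simp: poly_cover_def)
  let ?V = "\<lambda>U. {p \<in> low_degree n. L p \<in> U}"
  obtain B where B: "B \<subseteq> ?V U" "poly_vs.independent B" "?V U \<subseteq> poly_vs.span B"
    by (rule poly_vs.basis_exists[of "?V U"])
  have "finite B" using low_degree_independent_bound[OF B(2), of n] B(1) by auto
  moreover have "U \<subseteq> U'" if U': "submodule U' ring_of_type_algebra W" "L ` B \<subseteq> U'" for U'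
  proof
    fix u assume "u \<in> U"
    then obtain p where p: "p \<in> low_degree n" "L p = u"
      using poly_cover_lift[OF cover, of u] submoduleE(1)[OF U] by blast
    then have "p \<in> poly_vs.span B" using B(3) \<open>u \<in> U\<close> by blast
    also have "poly_vs.span B \<subseteq> ?V U'"
      using B(1) U' by (intro poly_vs.span_minimal preimage_subspace[OF L(1)]) auto
    finally show "u \<in> U'" using p by auto
  qed
  ultimately show ?thesis using B(1) by (intro exI[of _ "L ` B"]) auto
qed

text \<open>
  The dimension of the preimage is a measure of subspaces by which minimal submodules can be chosen.
\<close>

lemma subspace_dim_less:
  assumes cover: "poly_cover W n L" and U: "submodule U ring_of_type_algebra W"
    and U': "submodule U' ring_of_type_algebra W" "U \<subset> U'"
  shows "poly_vs.dim {p \<in> low_degree n. L p \<in> U} < poly_vs.dim {p \<in> low_degree n. L p \<in> U'}"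
proof -
  have L: "linear_from_poly W L" "L ` low_degree n = carrier W"
    using cover by (auto simp: poly_cover_def)
  let ?V = "\<lambda>U. {p \<in> low_degree n. L p \<in> U}"
  obtain B where B: "B \<subseteq> ?V U" "poly_vs.independent B" "?V U \<subseteq> poly_vs.span B" "card B = poly_vs.dim (?V U)"
    by (rule poly_vs.basis_exists[of "?V U"])
  obtain B' where B': "B' \<subseteq> ?V U'" "poly_vs.independent B'" "?V U' \<subseteq> poly_vs.span B'"
    "card B' = poly_vs.dim (?V U')"
    by (rule poly_vs.basis_exists[of "?V U'"])
  obtain u where u: "u \<in> U'" "u \<notin> U" using U'(2) by blast
  then obtain p where p: "p \<in> low_degree n" "L p = u"
    using poly_cover_lift[OF cover, of u] submoduleE(1)[OF U'(1)] by blast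
  have "poly_vs.span B \<subseteq> ?V U"
    using B(1) by (intro poly_vs.span_minimal preimage_subspace[OF L(1) U])
  then have "p \<notin> poly_vs.span B" using p u by auto
  then have "poly_vs.independent (insert p B)" "p \<notin> B"
    using B(2) poly_vs.span_base[of p B] by (auto simp: poly_vs.independent_insert)
  moreover have "insert p B \<subseteq> poly_vs.span B'"
    using p u B(1) B'(3) U'(2) by blast
  moreover have "finite B" "finite B'"
    using low_degree_independent_bound[OF B(2), of n] B(1) low_degree_independent_bound[OF B'(2), of n] B'(1) by auto
  ultimately have "card (insert p B) \<le> card B'"
    using poly_vs.independent_span_bound by blast
  then show ?thesis using \<open>p \<notin> B\<close> \<open>finite B\<close> B(4) B'(4) by simp
qed

subsection \<open>Eigenvectors\<close>

definition linear_op :: "('m \<Rightarrow> 'm) \<Rightarrow> bool" where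
  "linear_op T \<longleftrightarrow> (\<forall>x\<in>carrier W. T x \<in> carrier W) \<and>
    (\<forall>x\<in>carrier W. \<forall>y\<in>carrier W. T (x \<oplus>\<^bsub>W\<^esub> y) = T x \<oplus>\<^bsub>W\<^esub> T y) \<and>
    (\<forall>c. \<forall>x\<in>carrier W. T (c \<odot>\<^bsub>W\<^esub> x) = c \<odot>\<^bsub>W\<^esub> T x)"

lemma linear_opD:
  assumes "linear_op T" "x \<in> carrier W"
  shows "T x \<in> carrier W" "y \<in> carrier W \<Longrightarrow> T (x \<oplus>\<^bsub>W\<^esub> y) = T x \<oplus>\<^bsub>W\<^esub> T y"
    "T (c \<odot>\<^bsub>W\<^esub> x) = c \<odot>\<^bsub>W\<^esub> T x"
  using assms by (auto simp: linear_op_def)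

lemma linear_op_zero: "linear_op T \<Longrightarrow> T \<zero>\<^bsub>W\<^esub> = \<zero>\<^bsub>W\<^esub>"
  using linear_opD(3)[of T "\<zero>\<^bsub>W\<^esub>" 0] linear_opD(1)[of T "\<zero>\<^bsub>W\<^esub>"] by simp

text \<open>The vector \<open>p(T) v\<close>, by Horner's rule.\<close>

definition poly_op :: "('m \<Rightarrow> 'm) \<Rightarrow> 'm \<Rightarrow> 'k poly \<Rightarrow> 'm" where
  "poly_op T v p = fold_coeffs (\<lambda>c w. c \<odot>\<^bsub>W\<^esub> v \<oplus>\<^bsub>W\<^esub> T w) p \<zero>\<^bsub>W\<^esub>"

lemma poly_op_0 [simp]: "poly_op T v 0 = \<zero>\<^bsub>W\<^esub>"
  by (simp add: poly_op_def)

lemma poly_op_pCons: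
  assumes "linear_op T" "v \<in> carrier W"
  shows "poly_op T v (pCons c p) = c \<odot>\<^bsub>W\<^esub> v \<oplus>\<^bsub>W\<^esub> T (poly_op T v p)"
  using assms linear_op_zero[OF assms(1)]
  by (cases "c = 0"; cases "p = 0") (simp_all add: poly_op_def)

lemma poly_op_closed:
  assumes "linear_op T" "v \<in> carrier W"
  shows "poly_op T v p \<in> carrier W"
  by (induction p) (use assms in \<open>auto simp: poly_op_pCons linear_opD\<close>)

lemma poly_op_linear:
  assumes T: "linear_op T" and v: "v \<in> carrier W"
  shows "linear_from_poly W (poly_op T v)"
proof -
  note cl = poly_op_closed[OF T v]
  have "poly_op T v (p + q) = poly_op T v p \<oplus>\<^bsub>W\<^esub> poly_op T v q" for p q
  proof (induction p arbitrary: q)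
    case 0
    then show ?case using cl by simp
  next
    case (pCons c p)
    obtain d q' where q: "q = pCons d q'" by (cases q)
    show ?case
      using v cl by (simp add: q poly_op_pCons[OF T v] pCons.IH linear_opD[OF T] scale_left_distrib a_ac)
  qed
  moreover have "poly_op T v (smult c p) = c \<odot>\<^bsub>W\<^esub> poly_op T v p" for c p
    by (induction p)
      (use v cl in \<open>auto simp: poly_op_pCons[OF T v] linear_opD[OF T] scale_right_distrib scale_scale\<close>)
  ultimately show ?thesis using cl by (simp add: linear_from_poly_def)
qed

lemma poly_op_linear_factor:
  assumes T: "linear_op T" and v: "v \<in> carrier W"
  shows "poly_op T v ([:- r, 1:] * q) = T (poly_op T v q) \<ominus>\<^bsub>W\<^esub> r \<odot>\<^bsub>W\<^esub> poly_op T v q"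
proof -
  note cl = poly_op_closed[OF T v]
  have "[:- r, 1:] * q = smult (- r) q + pCons 0 q" by simp
  then have "poly_op T v ([:- r, 1:] * q) = (- r) \<odot>\<^bsub>W\<^esub> poly_op T v q \<oplus>\<^bsub>W\<^esub> T (poly_op T v q)"
    using poly_op_linear[OF T v] v cl linear_opD[OF T]
    by (simp only: linear_from_poly_def poly_op_pCons[OF T v]) simp
  then show ?thesis
    using cl linear_opD[OF T] by (simp add: scale_minus a_minus_def a_comm)
qed

text \<open>
  Applying \<open>T - \<lambda>\<^sub>j\<close> to a sum of eigenvectors with distinct eigenvalues removes the \<open>j\<close>-th term and
  multiplies the others by nonzero scalars, so the claim follows by induction on the number of terms.
\<close>

lemma eigenvector_components:
  assumes T: "linear_op T" and N: "submodule N ring_of_type_algebra W" and inv: "\<And>x. x \<in> N \<Longrightarrow> T x \<in> N"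
  shows "\<lbrakk>finite A; w \<in> A \<rightarrow> carrier W; \<And>i. i \<in> A \<Longrightarrow> T (w i) = l i \<odot>\<^bsub>W\<^esub> w i; inj_on l A;
    (\<Oplus>\<^bsub>W\<^esub>i\<in>A. w i) \<in> N\<rbrakk> \<Longrightarrow> \<forall>i\<in>A. w i \<in> N"
proof (induction A arbitrary: w rule: finite_induct)
  case (insert j A)
  note sub = submoduleE[OF N]
  have w: "w i \<in> carrier W" if "i \<in> insert j A" for i using insert.prems(1) that by auto
  have wA: "w \<in> A \<rightarrow> carrier W" using w by auto
  let ?s = "\<Oplus>\<^bsub>W\<^esub>i\<in>A. w i"
  have s: "?s \<in> carrier W" using wA by (rule finsum_closed)
  have total: "w j \<oplus>\<^bsub>W\<^esub> ?s \<in> N" using insert w wA by (simp add: finsum_insert)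
  have comb: "(\<Oplus>\<^bsub>W\<^esub>i\<in>B. (l i - l j) \<odot>\<^bsub>W\<^esub> w i) = T (\<Oplus>\<^bsub>W\<^esub>i\<in>B. w i) \<oplus>\<^bsub>W\<^esub> (- l j) \<odot>\<^bsub>W\<^esub> (\<Oplus>\<^bsub>W\<^esub>i\<in>B. w i)"
    if "B \<subseteq> A" for B
    using finite_subset[OF that \<open>finite A\<close>] that
  proof (induction B rule: finite_induct)
    case empty
    then show ?case by (simp add: linear_op_zero[OF T])
  next
    case (insert i B)
    have i: "w i \<in> carrier W" "T (w i) = l i \<odot>\<^bsub>W\<^esub> w i" "w \<in> B \<rightarrow> carrier W"
      using insert.prems wA \<open>\<And>i. i \<in> insert j A \<Longrightarrow> T (w i) = l i \<odot>\<^bsub>W\<^esub> w i\<close> by auto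
    have "(l i - l j) \<odot>\<^bsub>W\<^esub> w i = l i \<odot>\<^bsub>W\<^esub> w i \<oplus>\<^bsub>W\<^esub> (- l j) \<odot>\<^bsub>W\<^esub> w i"
      using scale_left_distrib[OF i(1), of "l i" "- l j"] by simp
    moreover have "(\<Oplus>\<^bsub>W\<^esub>i\<in>B. w i) \<in> carrier W" using i(3) by (rule finsum_closed)
    moreover have "(\<lambda>i. (l i - l j) \<odot>\<^bsub>W\<^esub> w i) \<in> B \<rightarrow> carrier W" using i(3) by auto
    ultimately show ?case
      using insert i by (simp add: finsum_insert linear_opD[OF T] scale_right_distrib a_ac)
  qed
  have Tj: "T (w j) = l j \<odot>\<^bsub>W\<^esub> w j" using insert.prems(2) by simp
  have cancel: "l j \<odot>\<^bsub>W\<^esub> w j \<oplus>\<^bsub>W\<^esub> (- l j) \<odot>\<^bsub>W\<^esub> w j = \<zero>\<^bsub>W\<^esub>"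
    using scale_left_distrib[of "w j" "l j" "- l j"] w[of j] by simp
  have "T (w j \<oplus>\<^bsub>W\<^esub> ?s) \<oplus>\<^bsub>W\<^esub> (- l j) \<odot>\<^bsub>W\<^esub> (w j \<oplus>\<^bsub>W\<^esub> ?s)
      = (l j \<odot>\<^bsub>W\<^esub> w j \<oplus>\<^bsub>W\<^esub> (- l j) \<odot>\<^bsub>W\<^esub> w j) \<oplus>\<^bsub>W\<^esub> (T ?s \<oplus>\<^bsub>W\<^esub> (- l j) \<odot>\<^bsub>W\<^esub> ?s)"
    using w[of j] s linear_opD[OF T] Tj by (simp add: scale_right_distrib a_ac)
  also have "\<dots> = (\<Oplus>\<^bsub>W\<^esub>i\<in>A. (l i - l j) \<odot>\<^bsub>W\<^esub> w i)"
    using comb[of A] s linear_opD(1)[OF T s] by (simp add: cancel)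
  finally have "(\<Oplus>\<^bsub>W\<^esub>i\<in>A. (l i - l j) \<odot>\<^bsub>W\<^esub> w i) \<in> N"
    using sub(5)[OF inv[OF total] sub(4)[OF _ total, of "- l j"]] by simp
  then have *: "\<forall>i\<in>A. (l i - l j) \<odot>\<^bsub>W\<^esub> w i \<in> N"
    using insert.prems(2,3) wA
    by (intro insert.IH) (auto simp: linear_opD[OF T] scale_scale mult.commute inj_on_def Pi_def)
  have A: "w i \<in> N" if i: "i \<in> A" for i
  proof -
    have "l i - l j \<noteq> 0" using insert.prems(3) i \<open>j \<notin> A\<close> by (auto simp: inj_on_def)
    then have "w i = inverse (l i - l j) \<odot>\<^bsub>W\<^esub> ((l i - l j) \<odot>\<^bsub>W\<^esub> w i)"
      using w i by (simp add: scale_scale)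
    then show ?thesis using * i sub(4)[of "inverse (l i - l j)"] by force
  qed
  have "?s \<in> N"
  proof -
    have "(\<Oplus>\<^bsub>W\<^esub>i\<in>B. w i) \<in> N" if "B \<subseteq> A" for B
      using finite_subset[OF that \<open>finite A\<close>] that
    proof (induction B rule: finite_induct)
      case empty
      then show ?case by (simp add: submodule_zero[OF N])
    next
      case (insert i B)
      have "w \<in> B \<rightarrow> carrier W" "w i \<in> carrier W" using insert.prems wA by auto
      then show ?case using insert A sub(5) by (simp add: finsum_insert)
    qed
    then show ?thesis by blast
  qed
  then have "(w j \<oplus>\<^bsub>W\<^esub> ?s) \<oplus>\<^bsub>W\<^esub> (\<ominus>\<^bsub>W\<^esub> ?s) \<in> N" using total sub(3,5) by blast
  also have "(w j \<oplus>\<^bsub>W\<^esub> ?s) \<oplus>\<^bsub>W\<^esub> (\<ominus>\<^bsub>W\<^esub> ?s) = w j" using w[of j] s by (simp add: a_assoc r_neg)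
  finally show ?case using A by simp
qed simp

lemma zero_subspace: "submodule {\<zero>\<^bsub>W\<^esub>} ring_of_type_algebra W"
  by (rule subspaceI) auto

end

text \<open>
  Some \<open>p \<noteq> 0\<close> satisfies \<open>p(T) v = 0\<close>. Take \<open>p\<close> of minimal degree and split off a root \<open>r\<close>, that is,
  \<open>p = (X - r) q\<close>. Then \<open>q(T) v\<close> is not zero, and it is an eigenvector with eigenvalue \<open>r\<close>.
\<close>

lemma (in vspace) eigenvector_exists_if_poly:
  assumes closed: "\<And>p :: 'k poly. Polynomial.degree p > 0 \<Longrightarrow> \<exists>z. poly p z = 0"
    and cover: "poly_cover W n L" and T: "linear_op T" and v: "v \<in> carrier W" "v \<noteq> \<zero>\<^bsub>W\<^esub>"
  shows "\<exists>w\<in>carrier W. \<exists>r. w \<noteq> \<zero>\<^bsub>W\<^esub> \<and> T w = r \<odot>\<^bsub>W\<^esub> w"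
proof -
  let ?P = "\<lambda>p. p \<noteq> 0 \<and> poly_op T v p = \<zero>\<^bsub>W\<^esub>"
  obtain p where p: "?P p" and min: "\<And>q. ?P q \<Longrightarrow> Polynomial.degree p \<le> degree q"
  proof -
    obtain p where "?P p" using linear_from_poly_kernel[OF cover poly_op_linear[OF T v(1)]] by blast
    then show thesis
      using that[of "arg_min Polynomial.degree ?P"] arg_min_natI[of ?P p] arg_min_nat_le[of ?P _ Polynomial.degree]
      by simp
  qed
  have "Polynomial.degree p > 0"
  proof (rule ccontr)
    assume "\<not> Polynomial.degree p > 0"
    then obtain c where "p = [:c:]" by (metis degree_eq_zeroE neq0_conv)
    then show False
      using p v scale_eq_zero[OF v(1), of c] by (auto simp: poly_op_pCons[OF T v(1)] linear_op_zero[OF T])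
  qed
  then obtain r where "poly p r = 0" using closed by blast
  then have "[:- r, 1:] dvd p" by (simp only: poly_eq_0_iff_dvd)
  then obtain q where q: "p = [:- r, 1:] * q" by (rule dvdE)
  have "q \<noteq> 0" using p q by auto
  then have "Polynomial.degree p = Suc (Polynomial.degree q)" unfolding q by (subst Polynomial.degree_mult_eq) auto
  then have "poly_op T v q \<noteq> \<zero>\<^bsub>W\<^esub>" using min[of q] \<open>q \<noteq> 0\<close> by force
  moreover have "T (poly_op T v q) = r \<odot>\<^bsub>W\<^esub> poly_op T v q"
  proof -
    note closed = poly_op_closed[OF T v(1), of q] linear_opD(1)[OF T poly_op_closed[OF T v(1), of q]]
    have "T (poly_op T v q) \<ominus>\<^bsub>W\<^esub> r \<odot>\<^bsub>W\<^esub> poly_op T v q = \<zero>\<^bsub>W\<^esub>"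
      using p unfolding q poly_op_linear_factor[OF T v(1), of r q] by blast
    then show ?thesis
      using closed M.minus_equality[of "T (poly_op T v q)" "\<ominus>\<^bsub>W\<^esub> (r \<odot>\<^bsub>W\<^esub> poly_op T v q)"]
      by (simp add: a_minus_def)
  qed
  ultimately show ?thesis using poly_op_closed[OF T v(1), of q] by blast
qed

lemma eigenvector_exists:
  fixes W :: "('k::alg_closed_field, 'm) module"
  assumes "vspace W" "poly_cover W n L" "vspace.linear_op W T" "v \<in> carrier W" "v \<noteq> \<zero>\<^bsub>W\<^esub>"
  shows "\<exists>w\<in>carrier W. \<exists>r. w \<noteq> \<zero>\<^bsub>W\<^esub> \<and> T w = r \<odot>\<^bsub>W\<^esub> w"
  by (rule vspace.eigenvector_exists_if_poly[OF assms(1) _ assms(2-)]) (rule alg_closed_imp_poly_has_root)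

section \<open>Left modules over a ring and over an algebra\<close>

lemma abelian_group_cong:
  assumes "abelian_group M" "carrier N = carrier M" "add N = add M" "\<zero>\<^bsub>N\<^esub> = \<zero>\<^bsub>M\<^esub>"
  shows "abelian_group N"
proof -
  interpret M: abelian_group M by fact
  show ?thesis
    by (rule abelian_groupI) (auto simp: assms(2-) M.a_assoc intro: M.a_comm bexI[of _ "\<ominus>\<^bsub>M\<^esub> _"] M.l_neg)
qed

lemma restrict_scalars_simps [simp]:
  "carrier (restrict_scalars f M) = carrier M"
  "x \<oplus>\<^bsub>restrict_scalars f M\<^esub> y = x \<oplus>\<^bsub>M\<^esub> y"
  "\<zero>\<^bsub>restrict_scalars f M\<^esub> = \<zero>\<^bsub>M\<^esub>"
  "r \<odot>\<^bsub>restrict_scalars f M\<^esub> x = f r \<odot>\<^bsub>M\<^esub> x"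
  "add (restrict_scalars f M) = add M"
  by (simp_all add: restrict_scalars_def)

lemma scalar_module_simps [simp]:
  "carrier (scalar_module A M) = carrier M"
  "x \<oplus>\<^bsub>scalar_module A M\<^esub> y = x \<oplus>\<^bsub>M\<^esub> y"
  "\<zero>\<^bsub>scalar_module A M\<^esub> = \<zero>\<^bsub>M\<^esub>"
  "c \<odot>\<^bsub>scalar_module A M\<^esub> x = (c \<odot>\<^bsub>A\<^esub> \<one>\<^bsub>A\<^esub>) \<odot>\<^bsub>M\<^esub> x"
  "add (scalar_module A M) = add M"
  by (simp_all add: scalar_module_def)

lemma submodule_subset: "submodule U R M \<Longrightarrow> U \<subseteq> carrier M"
  using subgroup.subset[OF submodule.axioms(1)] by fastforce

lemma submodule_add: "\<lbrakk>submodule U R M; x \<in> U; y \<in> U\<rbrakk> \<Longrightarrow> x \<oplus>\<^bsub>M\<^esub> y \<in> U"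
  using subgroup.m_closed[OF submodule.axioms(1)] by fastforce

lemma submodule_minus: "\<lbrakk>submodule U R M; x \<in> U\<rbrakk> \<Longrightarrow> \<ominus>\<^bsub>M\<^esub> x \<in> U"
  using subgroup.m_inv_closed[OF submodule.axioms(1)] by (fastforce simp: a_inv_def)

lemmas submodule_smult = submodule.smult_closed

lemma submodule_transfer:
  assumes U: "submodule U R M" and eq: "carrier N = carrier M" "add N = add M" "\<zero>\<^bsub>N\<^esub> = \<zero>\<^bsub>M\<^esub>"
    and smult: "\<And>t x. \<lbrakk>t \<in> carrier T; x \<in> U\<rbrakk> \<Longrightarrow> t \<odot>\<^bsub>N\<^esub> x \<in> U"
  shows "submodule U T N"
proof (intro submodule.intro subgroup.intro submodule_axioms.intro)
  fix x assume "x \<in> U"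
  then have "\<ominus>\<^bsub>M\<^esub> x \<in> U" by (rule submodule_minus[OF U])
  then show "inv\<^bsub>add_monoid N\<^esub> x \<in> U" by (simp add: a_inv_def m_inv_def eq)
qed (use submodule_subset[OF U] submodule_zero[OF U] submodule_add[OF U] smult in \<open>auto simp: eq\<close>)

context left_module
begin

lemma smult_zero_left: "x \<in> carrier M \<Longrightarrow> \<zero>\<^bsub>R\<^esub> \<odot>\<^bsub>M\<^esub> x = \<zero>\<^bsub>M\<^esub>"
  using smult_l_distr[of "\<zero>\<^bsub>R\<^esub>" "\<zero>\<^bsub>R\<^esub>" x] smult_closed[of "\<zero>\<^bsub>R\<^esub>" x]
  by simp

lemma smult_zero_right: "r \<in> carrier R \<Longrightarrow> r \<odot>\<^bsub>M\<^esub> \<zero>\<^bsub>M\<^esub> = \<zero>\<^bsub>M\<^esub>"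
  using smult_r_distr[of r "\<zero>\<^bsub>M\<^esub>" "\<zero>\<^bsub>M\<^esub>"] smult_closed[of r "\<zero>\<^bsub>M\<^esub>"]
  by simp

lemma smult_minus_left:
  assumes "r \<in> carrier R" "x \<in> carrier M"
  shows "(\<ominus>\<^bsub>R\<^esub> r) \<odot>\<^bsub>M\<^esub> x = \<ominus>\<^bsub>M\<^esub> (r \<odot>\<^bsub>M\<^esub> x)"
proof (rule M.minus_equality[symmetric])
  show "(\<ominus>\<^bsub>R\<^esub> r) \<odot>\<^bsub>M\<^esub> x \<oplus>\<^bsub>M\<^esub> r \<odot>\<^bsub>M\<^esub> x = \<zero>\<^bsub>M\<^esub>"
    using assms smult_l_distr[of "\<ominus>\<^bsub>R\<^esub> r" r x] by (simp add: R.l_neg smult_zero_left)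
qed (use assms smult_closed in auto)

lemma smult_minus_right:
  assumes "r \<in> carrier R" "x \<in> carrier M"
  shows "r \<odot>\<^bsub>M\<^esub> (\<ominus>\<^bsub>M\<^esub> x) = \<ominus>\<^bsub>M\<^esub> (r \<odot>\<^bsub>M\<^esub> x)"
proof (rule M.minus_equality[symmetric])
  show "r \<odot>\<^bsub>M\<^esub> (\<ominus>\<^bsub>M\<^esub> x) \<oplus>\<^bsub>M\<^esub> r \<odot>\<^bsub>M\<^esub> x = \<zero>\<^bsub>M\<^esub>"
    using assms smult_r_distr[of r "\<ominus>\<^bsub>M\<^esub> x" x] by (simp add: M.l_neg smult_zero_right)
qed (use assms smult_closed in auto)

lemma submoduleI:
  assumes "U \<subseteq> carrier M" "\<zero>\<^bsub>M\<^esub> \<in> U" "\<And>x y. \<lbrakk>x \<in> U; y \<in> U\<rbrakk> \<Longrightarrow> x \<oplus>\<^bsub>M\<^esub> y \<in> U"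
    "\<And>r x. \<lbrakk>r \<in> carrier R; x \<in> U\<rbrakk> \<Longrightarrow> r \<odot>\<^bsub>M\<^esub> x \<in> U"
  shows "submodule U R M"
proof (intro submodule.intro subgroup.intro)
  fix x assume x: "x \<in> U"
  then have "(\<ominus>\<^bsub>R\<^esub> \<one>\<^bsub>R\<^esub>) \<odot>\<^bsub>M\<^esub> x \<in> U" using assms by simp
  then show "inv\<^bsub>add_monoid M\<^esub> x \<in> U"
    using x assms(1) by (simp add: smult_minus_left smult_one subset_iff flip: a_inv_def)
qed (use assms in \<open>auto simp: submodule_axioms_def\<close>)

lemma carrier_submodule: "submodule (carrier M) R M"
  by (rule submoduleI) (auto simp: smult_closed)

lemma zero_submodule: "submodule {\<zero>\<^bsub>M\<^esub>} R M"
  by (rule submoduleI) (auto simp: smult_zero_right)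

lemma left_module_submodule:
  assumes U: "submodule U R M"
  shows "left_module R (M\<lparr>carrier := U\<rparr>)"
proof (intro left_module.intro left_module_axioms.intro)
  show "abelian_group (M\<lparr>carrier := U\<rparr>)"
  proof (rule abelian_groupI)
    fix x assume "x \<in> carrier (M\<lparr>carrier := U\<rparr>)"
    then show "\<exists>y\<in>carrier (M\<lparr>carrier := U\<rparr>). y \<oplus>\<^bsub>M\<lparr>carrier := U\<rparr>\<^esub> x = \<zero>\<^bsub>M\<lparr>carrier := U\<rparr>\<^esub>"
      using submodule_minus[OF U, of x] submodule_subset[OF U]
      by (auto intro!: bexI[of _ "\<ominus>\<^bsub>M\<^esub> x"] simp: M.l_neg)
  qed (use submodule_subset[OF U] in \<open>auto simp: submodule_add[OF U] submodule_zero[OF U] M.a_ac subset_iff\<close>)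
qed (use submodule_subset[OF U] in \<open>auto simp: submodule_smult[OF U] smult_l_distr smult_r_distr
    smult_assoc smult_one R.ring_axioms subset_iff\<close>)

lemma submodule_of_submodule:
  assumes U: "submodule U R M" and N: "submodule N R (M\<lparr>carrier := U\<rparr>)"
  shows "submodule N R M" "N \<subseteq> U"
proof -
  show "N \<subseteq> U" using submodule_subset[OF N] by simp
  then show "submodule N R M"
    using submodule_subset[OF U] submodule_zero[OF N] submodule_add[OF N] submodule_smult[OF N]
    by (intro submoduleI) auto
qed

end

subsection \<open>Homomorphisms\<close>

definition module_map ::
  "('r, 'y) ring_scheme \<Rightarrow> ('r, 'm) module \<Rightarrow> ('r, 'n) module \<Rightarrow> ('m \<Rightarrow> 'n) \<Rightarrow> bool" where
  "module_map R M N f \<longleftrightarrow> (\<forall>x\<in>carrier M. f x \<in> carrier N) \<and>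
    (\<forall>x\<in>carrier M. \<forall>y\<in>carrier M. f (x \<oplus>\<^bsub>M\<^esub> y) = f x \<oplus>\<^bsub>N\<^esub> f y) \<and>
    (\<forall>r\<in>carrier R. \<forall>x\<in>carrier M. f (r \<odot>\<^bsub>M\<^esub> x) = r \<odot>\<^bsub>N\<^esub> f x)"

lemma module_mapI:
  assumes "\<And>x. x \<in> carrier M \<Longrightarrow> f x \<in> carrier N"
    "\<And>x y. \<lbrakk>x \<in> carrier M; y \<in> carrier M\<rbrakk> \<Longrightarrow> f (x \<oplus>\<^bsub>M\<^esub> y) = f x \<oplus>\<^bsub>N\<^esub> f y"
    "\<And>r x. \<lbrakk>r \<in> carrier R; x \<in> carrier M\<rbrakk> \<Longrightarrow> f (r \<odot>\<^bsub>M\<^esub> x) = r \<odot>\<^bsub>N\<^esub> f x"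
  shows "module_map R M N f"
  using assms by (simp add: module_map_def)

lemma module_mapD:
  assumes "module_map R M N f" "x \<in> carrier M"
  shows "f x \<in> carrier N" "y \<in> carrier M \<Longrightarrow> f (x \<oplus>\<^bsub>M\<^esub> y) = f x \<oplus>\<^bsub>N\<^esub> f y"
    "r \<in> carrier R \<Longrightarrow> f (r \<odot>\<^bsub>M\<^esub> x) = r \<odot>\<^bsub>N\<^esub> f x"
  using assms by (auto simp: module_map_def)

lemma additive_map_zero:
  assumes "abelian_group M" "abelian_group N" "f \<zero>\<^bsub>M\<^esub> \<in> carrier N"
    "f (\<zero>\<^bsub>M\<^esub> \<oplus>\<^bsub>M\<^esub> \<zero>\<^bsub>M\<^esub>) = f \<zero>\<^bsub>M\<^esub> \<oplus>\<^bsub>N\<^esub> f \<zero>\<^bsub>M\<^esub>"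
  shows "f \<zero>\<^bsub>M\<^esub> = \<zero>\<^bsub>N\<^esub>"
proof -
  interpret M: abelian_group M by fact
  interpret N: abelian_group N by fact
  show ?thesis using assms(3,4) by simp
qed

lemma module_map_zero:
  assumes "left_module R M" "left_module R N" "module_map R M N f"
  shows "f \<zero>\<^bsub>M\<^esub> = \<zero>\<^bsub>N\<^esub>"
proof -
  interpret M: left_module R M by fact
  interpret N: left_module R N by fact
  show ?thesis
    by (rule additive_map_zero) (auto simp: module_mapD[OF assms(3)] M.M.abelian_group_axioms N.M.abelian_group_axioms
      simp del: M.M.l_zero M.M.r_zero)
qed

lemma module_map_minus:
  assumes "left_module R M" "left_module R N" "module_map R M N f" "x \<in> carrier M"
  shows "f (\<ominus>\<^bsub>M\<^esub> x) = \<ominus>\<^bsub>N\<^esub> f x"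
proof -
  interpret M: left_module R M by fact
  interpret N: left_module R N by fact
  have "f (\<ominus>\<^bsub>M\<^esub> x) \<oplus>\<^bsub>N\<^esub> f x = \<zero>\<^bsub>N\<^esub>"
    using module_mapD(2)[OF assms(3), of "\<ominus>\<^bsub>M\<^esub> x" x] assms(4)
    by (simp add: M.M.l_neg module_map_zero[OF assms(1-3)])
  then show ?thesis
    using assms(4) by (intro N.M.minus_equality[symmetric]) (auto simp: module_mapD[OF assms(3)])
qed

lemma module_map_comp:
  assumes "module_map R M N f" "module_map R N P g"
  shows "module_map R M P (g \<circ> f)"
  using assms by (simp add: module_map_def)

lemma module_map_preimage:
  assumes "left_module R M" "left_module R N" "module_map R M N f" "submodule U R N"
  shows "submodule {x \<in> carrier M. f x \<in> U} R M"
proof -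
  interpret M: left_module R M by fact
  show ?thesis
    by (rule M.submoduleI)
      (auto simp: module_mapD[OF assms(3)] module_map_zero[OF assms(1-3)] submodule_zero[OF assms(4)]
        submodule_add[OF assms(4)] submodule_smult[OF assms(4)] M.smult_closed)
qed

lemma module_map_kernel:
  assumes "left_module R M" "left_module R N" "module_map R M N f"
  shows "submodule {x \<in> carrier M. f x = \<zero>\<^bsub>N\<^esub>} R M"
  using module_map_preimage[OF assms left_module.zero_submodule[OF assms(2)]] by simp

lemma module_map_image:
  assumes "left_module R M" "left_module R N" "module_map R M N f" "submodule U R M"
  shows "submodule (f ` U) R N"
proof -
  interpret N: left_module R N by fact
  note U = submodule_subset[OF assms(4)]
  have in_U: "x \<in> carrier M" if "x \<in> U" for x using that U by blast
  show ?thesis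
  proof (rule N.submoduleI)
    show "\<zero>\<^bsub>N\<^esub> \<in> f ` U"
      using module_map_zero[OF assms(1-3)] submodule_zero[OF assms(4)] by (metis imageI)
  next
    fix x y assume "x \<in> f ` U" "y \<in> f ` U"
    then obtain u v where "x = f u" "y = f v" "u \<in> U" "v \<in> U" by blast
    then show "x \<oplus>\<^bsub>N\<^esub> y \<in> f ` U"
      by (intro image_eqI[of _ _ "u \<oplus>\<^bsub>M\<^esub> v"])
        (auto simp: module_mapD[OF assms(3)] in_U submodule_add[OF assms(4)])
  next
    fix r x assume r: "r \<in> carrier R" and "x \<in> f ` U"
    then obtain u where "x = f u" "u \<in> U" by blast
    then show "r \<odot>\<^bsub>N\<^esub> x \<in> f ` U"
      using r by (intro image_eqI[of _ _ "r \<odot>\<^bsub>M\<^esub> u"])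
        (auto simp: module_mapD[OF assms(3)] in_U submodule_smult[OF assms(4)])
  qed (use in_U module_mapD[OF assms(3)] in auto)
qed

lemma module_map_inj:
  assumes "left_module R M" "left_module R N" "module_map R M N f"
    "\<And>x. \<lbrakk>x \<in> carrier M; f x = \<zero>\<^bsub>N\<^esub>\<rbrakk> \<Longrightarrow> x = \<zero>\<^bsub>M\<^esub>"
  shows "inj_on f (carrier M)"
proof (rule inj_onI)
  interpret M: left_module R M by fact
  interpret N: left_module R N by fact
  fix x y assume xy: "x \<in> carrier M" "y \<in> carrier M" "f x = f y"
  have "f (x \<oplus>\<^bsub>M\<^esub> \<ominus>\<^bsub>M\<^esub> y) = \<zero>\<^bsub>N\<^esub>"
    using xy module_mapD(1)[OF assms(3)]
    by (simp add: module_mapD(2)[OF assms(3)] module_map_minus[OF assms(1-3)] N.M.r_neg)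
  then have "x \<oplus>\<^bsub>M\<^esub> \<ominus>\<^bsub>M\<^esub> y = \<zero>\<^bsub>M\<^esub>" using assms(4) xy by simp
  then show "x = y" using xy M.M.minus_equality[of x "\<ominus>\<^bsub>M\<^esub> y"] by simp
qed

lemma module_isomorphic_iff:
  "module_isomorphic R M N \<longleftrightarrow> (\<exists>f. module_map R M N f \<and> bij_betw f (carrier M) (carrier N))"
  unfolding module_isomorphic_def module_map_def by (intro iff_exI) (auto dest: bij_betwE)

lemma module_isomorphic_trans:
  assumes "module_isomorphic R M N" "module_isomorphic R N P"
  shows "module_isomorphic R M P"
proof -
  obtain f g where "module_map R M N f" "bij_betw f (carrier M) (carrier N)"
    "module_map R N P g" "bij_betw g (carrier N) (carrier P)"
    using assms by (auto simp: module_isomorphic_iff)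
  then have "module_map R M P (g \<circ> f)" "bij_betw (g \<circ> f) (carrier M) (carrier P)"
    by (simp_all add: module_map_comp bij_betw_trans)
  then show ?thesis unfolding module_isomorphic_iff by blast
qed

text \<open>
  Only closure of the operations is assumed: for the tensor product of a character with a module this
  is at hand before the module axioms are.
\<close>

lemma module_isomorphic_sym_closed:
  assumes iso: "module_isomorphic R M N"
    and add: "\<And>x y. \<lbrakk>x \<in> carrier M; y \<in> carrier M\<rbrakk> \<Longrightarrow> x \<oplus>\<^bsub>M\<^esub> y \<in> carrier M"
    and smult: "\<And>r x. \<lbrakk>r \<in> carrier R; x \<in> carrier M\<rbrakk> \<Longrightarrow> r \<odot>\<^bsub>M\<^esub> x \<in> carrier M"
  shows "module_isomorphic R N M"
proof -
  obtain f where f: "module_map R M N f" "bij_betw f (carrier M) (carrier N)"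
    using iso by (auto simp: module_isomorphic_iff)
  let ?g = "inv_into (carrier M) f"
  have g: "bij_betw ?g (carrier N) (carrier M)" by (rule bij_betw_inv_into[OF f(2)])
  then have gc: "?g x \<in> carrier M" if "x \<in> carrier N" for x using that bij_betwE by metis
  have fg: "f (?g x) = x" if "x \<in> carrier N" for x
    using f(2) that by (simp add: bij_betw_inv_into_right)
  have gf: "?g (f x) = x" if "x \<in> carrier M" for x
    using f(2) that by (simp add: bij_betw_inv_into_left)
  have "module_map R N M ?g"
  proof (rule module_mapI)
    fix x y assume xy: "x \<in> carrier N" "y \<in> carrier N"
    have "f (?g x \<oplus>\<^bsub>M\<^esub> ?g y) = x \<oplus>\<^bsub>N\<^esub> y" using xy by (simp add: module_mapD[OF f(1)] gc fg)
    then show "?g (x \<oplus>\<^bsub>N\<^esub> y) = ?g x \<oplus>\<^bsub>M\<^esub> ?g y"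
      using gf[of "?g x \<oplus>\<^bsub>M\<^esub> ?g y"] add xy gc by simp
  next
    fix r x assume rx: "r \<in> carrier R" "x \<in> carrier N"
    have "f (r \<odot>\<^bsub>M\<^esub> ?g x) = r \<odot>\<^bsub>N\<^esub> x" using rx by (simp add: module_mapD[OF f(1)] gc fg)
    then show "?g (r \<odot>\<^bsub>N\<^esub> x) = r \<odot>\<^bsub>M\<^esub> ?g x"
      using gf[of "r \<odot>\<^bsub>M\<^esub> ?g x"] smult rx gc by simp
  qed (rule gc)
  then show ?thesis using g by (auto simp: module_isomorphic_iff)
qed

lemma module_isomorphic_sym:
  assumes "left_module R M" "module_isomorphic R M N"
  shows "module_isomorphic R N M"
proof -
  interpret left_module R M by fact
  show ?thesis by (rule module_isomorphic_sym_closed[OF assms(2)]) (auto intro: smult_closed)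
qed

lemma simple_moduleD:
  assumes "simple_module R M"
  shows "left_module R M" "submodule N R M \<Longrightarrow> N = {\<zero>\<^bsub>M\<^esub>} \<or> N = carrier M"
    "\<exists>x\<in>carrier M. x \<noteq> \<zero>\<^bsub>M\<^esub>"
proof -
  show M: "left_module R M" using assms by (simp add: simple_module_def)
  interpret left_module R M by fact
  show "submodule N R M \<Longrightarrow> N = {\<zero>\<^bsub>M\<^esub>} \<or> N = carrier M" "\<exists>x\<in>carrier M. x \<noteq> \<zero>\<^bsub>M\<^esub>"
    using assms by (auto simp: simple_module_def)
qed

lemma simple_module_whole:
  assumes "simple_module R M" "submodule N R M" "x \<in> N" "x \<noteq> \<zero>\<^bsub>M\<^esub>"
  shows "N = carrier M"
  using simple_moduleD(2)[OF assms(1,2)] assms(3,4) by blast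

text \<open>
  Schur's lemma: the kernel of a nonzero map out of a simple module is a proper submodule, and the
  image of a nonzero map into a simple module is a nonzero submodule.
\<close>

lemma simple_module_map_inj:
  assumes "simple_module R M" "left_module R N" "module_map R M N f" "x \<in> carrier M" "f x \<noteq> \<zero>\<^bsub>N\<^esub>"
  shows "inj_on f (carrier M)"
proof (rule module_map_inj[OF simple_moduleD(1)[OF assms(1)] assms(2,3)])
  fix y assume y: "y \<in> carrier M" "f y = \<zero>\<^bsub>N\<^esub>"
  have "submodule {x \<in> carrier M. f x = \<zero>\<^bsub>N\<^esub>} R M"
    by (rule module_map_kernel[OF simple_moduleD(1)[OF assms(1)] assms(2,3)])
  then show "y = \<zero>\<^bsub>M\<^esub>"
    using simple_moduleD(2)[OF assms(1)] assms(4,5) y by blast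
qed

lemma simple_module_map_iso:
  assumes "simple_module R M" "simple_module R N" "module_map R M N f" "x \<in> carrier M" "f x \<noteq> \<zero>\<^bsub>N\<^esub>"
  shows "module_isomorphic R M N"
proof -
  note M = simple_moduleD(1)[OF assms(1)] and N = simple_moduleD(1)[OF assms(2)]
  have "submodule (f ` carrier M) R N"
    by (rule module_map_image[OF M N assms(3) left_module.carrier_submodule[OF M]])
  then have "f ` carrier M = carrier N"
    by (rule simple_module_whole[OF assms(2)]) (use assms(4,5) in auto)
  then show ?thesis
    using simple_module_map_inj[OF assms(1) N assms(3-5)] assms(3)
    by (auto simp: module_isomorphic_iff bij_betw_def)
qed

lemma simple_module_iso:
  assumes M: "simple_module R M" and N: "left_module R N" and iso: "module_isomorphic R M N"
  shows "simple_module R N"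
proof -
  note LM = simple_moduleD(1)[OF M]
  obtain f where f: "module_map R M N f" "bij_betw f (carrier M) (carrier N)"
    using iso by (auto simp: module_isomorphic_iff)
  have im: "f ` carrier M = carrier N" and inj: "inj_on f (carrier M)"
    using f(2) by (auto simp: bij_betw_def)
  note zero = module_map_zero[OF LM N f(1)]
  interpret M: left_module R M by fact
  interpret N: left_module R N by fact
  obtain x where x: "x \<in> carrier M" "x \<noteq> \<zero>\<^bsub>M\<^esub>" using simple_moduleD(3)[OF M] by blast
  then have "f x \<noteq> \<zero>\<^bsub>N\<^esub>" using inj_onD[OF inj, of x "\<zero>\<^bsub>M\<^esub>"] zero by auto
  then have "carrier N \<noteq> {\<zero>\<^bsub>N\<^esub>}" using x im by blast
  moreover have "U = {\<zero>\<^bsub>N\<^esub>} \<or> U = carrier N" if U: "submodule U R N" for U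
  proof -
    have "f ` {x \<in> carrier M. f x \<in> U} = f ` carrier M \<inter> U" by auto
    also have "\<dots> = U" using submodule_subset[OF U] im by auto
    finally have "U = f ` {x \<in> carrier M. f x \<in> U}" by simp
    moreover have "{x \<in> carrier M. f x \<in> U} = {\<zero>\<^bsub>M\<^esub>} \<or> {x \<in> carrier M. f x \<in> U} = carrier M"
      by (rule simple_moduleD(2)[OF M module_map_preimage[OF LM N f(1) U]])
    ultimately show ?thesis using im zero by auto
  qed
  ultimately show ?thesis using N by (simp add: simple_module_def)
qed

subsection \<open>Restriction of scalars\<close>

lemma restrict_scalars_left_module:
  assumes A: "ring A" and B: "left_module B M" and f: "f \<in> ring_hom A B"
  shows "left_module A (restrict_scalars f M)"
proof -
  interpret M: left_module B M by fact
  show ?thesis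
    by (intro left_module.intro left_module_axioms.intro A)
      (use ring_hom_closed[OF f] ring_hom_add[OF f] ring_hom_mult[OF f] ring_hom_one[OF f] in
        \<open>auto simp: M.smult_closed M.smult_l_distr M.smult_r_distr M.smult_assoc M.smult_one
          intro: abelian_group_cong[OF M.M.abelian_group_axioms]\<close>)
qed

lemma restrict_scalars_module_map:
  assumes "module_map B M N g" "f \<in> ring_hom A B"
  shows "module_map A (restrict_scalars f M) (restrict_scalars f N) g"
  using assms ring_hom_closed[OF assms(2)] by (auto simp: module_map_def)

lemma restrict_scalars_iso:
  assumes "module_isomorphic B M N" "f \<in> ring_hom A B"
  shows "module_isomorphic A (restrict_scalars f M) (restrict_scalars f N)"
  using assms restrict_scalars_module_map[OF _ assms(2)] by (auto simp: module_isomorphic_iff)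

lemma restrict_scalars_submodule:
  assumes "submodule U B M" "f \<in> ring_hom A B"
  shows "submodule U A (restrict_scalars f M)"
  by (rule submodule_transfer[OF assms(1)])
    (use submodule_smult[OF assms(1)] ring_hom_closed[OF assms(2)] in auto)

text \<open>
  Along a surjective ring homomorphism, the submodules remain the same.
\<close>

lemma restrict_scalars_simple:
  assumes "simple_module B M" "ring A" "f \<in> ring_hom A B" "f ` carrier A = carrier B"
  shows "simple_module A (restrict_scalars f M)"
proof -
  interpret M: left_module B M by (rule simple_moduleD(1)[OF assms(1)])
  have "submodule N B M" if N: "submodule N A (restrict_scalars f M)" for N
  proof (rule M.submoduleI)
    fix r x assume "r \<in> carrier B" "x \<in> N"
    then obtain t where "t \<in> carrier A" "r = f t" using assms(4) by blast
    then show "r \<odot>\<^bsub>M\<^esub> x \<in> N" using submodule_smult[OF N, of t x] \<open>x \<in> N\<close> by simp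
  qed (use submodule_subset[OF N] submodule_zero[OF N] submodule_add[OF N] in auto)
  then show ?thesis
    using assms(1) restrict_scalars_left_module[OF assms(2) M.left_module_axioms assms(3)]
    by (simp add: simple_module_def)
qed

text \<open>
  A homomorphism of \<open>k\<close>-algebras leaves the vector space underlying a module unchanged, so it preserves
  finite dimension.
\<close>

definition algebra_map ::
  "('k, 'r, 'y) module_scheme \<Rightarrow> ('k, 't, 'z) module_scheme \<Rightarrow> ('r \<Rightarrow> 't) \<Rightarrow> bool" where
  "algebra_map A B f \<longleftrightarrow> ring A \<and> f \<in> ring_hom A B \<and> (\<forall>c. f (c \<odot>\<^bsub>A\<^esub> \<one>\<^bsub>A\<^esub>) = c \<odot>\<^bsub>B\<^esub> \<one>\<^bsub>B\<^esub>)"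

lemma algebra_map_hom: "algebra_map A B f \<Longrightarrow> f \<in> ring_hom A B"
  by (simp add: algebra_map_def)

lemma restrict_scalars_finite_dim:
  "algebra_map A B f \<Longrightarrow> finite_dim A (restrict_scalars f M) \<longleftrightarrow> finite_dim B M"
  by (simp add: finite_dim_def scalar_module_def restrict_scalars_def algebra_map_def)

lemma restrict_scalars_simple_fd:
  assumes "simple_fd B M" "algebra_map A B f" "f ` carrier A = carrier B"
  shows "simple_fd A (restrict_scalars f M)"
  using assms restrict_scalars_finite_dim[OF assms(2), of M] restrict_scalars_simple[of B M A f]
  by (auto simp: simple_fd_def algebra_map_def)

subsection \<open>Modules over an algebra\<close>

text \<open>
  What makes a module over \<open>A\<close> a vector space: the multiples of the unit are central and form an image
  of the field.
\<close>

locale scalar_ring = ring A for A :: "('k::field, 'r, 'y) module_scheme" +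
  assumes scal_closed: "c \<odot>\<^bsub>A\<^esub> \<one>\<^bsub>A\<^esub> \<in> carrier A"
    and scal_add: "(c + d) \<odot>\<^bsub>A\<^esub> \<one>\<^bsub>A\<^esub> = c \<odot>\<^bsub>A\<^esub> \<one>\<^bsub>A\<^esub> \<oplus>\<^bsub>A\<^esub> d \<odot>\<^bsub>A\<^esub> \<one>\<^bsub>A\<^esub>"
    and scal_mult: "(c * d) \<odot>\<^bsub>A\<^esub> \<one>\<^bsub>A\<^esub> = (c \<odot>\<^bsub>A\<^esub> \<one>\<^bsub>A\<^esub>) \<otimes>\<^bsub>A\<^esub> (d \<odot>\<^bsub>A\<^esub> \<one>\<^bsub>A\<^esub>)"
    and scal_one: "1 \<odot>\<^bsub>A\<^esub> \<one>\<^bsub>A\<^esub> = \<one>\<^bsub>A\<^esub>"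
    and scal_central: "r \<in> carrier A \<Longrightarrow> (c \<odot>\<^bsub>A\<^esub> \<one>\<^bsub>A\<^esub>) \<otimes>\<^bsub>A\<^esub> r = r \<otimes>\<^bsub>A\<^esub> (c \<odot>\<^bsub>A\<^esub> \<one>\<^bsub>A\<^esub>)"
begin

lemma vspace_scalar_module:
  assumes "left_module A M"
  shows "vspace (scalar_module A M)"
proof -
  interpret M: left_module A M by fact
  show ?thesis
    unfolding vspace_def
    by (intro module.intro module_axioms.intro cring_from_type_algebra)
      (auto simp: scal_closed scal_add scal_mult scal_one M.smult_closed M.smult_l_distr M.smult_r_distr
        M.smult_assoc M.smult_one intro: abelian_group_cong[OF M.M.abelian_group_axioms])
qed

lemma submodule_subspace:
  assumes "submodule U A M"
  shows "submodule U ring_of_type_algebra (scalar_module A M)"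
  by (rule submodule_transfer[OF assms]) (use submodule_smult[OF assms] scal_closed in auto)

lemma module_map_linear:
  assumes "module_map A M N f"
  shows "module_map ring_of_type_algebra (scalar_module A M) (scalar_module A N) f"
  using assms scal_closed by (simp add: module_map_def)

end

lemma vspace_left_module: "vspace W \<Longrightarrow> left_module ring_of_type_algebra W"
  unfolding vspace_def module_def
  by (auto intro!: left_module.intro left_module_axioms.intro simp: module_axioms_def cring.axioms)

context scalar_ring
begin

lemma finite_dim_surj:
  fixes M :: "('r, 'm) module" and N :: "('r, 'n) module"
  assumes M: "left_module A M" and N: "left_module A N" and fd: "finite_dim A M"
    and f: "module_map A M N f" "f ` carrier M = carrier N"
  shows "finite_dim A N"
proof -
  obtain S where S: "spanned_by (scalar_module A M) S" using fd by (auto simp: finite_dim_iff_spanned)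
  have "spanned_by (scalar_module A N) (f ` S)"
    unfolding spanned_by_def
  proof (intro conjI allI impI)
    fix U :: "'n set"
    assume U: "submodule U (ring_of_type_algebra :: 'k ring) (scalar_module A N) \<and> f ` S \<subseteq> U"
    have "submodule {x \<in> carrier (scalar_module A M). f x \<in> U} ring_of_type_algebra (scalar_module A M)"
      by (rule module_map_preimage[OF vspace_left_module[OF vspace_scalar_module[OF M]]
            vspace_left_module[OF vspace_scalar_module[OF N]] module_map_linear[OF f(1)]]) (use U in simp)
    then have "{x \<in> carrier (scalar_module A M). f x \<in> U} = carrier M"
      using S U by (force simp: spanned_by_def)
    then have "f ` carrier M \<subseteq> U" by blast
    then show "U = carrier (scalar_module A N)"
      using f(2) submodule_subset[of U ring_of_type_algebra "scalar_module A N"] U by auto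
  qed (use S f(2) in \<open>auto simp: spanned_by_def\<close>)
  then show ?thesis by (auto simp: finite_dim_iff_spanned)
qed

lemma simple_fd_iso:
  assumes M: "simple_fd A M" and N: "left_module A N" and iso: "module_isomorphic A M N"
  shows "simple_fd A N"
proof -
  have M': "simple_module A M" "finite_dim A M" using M by (auto simp: simple_fd_def)
  obtain f where "module_map A M N f" "bij_betw f (carrier M) (carrier N)"
    using iso by (auto simp: module_isomorphic_iff)
  then have "finite_dim A N"
    by (intro finite_dim_surj[OF simple_moduleD(1)[OF M'(1)] N M'(2)]) (auto simp: bij_betw_def)
  then show ?thesis using simple_module_iso[OF M'(1) N iso] by (simp add: simple_fd_def)
qed

lemma finite_dim_cover:
  assumes "left_module A M" "finite_dim A M"
  shows "\<exists>n L. poly_cover (scalar_module A M) n L"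
  using vspace.poly_cover_exists[OF vspace_scalar_module[OF assms(1)]] assms(2)
  by (auto simp: finite_dim_iff_spanned)

lemma finite_dim_submodule:
  assumes M: "left_module A M" and fd: "finite_dim A M" and U: "submodule U A M"
  shows "finite_dim A (M\<lparr>carrier := U\<rparr>)"
proof -
  interpret W: vspace "scalar_module A M" by (rule vspace_scalar_module[OF M])
  obtain n L where "poly_cover (scalar_module A M) n L" using finite_dim_cover[OF M fd] by blast
  from W.subspace_spanned_by_finite[OF this submodule_subspace[OF U]] obtain S where
    S: "finite S \<and> S \<subseteq> U \<and>
      (\<forall>U'. submodule U' ring_of_type_algebra (scalar_module A M) \<and> S \<subseteq> U' \<longrightarrow> U \<subseteq> U')"
    by (rule exE)
  have eq: "scalar_module A (M\<lparr>carrier := U\<rparr>) = (scalar_module A M)\<lparr>carrier := U\<rparr>"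
    by (simp add: scalar_module_def restrict_scalars_def)
  have "spanned_by (scalar_module A (M\<lparr>carrier := U\<rparr>)) S"
    unfolding spanned_by_def
  proof (intro conjI allI impI)
    fix U'
    assume U': "submodule U' (ring_of_type_algebra :: 'k ring) (scalar_module A (M\<lparr>carrier := U\<rparr>)) \<and> S \<subseteq> U'"
    then have sub: "submodule U' ring_of_type_algebra (scalar_module A M)" "U' \<subseteq> U"
      using left_module.submodule_of_submodule[OF vspace_left_module[OF W.vspace_axioms] submodule_subspace[OF U],
          of U'] unfolding eq by simp_all
    then have "U \<subseteq> U'" using S U' by simp
    then show "U' = carrier (scalar_module A (M\<lparr>carrier := U\<rparr>))" using sub(2) by simp
  qed (use S in auto)
  then show ?thesis by (auto simp: finite_dim_iff_spanned)
qed

text \<open>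
  A nonzero submodule of minimal dimension is simple.
\<close>

lemma simple_submodule_exists:
  assumes M: "left_module A M" and fd: "finite_dim A M" and nz: "carrier M \<noteq> {\<zero>\<^bsub>M\<^esub>}"
  shows "\<exists>U. submodule U A M \<and> simple_fd A (M\<lparr>carrier := U\<rparr>)"
proof -
  interpret M: left_module A M by fact
  interpret W: vspace "scalar_module A M" by (rule vspace_scalar_module[OF M])
  obtain n L where cover: "poly_cover (scalar_module A M) n L" using finite_dim_cover[OF M fd] by blast
  define d where "d = (\<lambda>U. poly_vs.dim {p \<in> low_degree n. L p \<in> U})"
  let ?P = "\<lambda>U. submodule U A M \<and> U \<noteq> {\<zero>\<^bsub>M\<^esub>}"
  have "?P (carrier M)" using M.carrier_submodule nz by blast
  then have U: "?P (arg_min d ?P)" by (rule arg_min_natI)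
  have min: "d (arg_min d ?P) \<le> d U'" if "?P U'" for U' using that by (rule arg_min_nat_le)
  define U where "U = arg_min d ?P"
  note U = U[folded U_def] and min = min[folded U_def]
  have "N = {\<zero>\<^bsub>M\<^esub>} \<or> N = U" if "submodule N A (M\<lparr>carrier := U\<rparr>)" for N
  proof (rule ccontr)
    assume *: "\<not> (N = {\<zero>\<^bsub>M\<^esub>} \<or> N = U)"
    have N: "submodule N A M" "N \<subseteq> U" using M.submodule_of_submodule[of U N] U that by auto
    then have "d N < d U"
      unfolding d_def using * U
      by (intro W.subspace_dim_less[OF cover] submodule_subspace) auto
    then show False using min[of N] N * by auto
  qed
  then show ?thesis
    using U M.left_module_submodule[of U] finite_dim_submodule[OF M fd, of U]
    by (auto simp: simple_fd_def simple_module_def)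
qed

lemma module_map_linear_op:
  assumes "left_module A M" "module_map A M M T"
  shows "vspace.linear_op (scalar_module A M) T"
  unfolding vspace.linear_op_def[OF vspace_scalar_module[OF assms(1)]]
  using module_mapD[OF assms(2)] scal_closed by auto

end

text \<open>
  An eigenspace of an endomorphism is a submodule, because the scalars are central; over an
  algebraically closed field there is a nonzero one.
\<close>

lemma simple_endomorphism_scalar:
  fixes A :: "('k::alg_closed_field, 'r, 'y) module_scheme"
  assumes A: "scalar_ring A" and M: "simple_fd A M" and T: "module_map A M M T"
  shows "\<exists>r. \<forall>x\<in>carrier M. T x = (r \<odot>\<^bsub>A\<^esub> \<one>\<^bsub>A\<^esub>) \<odot>\<^bsub>M\<^esub> x"
proof -
  interpret A: scalar_ring A by fact
  have M': "simple_module A M" "finite_dim A M" using M by (auto simp: simple_fd_def)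
  interpret M: left_module A M by (rule simple_moduleD(1)[OF M'(1)])
  obtain n L where cover: "poly_cover (scalar_module A M) n L"
    using A.finite_dim_cover[OF M.left_module_axioms M'(2)] by blast
  obtain v where v: "v \<in> carrier M" "v \<noteq> \<zero>\<^bsub>M\<^esub>" using simple_moduleD(3)[OF M'(1)] by blast
  obtain w r where w: "w \<in> carrier M" "w \<noteq> \<zero>\<^bsub>M\<^esub>" "T w = (r \<odot>\<^bsub>A\<^esub> \<one>\<^bsub>A\<^esub>) \<odot>\<^bsub>M\<^esub> w"
    using eigenvector_exists[OF A.vspace_scalar_module[OF M.left_module_axioms] cover
        A.module_map_linear_op[OF M.left_module_axioms T], of v] v by auto
  let ?N = "{x \<in> carrier M. T x = (r \<odot>\<^bsub>A\<^esub> \<one>\<^bsub>A\<^esub>) \<odot>\<^bsub>M\<^esub> x}"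
  have "submodule ?N A M"
  proof (rule M.submoduleI)
    fix t x assume t: "t \<in> carrier A" and x: "x \<in> ?N"
    then have "T (t \<odot>\<^bsub>M\<^esub> x) = (t \<otimes>\<^bsub>A\<^esub> (r \<odot>\<^bsub>A\<^esub> \<one>\<^bsub>A\<^esub>)) \<odot>\<^bsub>M\<^esub> x"
      by (simp add: module_mapD[OF T] M.smult_assoc A.scal_closed)
    also have "\<dots> = (r \<odot>\<^bsub>A\<^esub> \<one>\<^bsub>A\<^esub>) \<odot>\<^bsub>M\<^esub> (t \<odot>\<^bsub>M\<^esub> x)"
      using t x by (simp add: A.scal_central[symmetric] M.smult_assoc A.scal_closed)
    finally show "t \<odot>\<^bsub>M\<^esub> x \<in> ?N" using t x by (simp add: M.smult_closed)
  qed (auto simp: module_mapD[OF T] M.smult_r_distr A.scal_closed M.smult_zero_right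
      module_map_zero[OF M.left_module_axioms M.left_module_axioms T])
  then have "?N = carrier M" by (rule simple_module_whole[OF M'(1)]) (use w in auto)
  then show ?thesis by blast
qed

text \<open>
  The structure of a finite-dimensional module can be transported along any injection of its carrier
  into \<open>nat \<Rightarrow> 'k\<close>, linear or not. Such an injection chooses coordinates for every element.
\<close>

context scalar_ring
begin

lemma transport_to_functions:
  fixes M :: "('r, 'm) module"
  assumes M: "left_module A M" and fd: "finite_dim A M"
  shows "\<exists>N :: ('r, nat \<Rightarrow> 'k) module. left_module A N \<and> module_isomorphic A M N"
proof -
  interpret M: left_module A M by fact
  obtain n L where cover: "poly_cover (scalar_module A M) n L" using finite_dim_cover[OF M fd] by blast
  have ex: "\<exists>p. L p = x" if "x \<in> carrier M" for x
  proof -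
    have "x \<in> L ` low_degree n" using cover that by (simp add: poly_cover_def)
    then show ?thesis by blast
  qed
  define j where "j = (\<lambda>x. SOME p. L p = x)"
  have Lj: "L (j x) = x" if "x \<in> carrier M" for x
    unfolding j_def by (rule someI_ex[OF ex[OF that]])
  define b where "b = (\<lambda>x. Polynomial.coeff (j x))"
  have "inj_on b (carrier M)"
  proof (rule inj_onI)
    fix x y assume xy: "x \<in> carrier M" "y \<in> carrier M" "b x = b y"
    then have "j x = j y" by (simp add: b_def Polynomial.coeff_inject)
    then have "L (j x) = L (j y)" by simp
    then show "x = y" unfolding Lj[OF xy(1)] Lj[OF xy(2)] .
  qed
  define b' where "b' = inv_into (carrier M) b"
  have b'b [simp]: "b' (b x) = x" if "x \<in> carrier M" for x
    using that \<open>inj_on b (carrier M)\<close> by (simp add: b'_def)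
  define N :: "('r, nat \<Rightarrow> 'k) module" where
    "N = \<lparr>carrier = b ` carrier M, monoid.mult = undefined, one = undefined, ring.zero = b \<zero>\<^bsub>M\<^esub>,
      add = (\<lambda>u v. b (b' u \<oplus>\<^bsub>M\<^esub> b' v)), module.smult = (\<lambda>r u. b (r \<odot>\<^bsub>M\<^esub> b' u))\<rparr>"
  have "abelian_group N"
  proof (rule abelian_groupI)
    fix u assume "u \<in> carrier N"
    then obtain x where "x \<in> carrier M" "u = b x" by (auto simp: N_def)
    then show "\<exists>v\<in>carrier N. v \<oplus>\<^bsub>N\<^esub> u = \<zero>\<^bsub>N\<^esub>"
      by (intro bexI[of _ "b (\<ominus>\<^bsub>M\<^esub> x)"]) (auto simp: N_def M.M.l_neg)
  qed (auto simp: N_def M.M.a_ac)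
  then have "left_module A N"
    by (intro left_module.intro left_module_axioms.intro ring_axioms)
      (auto simp: N_def M.smult_closed M.smult_l_distr M.smult_r_distr M.smult_assoc M.smult_one)
  moreover have "module_map A M N b"
    by (rule module_mapI) (auto simp: N_def M.smult_closed)
  moreover have "bij_betw b (carrier M) (carrier N)"
    using \<open>inj_on b (carrier M)\<close> by (simp add: bij_betw_def N_def)
  ultimately show ?thesis by (auto simp: module_isomorphic_iff)
qed

lemma complete_simples_any_type:
  fixes M :: "('r, 'm) module"
  assumes V: "complete_simples TYPE(nat \<Rightarrow> 'k) A I V" and M: "simple_fd A M"
  shows "\<exists>i\<in>I. module_isomorphic A M (V i)"
proof -
  have LM: "left_module A M" "finite_dim A M" using M by (auto simp: simple_fd_def simple_module_def)
  obtain N :: "('r, nat \<Rightarrow> 'k) module" where N: "left_module A N" "module_isomorphic A M N"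
    using transport_to_functions[OF LM] by blast
  have "simple_fd A N" by (rule simple_fd_iso[OF M N])
  then obtain i where "i \<in> I" "module_isomorphic A N (V i)" using V by (auto simp: complete_simples_def)
  then show ?thesis using module_isomorphic_trans[OF N(2)] by blast
qed

end

section \<open>The group algebra and the Hopf-Ore extension\<close>

lemma poly_mapping_carrier_induct [consumes 1, case_names zero single add]:
  fixes u :: "'b \<Rightarrow>\<^sub>0 'k::field"
  assumes "Poly_Mapping.keys u \<subseteq> S"
    and zero: "P 0" and single: "\<And>p c. p \<in> S \<Longrightarrow> P (Poly_Mapping.single p c)"
    and add: "\<And>u v. \<lbrakk>Poly_Mapping.keys u \<subseteq> S; Poly_Mapping.keys v \<subseteq> S; P u; P v\<rbrakk> \<Longrightarrow> P (u + v)"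
  shows "P u"
proof -
  have "P (\<Sum>p\<in>A. Poly_Mapping.single p (Poly_Mapping.lookup u p)) \<and>
      Poly_Mapping.keys (\<Sum>p\<in>A. Poly_Mapping.single p (Poly_Mapping.lookup u p)) \<subseteq> S"
    if "finite A" "A \<subseteq> S" for A
    using that
  proof (induction A rule: finite_induct)
    case (insert p A)
    let ?s = "\<Sum>p\<in>A. Poly_Mapping.single p (Poly_Mapping.lookup u p)"
    have "Poly_Mapping.keys (Poly_Mapping.single p (Poly_Mapping.lookup u p)) \<subseteq> S"
      using insert.prems by simp
    moreover have "P ?s" "Poly_Mapping.keys ?s \<subseteq> S" using insert.IH insert.prems by simp_all
    moreover have "P (Poly_Mapping.single p (Poly_Mapping.lookup u p))" using insert.prems by (simp add: single)
    moreover have "Poly_Mapping.keys (Poly_Mapping.single p (Poly_Mapping.lookup u p) + ?s) \<subseteq> S"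
      by (rule order_trans[OF keys_add Un_least]) fact+
    ultimately show ?case using insert.hyps by (simp add: add)
  qed (simp add: zero)
  from this[of "Poly_Mapping.keys u"] have
    "P (\<Sum>p\<in>Poly_Mapping.keys u. Poly_Mapping.single p (Poly_Mapping.lookup u p))"
    using assms(1) by simp
  moreover have "(\<Sum>p\<in>Poly_Mapping.keys u. Poly_Mapping.single p (Poly_Mapping.lookup u p)) = u"
    using lin_extend_id[of u] by (simp add: lin_extend_def)
  ultimately show ?thesis by simp
qed

text \<open>The common setting of \<open>kG\<close> and \<open>H\<close>, in which homomorphisms are determined on the basis \<open>S\<close>.\<close>

locale pm_algebra = ring A for A :: "('k::field, 'b \<Rightarrow>\<^sub>0 'k, 'z) module_scheme" +
  fixes S :: "'b set"
  assumes carrier_eq: "carrier A = {u. Poly_Mapping.keys u \<subseteq> S}"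
    and add_eq: "u \<oplus>\<^bsub>A\<^esub> v = u + v"
    and zero_eq: "\<zero>\<^bsub>A\<^esub> = 0"
    and smult_eq: "c \<odot>\<^bsub>A\<^esub> u = pm_scale c u"
    and mult_scale_left: "pm_scale c u \<otimes>\<^bsub>A\<^esub> v = pm_scale c (u \<otimes>\<^bsub>A\<^esub> v)"
    and mult_scale_right: "u \<otimes>\<^bsub>A\<^esub> pm_scale c v = pm_scale c (u \<otimes>\<^bsub>A\<^esub> v)"
begin

lemma single_closed: "p \<in> S \<Longrightarrow> Poly_Mapping.single p c \<in> carrier A"
  by (simp add: carrier_eq)

lemma pm_scale_closed: "u \<in> carrier A \<Longrightarrow> pm_scale c u \<in> carrier A"
  by (force simp: carrier_eq in_keys_iff)

sublocale scalar_ring A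
  by unfold_locales
    (auto simp: smult_eq add_eq pm_scale_add mult_scale_left mult_scale_right mult.commute intro: pm_scale_closed)

lemma minus_eq:
  assumes "u \<in> carrier A" "v \<in> carrier A" shows "u \<ominus>\<^bsub>A\<^esub> v = u - v"
proof -
  have "\<ominus>\<^bsub>A\<^esub> v = - v"
    by (rule minus_equality) (use assms in \<open>auto simp: add_eq zero_eq carrier_eq\<close>)
  then show ?thesis by (simp add: a_minus_def add_eq)
qed

end

text \<open>
  Both sides of \<open>f(u v) = f(u) f(v)\<close> are bilinear, so it suffices to compare them on basis elements.
\<close>

lemma pm_algebra_map:
  assumes A: "pm_algebra A S" and B: "pm_algebra B T"
    and f_add: "\<And>u v. f (u + v) = f u + f v" and scale: "\<And>c u. f (pm_scale c u) = pm_scale c (f u)"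
    and closed: "\<And>p. p \<in> S \<Longrightarrow> f (Poly_Mapping.single p 1) \<in> carrier B"
    and mult: "\<And>p q. \<lbrakk>p \<in> S; q \<in> S\<rbrakk> \<Longrightarrow>
      f (Poly_Mapping.single p 1 \<otimes>\<^bsub>A\<^esub> Poly_Mapping.single q 1) =
      f (Poly_Mapping.single p 1) \<otimes>\<^bsub>B\<^esub> f (Poly_Mapping.single q 1)"
    and one: "f \<one>\<^bsub>A\<^esub> = \<one>\<^bsub>B\<^esub>"
  shows "algebra_map A B f"
proof -
  interpret A: pm_algebra A S by fact
  interpret B: pm_algebra B T by fact
  have f_zero: "f 0 = 0" using scale[of 0 0] by simp
  have f_single: "f (Poly_Mapping.single p c) = pm_scale c (f (Poly_Mapping.single p 1))" for p c
    using scale[of c "Poly_Mapping.single p 1"] by simp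
  have cl: "f u \<in> carrier B" if "Poly_Mapping.keys u \<subseteq> S" for u
    using that
  proof (induction u rule: poly_mapping_carrier_induct)
    case zero
    then show ?case using B.zero_closed by (simp add: B.zero_eq f_zero)
  next
    case (single p c)
    then show ?case by (subst f_single) (rule B.pm_scale_closed[OF closed])
  next
    case (add u v)
    then show ?case using B.a_closed[of "f u" "f v"] by (simp add: f_add B.add_eq)
  qed
  have mult1: "f (Poly_Mapping.single p c \<otimes>\<^bsub>A\<^esub> v) = f (Poly_Mapping.single p c) \<otimes>\<^bsub>B\<^esub> f v"
    if "Poly_Mapping.keys v \<subseteq> S" "p \<in> S" for p c v
    using that(1)
  proof (induction v rule: poly_mapping_carrier_induct)
    case zero
    show ?case using that(2) A.r_null[of "Poly_Mapping.single p c"] B.r_null[of "f (Poly_Mapping.single p c)"]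
        A.single_closed[of p c] cl[of "Poly_Mapping.single p c"] by (simp add: A.zero_eq B.zero_eq f_zero)
  next
    case (single q d)
    have "f (Poly_Mapping.single p c \<otimes>\<^bsub>A\<^esub> Poly_Mapping.single q d) =
        f (pm_scale c (Poly_Mapping.single p 1) \<otimes>\<^bsub>A\<^esub> pm_scale d (Poly_Mapping.single q 1))" by simp
    also have "\<dots> = pm_scale c (f (Poly_Mapping.single p 1)) \<otimes>\<^bsub>B\<^esub> pm_scale d (f (Poly_Mapping.single q 1))"
      using that(2) single unfolding A.mult_scale_left A.mult_scale_right B.mult_scale_left B.mult_scale_right
      by (simp only: scale mult)
    finally show ?case by (subst f_single[of p c], subst f_single[of q d]) simp
  next
    case (add u v)
    have "u \<in> carrier A" "v \<in> carrier A" "f u \<in> carrier B" "f v \<in> carrier B"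
      "Poly_Mapping.single p c \<in> carrier A" "f (Poly_Mapping.single p c) \<in> carrier B"
      using add that(2) cl by (auto simp: A.carrier_eq)
    then show ?case
      using A.r_distr[of u v "Poly_Mapping.single p c"] B.r_distr[of "f u" "f v" "f (Poly_Mapping.single p c)"] add
      by (simp add: A.add_eq B.add_eq f_add)
  qed
  have mult2: "f (u \<otimes>\<^bsub>A\<^esub> v) = f u \<otimes>\<^bsub>B\<^esub> f v"
    if "Poly_Mapping.keys u \<subseteq> S" "Poly_Mapping.keys v \<subseteq> S" for u v
    using that(1)
  proof (induction u rule: poly_mapping_carrier_induct)
    case zero
    show ?case using that(2) A.l_null[of v] B.l_null[of "f v"] cl[of v]
      by (simp add: A.zero_eq B.zero_eq A.carrier_eq f_zero)
  next
    case (single p c)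
    then show ?case using mult1[OF that(2)] by blast
  next
    case (add u w)
    have "u \<in> carrier A" "w \<in> carrier A" "v \<in> carrier A" "f u \<in> carrier B" "f w \<in> carrier B" "f v \<in> carrier B"
      using add that(2) cl by (auto simp: A.carrier_eq)
    then show ?case
      using A.l_distr[of u w v] B.l_distr[of "f u" "f w" "f v"] add
      by (simp add: A.add_eq B.add_eq f_add)
  qed
  show ?thesis
    unfolding algebra_map_def
  proof (intro conjI allI)
    show "f \<in> ring_hom A B"
      by (rule ring_hom_memI) (use cl mult2 one f_add in \<open>auto simp: A.carrier_eq A.add_eq B.add_eq\<close>)
    show "f (c \<odot>\<^bsub>A\<^esub> \<one>\<^bsub>A\<^esub>) = c \<odot>\<^bsub>B\<^esub> \<one>\<^bsub>B\<^esub>" for c by (simp add: A.smult_eq B.smult_eq scale one)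
  qed (rule A.ring_axioms)
qed

lemma group_algebra_simps:
  "carrier (group_algebra G) = {u. Poly_Mapping.keys u \<subseteq> carrier G}"
  "\<one>\<^bsub>group_algebra G\<^esub> = Poly_Mapping.single \<one>\<^bsub>G\<^esub> 1"
  "\<zero>\<^bsub>group_algebra G\<^esub> = 0"
  "u \<oplus>\<^bsub>group_algebra G\<^esub> v = u + v"
  "c \<odot>\<^bsub>group_algebra G\<^esub> u = pm_scale c u"
  "Poly_Mapping.single g c \<otimes>\<^bsub>group_algebra G\<^esub> Poly_Mapping.single h d = Poly_Mapping.single (g \<otimes>\<^bsub>G\<^esub> h) (c * d)"
  by (simp_all add: group_algebra_def module.defs hopf_algebra.defs twisted_algebra_def)

lemma pm_algebra_group_algebra:
  assumes "group G"
  shows "pm_algebra (group_algebra G :: ('k::field, 'g) hopf) (carrier G)"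
proof -
  interpret ring "group_algebra G :: ('k::field, 'g) hopf" by (rule group_algebra_ring[OF assms])
  show ?thesis
    by unfold_locales
      (simp_all add: group_algebra_simps, simp_all add: group_algebra_def module.defs hopf_algebra.defs
        twisted_algebra_def lin_extend_scale lin_extend_fun_scale)
qed

lemma pm_algebra_hopf_ore:
  assumes "group G" "\<chi> \<in> carrier (character_group G)"
  shows "pm_algebra (hopf_ore G \<chi> a) (carrier G \<times> UNIV)"
proof -
  interpret ring "hopf_ore G \<chi> a" by (rule hopf_ore_ring[OF assms])
  show ?thesis
    by unfold_locales
      (simp_all add: hopf_ore_simps, simp_all add: hopf_ore_def Let_def module.defs hopf_algebra.defs
        ore_algebra_def twisted_algebra_def lin_extend_scale lin_extend_fun_scale)
qed

text \<open>For a character \<open>\<psi>\<close>, the automorphism \<open>g \<mapsto> \<psi>(g) g\<close> of \<open>kG\<close>.\<close>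

definition twist :: "('g \<Rightarrow> 'k::field) \<Rightarrow> ('g \<Rightarrow>\<^sub>0 'k) \<Rightarrow> ('g \<Rightarrow>\<^sub>0 'k)" where
  "twist \<psi> = lin_extend (\<lambda>g. Poly_Mapping.single g (\<psi> g))"

lemma lookup_twist: "Poly_Mapping.lookup (twist \<psi> u) g = \<psi> g * Poly_Mapping.lookup u g"
  by (auto simp: twist_def lin_extend_def lookup_sum lookup_single when_def in_keys_iff sum.delta mult.commute)

lemma twist_simps [simp]:
  "twist \<psi> 0 = 0" "twist \<psi> (u + v) = twist \<psi> u + twist \<psi> v" "twist \<psi> (pm_scale c u) = pm_scale c (twist \<psi> u)"
  "twist \<psi> (Poly_Mapping.single g c) = Poly_Mapping.single g (\<psi> g * c)"
  "twist \<psi> (twist \<phi> u) = twist (\<lambda>g. \<psi> g * \<phi> g) u"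
  by (auto intro!: poly_mapping_eqI simp: lookup_twist lookup_add lookup_single when_def algebra_simps)

lemma keys_twist: "Poly_Mapping.keys (twist \<psi> u) \<subseteq> Poly_Mapping.keys u"
  by (auto simp: in_keys_iff lookup_twist)

lemma twist_one:
  assumes "\<And>g. g \<in> Poly_Mapping.keys u \<Longrightarrow> \<psi> g = 1"
  shows "twist \<psi> u = u"
  by (rule poly_mapping_eqI) (use assms in \<open>auto simp: lookup_twist in_keys_iff\<close>)

locale hopf_ore_setting = G: group G
  for G :: "('g, 'z) monoid_scheme" (structure) and \<chi> :: "'g \<Rightarrow> 'k::field" and a :: 'g +
  assumes character: "\<chi> \<in> carrier (character_group G)"
    and a_closed: "a \<in> carrier G" and a_central: "g \<in> carrier G \<Longrightarrow> a \<otimes> g = g \<otimes> a"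
begin

abbreviation kG :: "('k, 'g) hopf" where "kG \<equiv> group_algebra G"
abbreviation H :: "('k, 'g \<times> nat) hopf" where "H \<equiv> hopf_ore G \<chi> a"

sublocale kG: pm_algebra kG "carrier G" by (rule pm_algebra_group_algebra) (rule G.is_group)
sublocale H: pm_algebra H "carrier G \<times> UNIV" by (rule pm_algebra_hopf_ore) (rule G.is_group, rule character)

text \<open>
  Restriction of scalars along \<open>tw n\<close> is the tensor product with the character \<open>\<chi>\<^sup>n\<close>; for a
  \<open>kG\<close>-submodule \<open>V\<close> of an \<open>H\<close>-module, \<open>x\<^sup>n V\<close> is a quotient of \<open>V\<close> twisted in this way.
\<close>

definition tw :: "nat \<Rightarrow> ('g \<Rightarrow>\<^sub>0 'k) \<Rightarrow> ('g \<Rightarrow>\<^sub>0 'k)" where "tw n = twist (\<lambda>g. \<chi> g ^ n)"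

lemma tw_algebra_map: "algebra_map kG kG (tw n)"
  unfolding tw_def
  by (rule pm_algebra_map[OF kG.pm_algebra_axioms kG.pm_algebra_axioms])
    (auto simp: group_algebra_simps character_mult[OF character] character_one[OF G.is_group character]
      power_mult_distrib)

lemma tw_add: "tw m (tw n u) = tw (m + n) u"
  by (simp add: tw_def power_add)

lemma tw_surj: "tw n ` carrier kG = carrier kG"
proof
  show "tw n ` carrier kG \<subseteq> carrier kG"
    using keys_twist by (fastforce simp: group_algebra_simps tw_def)
  show "carrier kG \<subseteq> tw n ` carrier kG"
  proof
    fix u :: "'g \<Rightarrow>\<^sub>0 'k" assume u: "u \<in> carrier kG"
    have "twist (\<lambda>g. \<chi> g ^ n) (twist (\<lambda>g. inverse (\<chi> g ^ n)) u) = u"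
      unfolding twist_simps
      by (rule twist_one) (use u character_nonzero[OF character] in \<open>auto simp: group_algebra_simps\<close>)
    moreover have "twist (\<lambda>g. inverse (\<chi> g ^ n)) u \<in> carrier kG"
      using u keys_twist by (fastforce simp: group_algebra_simps)
    ultimately show "u \<in> tw n ` carrier kG" unfolding tw_def by (intro image_eqI[of _ _ "twist (\<lambda>g. inverse (\<chi> g ^ n)) u"]) simp_all
  qed
qed

lemma group_to_ore_simps [simp]:
  "group_to_ore 0 = 0" "group_to_ore (u + v) = group_to_ore u + group_to_ore v"
  "group_to_ore (pm_scale c u) = pm_scale c (group_to_ore u)"
  "group_to_ore (Poly_Mapping.single g c) = Poly_Mapping.single (g, 0) c"
  by (simp_all add: group_to_ore_def lin_extend_add lin_extend_scale ore_group_def)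

lemma group_to_ore_algebra_map: "algebra_map kG H group_to_ore"
  by (rule pm_algebra_map[OF kG.pm_algebra_axioms H.pm_algebra_axioms])
    (auto simp: group_algebra_simps hopf_ore_simps ore_group_def)

lemma ore_to_group_simps [simp]:
  "ore_to_group 0 = 0" "ore_to_group (u + v) = ore_to_group u + ore_to_group v"
  "ore_to_group (pm_scale c u) = pm_scale c (ore_to_group u)"
  "ore_to_group (Poly_Mapping.single (g, i) c) = (if i = 0 then Poly_Mapping.single g c else 0)"
  by (simp_all add: ore_to_group_def lin_extend_add lin_extend_scale)

lemma ore_to_group_algebra_map: "algebra_map H kG ore_to_group"
  by (rule pm_algebra_map[OF H.pm_algebra_axioms kG.pm_algebra_axioms])
    (use kG.l_null kG.r_null in
      \<open>auto simp: group_algebra_simps hopf_ore_simps ore_group_def split: if_splits\<close>)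

lemma ore_to_group_to_ore: "ore_to_group (group_to_ore u) = u"
proof -
  have "Poly_Mapping.keys u \<subseteq> UNIV" by simp
  then show ?thesis by (induction u rule: poly_mapping_carrier_induct) simp_all
qed

lemma ore_to_group_surj: "ore_to_group ` carrier H = carrier kG"
proof
  show "ore_to_group ` carrier H \<subseteq> carrier kG"
    using ore_to_group_algebra_map ring_hom_closed by (fastforce simp: algebra_map_def)
  show "carrier kG \<subseteq> ore_to_group ` carrier H"
  proof
    fix u :: "'g \<Rightarrow>\<^sub>0 'k" assume "u \<in> carrier kG"
    then have "group_to_ore u \<in> carrier H"
      using group_to_ore_algebra_map ring_hom_closed by (fastforce simp: algebra_map_def)
    then show "u \<in> ore_to_group ` carrier H"
      by (rule image_eqI[rotated]) (simp add: ore_to_group_to_ore)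
  qed
qed

definition xpow :: "nat \<Rightarrow> ('g \<times> nat \<Rightarrow>\<^sub>0 'k)" where "xpow i = Poly_Mapping.single (\<one>, i) 1"

lemma xpow_closed: "xpow i \<in> carrier H" by (simp add: xpow_def hopf_ore_simps)

lemma xpow_1: "xpow 1 = ore_var G" by (simp add: xpow_def ore_var_def)

lemma xpow_0: "xpow 0 = \<one>\<^bsub>H\<^esub>" by (simp add: xpow_def hopf_ore_simps ore_group_def)

lemma xpow_mult: "xpow i \<otimes>\<^bsub>H\<^esub> xpow j = xpow (i + j)"
  by (simp add: xpow_def hopf_ore_simps character_one[OF G.is_group character])

lemma xpow_pow: "ore_var G [^]\<^bsub>H\<^esub> i = xpow i"
  by (induction i) (simp_all add: xpow_0 xpow_mult flip: xpow_1)

lemma monomial: "g \<in> carrier G \<Longrightarrow> Poly_Mapping.single (g, i) c = group_to_ore (Poly_Mapping.single g c) \<otimes>\<^bsub>H\<^esub> xpow i"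
  by (simp add: xpow_def hopf_ore_simps character_one[OF G.is_group character])

lemma group_to_ore_closed: "u \<in> carrier kG \<Longrightarrow> group_to_ore u \<in> carrier H"
  using group_to_ore_algebra_map ring_hom_closed by (fastforce simp: algebra_map_def)

lemma tw_closed: "u \<in> carrier kG \<Longrightarrow> tw n u \<in> carrier kG"
  using tw_surj by blast

text \<open>
  This is \<open>x\<^sup>i g = \<chi>(g)\<^sup>-\<^sup>i g x\<^sup>i\<close>, solved for \<open>g x\<^sup>i\<close> and extended linearly.
\<close>

lemma xpow_commute: "u \<in> carrier kG \<Longrightarrow> group_to_ore u \<otimes>\<^bsub>H\<^esub> xpow i = xpow i \<otimes>\<^bsub>H\<^esub> group_to_ore (tw i u)"
proof -
  assume "u \<in> carrier kG"
  then have "Poly_Mapping.keys u \<subseteq> carrier G" by (simp add: group_algebra_simps)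
  then show ?thesis
  proof (induction u rule: poly_mapping_carrier_induct)
    case zero
    then show ?case using H.l_null[OF xpow_closed] H.r_null[OF xpow_closed] by (simp add: tw_def hopf_ore_simps)
  next
    case (single g c)
    then show ?case
      using character_nonzero[OF character]
      by (simp add: xpow_def hopf_ore_simps character_one[OF G.is_group character] tw_def field_simps)
  next
    case (add u v)
    then have "group_to_ore u \<in> carrier H" "group_to_ore v \<in> carrier H"
      "group_to_ore (tw i u) \<in> carrier H" "group_to_ore (tw i v) \<in> carrier H"
      by (auto intro!: group_to_ore_closed tw_closed simp: group_algebra_simps)
    then show ?case
      using add H.l_distr[of "group_to_ore u" "group_to_ore v" "xpow i"]
        H.r_distr[of "group_to_ore (tw i u)" "group_to_ore (tw i v)" "xpow i"] xpow_closed
      by (simp add: tw_def hopf_ore_simps)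
  qed
qed

lemma xpow_central:
  assumes s: "\<And>g. g \<in> carrier G \<Longrightarrow> \<chi> g ^ s = 1" and h: "h \<in> carrier H"
  shows "xpow s \<otimes>\<^bsub>H\<^esub> h = h \<otimes>\<^bsub>H\<^esub> xpow s"
proof -
  have "Poly_Mapping.keys h \<subseteq> carrier G \<times> UNIV" using h by (simp add: hopf_ore_simps)
  then show ?thesis
  proof (induction h rule: poly_mapping_carrier_induct)
    case zero
    then show ?case using H.l_null[OF xpow_closed] H.r_null[OF xpow_closed] by (simp add: hopf_ore_simps)
  next
    case (single p c)
    obtain g i where p: "p = (g, i)" by (cases p)
    have "inverse (\<chi> g) ^ s = 1" using s[of g] single by (simp add: p power_inverse)
    then show ?case
      using single by (simp add: p xpow_def hopf_ore_simps character_one[OF G.is_group character] add.commute)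
  next
    case (add u v)
    then have "u \<in> carrier H" "v \<in> carrier H" by (auto simp: hopf_ore_simps)
    then show ?case
      using add H.l_distr[of u v "xpow s"] H.r_distr[of u v "xpow s"] xpow_closed by (simp add: hopf_ore_simps)
  qed
qed

subsection \<open>Modules over the Hopf-Ore extension\<close>

text \<open>
  \<open>H\<close> is spanned by the products of elements of \<open>kG\<close> and powers of \<open>x\<close>. So \<open>H\<close>-submodules and \<open>H\<close>-linear
  maps are recognised by their behaviour under \<open>kG\<close> and \<open>x\<close>.
\<close>

lemma hopf_ore_action_induct:
  assumes M: "left_module H M" and h: "h \<in> carrier H"
    and zero: "P 0" and gr: "\<And>u i. u \<in> carrier kG \<Longrightarrow> P (group_to_ore u \<otimes>\<^bsub>H\<^esub> xpow i)"
    and add: "\<And>u v. \<lbrakk>u \<in> carrier H; v \<in> carrier H; P u; P v\<rbrakk> \<Longrightarrow> P (u + v)"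
  shows "P h"
proof -
  have "Poly_Mapping.keys h \<subseteq> carrier G \<times> UNIV" using h by (simp add: hopf_ore_simps)
  then show ?thesis
  proof (induction h rule: poly_mapping_carrier_induct)
    case (single p c)
    then show ?case using monomial[of "fst p" "snd p" c] gr[of "Poly_Mapping.single (fst p) c" "snd p"]
      by (auto simp: group_algebra_simps)
  next
    case (add u v)
    then show ?case using assms(5)[of u v] by (simp add: hopf_ore_simps)
  qed (rule zero)
qed

definition res :: "('g \<times> nat \<Rightarrow>\<^sub>0 'k, 'm) module \<Rightarrow> ('g \<Rightarrow>\<^sub>0 'k, 'm) module" where
  "res M = restrict_scalars group_to_ore M"

lemma res_simps [simp]:
  "carrier (res M) = carrier M"
  "x \<oplus>\<^bsub>res M\<^esub> y = x \<oplus>\<^bsub>M\<^esub> y"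
  "\<zero>\<^bsub>res M\<^esub> = \<zero>\<^bsub>M\<^esub>"
  "r \<odot>\<^bsub>res M\<^esub> x = group_to_ore r \<odot>\<^bsub>M\<^esub> x"
  "add (res M) = add M"
  by (simp_all add: res_def)

lemma res_left_module: "left_module H M \<Longrightarrow> left_module kG (res M)"
  using group_to_ore_algebra_map unfolding res_def algebra_map_def by (blast intro: restrict_scalars_left_module)

lemma res_finite_dim: "finite_dim kG (res M) \<longleftrightarrow> finite_dim H M"
  unfolding res_def by (rule restrict_scalars_finite_dim[OF group_to_ore_algebra_map])

lemma xpow_action_closed:
  assumes M: "left_module H M" and x: "\<And>m. m \<in> U \<Longrightarrow> xpow 1 \<odot>\<^bsub>M\<^esub> m \<in> U" and U: "U \<subseteq> carrier M" and m: "m \<in> U"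
  shows "xpow i \<odot>\<^bsub>M\<^esub> m \<in> U"
proof (induction i)
  case 0
  then show ?case using left_module.smult_one[OF M, of m] U m by (auto simp: xpow_0)
next
  case (Suc i)
  have "xpow (Suc i) \<odot>\<^bsub>M\<^esub> m = xpow 1 \<odot>\<^bsub>M\<^esub> (xpow i \<odot>\<^bsub>M\<^esub> m)"
    using left_module.smult_assoc[OF M xpow_closed xpow_closed, of m 1 i] U m by (auto simp: xpow_mult)
  then show ?case using x[OF Suc] by simp
qed

lemma hopf_ore_submodule:
  assumes M: "left_module H M" and U: "submodule U kG (res M)"
    and x: "\<And>m. m \<in> U \<Longrightarrow> xpow 1 \<odot>\<^bsub>M\<^esub> m \<in> U"
  shows "submodule U H M"
proof -
  interpret M: left_module H M by fact
  have sub: "U \<subseteq> carrier M" using submodule_subset[OF U] by simp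
  show ?thesis
  proof (rule M.submoduleI)
    fix h m assume "h \<in> carrier H" "m \<in> U"
    show "h \<odot>\<^bsub>M\<^esub> m \<in> U"
    proof (rule hopf_ore_action_induct[OF M \<open>h \<in> carrier H\<close>])
      show "0 \<odot>\<^bsub>M\<^esub> m \<in> U"
        using M.smult_zero_left[of m] sub \<open>m \<in> U\<close> submodule_zero[OF U] by (auto simp: hopf_ore_simps)
      fix u :: "'g \<Rightarrow>\<^sub>0 'k" and i assume u: "u \<in> carrier kG"
      have "xpow i \<odot>\<^bsub>M\<^esub> m \<in> U" by (rule xpow_action_closed[OF M x sub \<open>m \<in> U\<close>])
      then have "group_to_ore u \<odot>\<^bsub>M\<^esub> (xpow i \<odot>\<^bsub>M\<^esub> m) \<in> U" using submodule_smult[OF U u] by simp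
      then show "(group_to_ore u \<otimes>\<^bsub>H\<^esub> xpow i) \<odot>\<^bsub>M\<^esub> m \<in> U"
        using M.smult_assoc[OF group_to_ore_closed[OF u] xpow_closed] sub \<open>m \<in> U\<close> by auto
    next
      fix u v assume "u \<in> carrier H" "v \<in> carrier H" "u \<odot>\<^bsub>M\<^esub> m \<in> U" "v \<odot>\<^bsub>M\<^esub> m \<in> U"
      then show "(u + v) \<odot>\<^bsub>M\<^esub> m \<in> U"
        using M.smult_l_distr[of u v m] sub \<open>m \<in> U\<close> submodule_add[OF U] by (auto simp: hopf_ore_simps)
    qed
  qed (use sub submodule_zero[OF U] submodule_add[OF U] in auto)
qed

lemma hopf_ore_module_map:
  assumes M: "left_module H M" and N: "left_module H N" and f: "module_map kG (res M) (res N) f"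
    and x: "\<And>m. m \<in> carrier M \<Longrightarrow> f (xpow 1 \<odot>\<^bsub>M\<^esub> m) = xpow 1 \<odot>\<^bsub>N\<^esub> f m"
  shows "module_map H M N f"
proof (rule module_mapI)
  interpret M: left_module H M by fact
  interpret N: left_module H N by fact
  have f1: "f m \<in> carrier N" if "m \<in> carrier M" for m using module_mapD(1)[OF f] that by simp
  show "f m \<in> carrier N" if "m \<in> carrier M" for m using f1 that .
  have f2: "f (m \<oplus>\<^bsub>M\<^esub> m') = f m \<oplus>\<^bsub>N\<^esub> f m'" if "m \<in> carrier M" "m' \<in> carrier M" for m m'
    using module_mapD(2)[OF f] that by simp
  show "f (m \<oplus>\<^bsub>M\<^esub> m') = f m \<oplus>\<^bsub>N\<^esub> f m'" if "m \<in> carrier M" "m' \<in> carrier M" for m m'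
    using f2 that .
  have f0: "f \<zero>\<^bsub>M\<^esub> = \<zero>\<^bsub>N\<^esub>"
    using module_map_zero[OF res_left_module[OF M] res_left_module[OF N] f] by simp
  fix h m assume h: "h \<in> carrier H" and m: "m \<in> carrier M"
  have xi: "f (xpow i \<odot>\<^bsub>M\<^esub> m) = xpow i \<odot>\<^bsub>N\<^esub> f m" for i
  proof (induction i)
    case 0
    then show ?case using m f1 by (simp add: xpow_0 M.smult_one N.smult_one)
  next
    case (Suc i)
    have "xpow (Suc i) \<odot>\<^bsub>M\<^esub> m = xpow 1 \<odot>\<^bsub>M\<^esub> (xpow i \<odot>\<^bsub>M\<^esub> m)"
      using M.smult_assoc[OF xpow_closed xpow_closed, of m 1 i] m by (simp add: xpow_mult)
    moreover have "xpow (Suc i) \<odot>\<^bsub>N\<^esub> f m = xpow 1 \<odot>\<^bsub>N\<^esub> (xpow i \<odot>\<^bsub>N\<^esub> f m)"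
      using N.smult_assoc[OF xpow_closed xpow_closed, of "f m" 1 i] f1[OF m] by (simp add: xpow_mult)
    ultimately show ?case using x[of "xpow i \<odot>\<^bsub>M\<^esub> m"] Suc m M.smult_closed[OF xpow_closed m] by simp
  qed
  show "f (h \<odot>\<^bsub>M\<^esub> m) = h \<odot>\<^bsub>N\<^esub> f m"
  proof (rule hopf_ore_action_induct[OF M h])
    show "f (0 \<odot>\<^bsub>M\<^esub> m) = 0 \<odot>\<^bsub>N\<^esub> f m"
      using M.smult_zero_left[OF m] N.smult_zero_left[OF f1[OF m]] f0 by (simp add: hopf_ore_simps)
    fix u :: "'g \<Rightarrow>\<^sub>0 'k" and i assume u: "u \<in> carrier kG"
    show "f ((group_to_ore u \<otimes>\<^bsub>H\<^esub> xpow i) \<odot>\<^bsub>M\<^esub> m) = (group_to_ore u \<otimes>\<^bsub>H\<^esub> xpow i) \<odot>\<^bsub>N\<^esub> f m"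
      using module_mapD(3)[OF f, of "xpow i \<odot>\<^bsub>M\<^esub> m" u] m u f1[OF m]
      by (simp add: M.smult_assoc N.smult_assoc group_to_ore_closed xpow_closed M.smult_closed xi)
  next
    fix u v assume "u \<in> carrier H" "v \<in> carrier H" "f (u \<odot>\<^bsub>M\<^esub> m) = u \<odot>\<^bsub>N\<^esub> f m" "f (v \<odot>\<^bsub>M\<^esub> m) = v \<odot>\<^bsub>N\<^esub> f m"
    then show "f ((u + v) \<odot>\<^bsub>M\<^esub> m) = (u + v) \<odot>\<^bsub>N\<^esub> f m"
      using M.smult_l_distr[of u v m] N.smult_l_distr[of u v "f m"] m f1[OF m] f2
      by (simp add: hopf_ore_simps M.smult_closed)
  qed
qed

end

section \<open>Zero and injective actions of \<open>x\<close>\<close>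

context hopf_ore_setting
begin

lemma inflate_simps [simp]:
  "carrier (inflate V) = carrier V" "x \<oplus>\<^bsub>inflate V\<^esub> y = x \<oplus>\<^bsub>V\<^esub> y" "\<zero>\<^bsub>inflate V\<^esub> = \<zero>\<^bsub>V\<^esub>"
  "h \<odot>\<^bsub>inflate V\<^esub> x = ore_to_group h \<odot>\<^bsub>V\<^esub> x"
  by (simp_all add: inflate_def)

lemma inflate_simple_fd: "simple_fd kG V \<Longrightarrow> simple_fd H (inflate V)"
  unfolding inflate_def by (rule restrict_scalars_simple_fd[OF _ ore_to_group_algebra_map ore_to_group_surj])

lemma module_isomorphic_id:
  assumes "carrier M = carrier N" "\<And>x y. \<lbrakk>x \<in> carrier M; y \<in> carrier M\<rbrakk> \<Longrightarrow> x \<oplus>\<^bsub>M\<^esub> y = x \<oplus>\<^bsub>N\<^esub> y"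
    "\<And>r x. \<lbrakk>r \<in> carrier R; x \<in> carrier M\<rbrakk> \<Longrightarrow> r \<odot>\<^bsub>M\<^esub> x = r \<odot>\<^bsub>N\<^esub> x"
  shows "module_isomorphic R M N"
  unfolding module_isomorphic_def using assms by (intro exI[of _ id]) simp

lemma inflate_iso:
  assumes "module_isomorphic H (inflate V) (inflate W)"
  shows "module_isomorphic kG V W"
proof -
  have "module_isomorphic kG (res (inflate V)) (res (inflate W))"
    unfolding res_def by (rule restrict_scalars_iso[OF assms algebra_map_hom[OF group_to_ore_algebra_map]])
  moreover have "module_isomorphic kG V (res (inflate V))" "module_isomorphic kG (res (inflate W)) W"
    by (rule module_isomorphic_id; simp add: ore_to_group_to_ore)+
  ultimately show ?thesis by (blast intro: module_isomorphic_trans)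
qed

lemma inflate_iso': "module_isomorphic kG V W \<Longrightarrow> module_isomorphic H (inflate V) (inflate W)"
  unfolding inflate_def by (rule restrict_scalars_iso[OF _ algebra_map_hom[OF ore_to_group_algebra_map]])

lemma inflate_nonisomorphic:
  assumes "nonisomorphic_simples kG I V"
  shows "nonisomorphic_simples H I (\<lambda>i. inflate (V i))"
  using assms by (auto simp: nonisomorphic_simples_def intro: inflate_simple_fd dest: inflate_iso)

lemma xpow_inflate:
  assumes "left_module kG V" "v \<in> carrier V" "i > 0"
  shows "xpow i \<odot>\<^bsub>inflate V\<^esub> v = \<zero>\<^bsub>V\<^esub>"
  using left_module.smult_zero_left[OF assms(1,2)] assms(3) by (simp add: xpow_def group_algebra_simps)

text \<open>
  If \<open>x\<close> acts as zero, every \<open>kG\<close>-submodule is an \<open>H\<close>-submodule.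
\<close>

lemma simple_x_zero:
  assumes M: "simple_fd H M" and x: "\<And>m. m \<in> carrier M \<Longrightarrow> xpow 1 \<odot>\<^bsub>M\<^esub> m = \<zero>\<^bsub>M\<^esub>"
  shows "simple_fd kG (res M)" "module_isomorphic H M (inflate (res M))"
proof -
  have M': "simple_module H M" "finite_dim H M" using M by (auto simp: simple_fd_def)
  note LM = simple_moduleD(1)[OF M'(1)]
  interpret M: left_module H M by fact
  note LR = res_left_module[OF LM]
  have "U = {\<zero>\<^bsub>M\<^esub>} \<or> U = carrier M" if U: "submodule U kG (res M)" for U
  proof -
    have "submodule U H M"
      using submodule_subset[OF U] submodule_zero[OF U] x by (intro hopf_ore_submodule[OF LM U]) auto
    then show ?thesis by (rule simple_moduleD(2)[OF M'(1)])
  qed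
  then show "simple_fd kG (res M)"
    using LR M' by (simp add: simple_fd_def simple_module_def res_finite_dim)
  have "left_module H (inflate (res M))"
    unfolding inflate_def
    by (rule restrict_scalars_left_module[OF H.ring_axioms LR algebra_map_hom[OF ore_to_group_algebra_map]])
  then have "module_map H M (inflate (res M)) id"
    using x M.smult_zero_left
    by (intro hopf_ore_module_map[OF LM])
      (auto simp: ore_to_group_to_ore xpow_def hopf_ore_simps intro!: module_mapI M.smult_closed group_to_ore_closed)
  then show "module_isomorphic H M (inflate (res M))"
    by (auto simp: module_isomorphic_iff intro!: exI[of _ id])
qed

text \<open>
  The kernel of \<open>x\<close> is a submodule: since \<open>tw 1\<close> is an automorphism of \<open>kG\<close>, every element of \<open>x kG\<close> has
  the form \<open>u x\<close> with \<open>u \<in> kG\<close>.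
\<close>

lemma simple_x_injective:
  assumes M: "simple_module H M" and "m \<in> carrier M" "xpow 1 \<odot>\<^bsub>M\<^esub> m \<noteq> \<zero>\<^bsub>M\<^esub>"
    and "n \<in> carrier M" "xpow 1 \<odot>\<^bsub>M\<^esub> n = \<zero>\<^bsub>M\<^esub>"
  shows "n = \<zero>\<^bsub>M\<^esub>"
proof -
  note LM = simple_moduleD(1)[OF M]
  interpret M: left_module H M by fact
  interpret R: left_module kG "res M" by (rule res_left_module[OF LM])
  let ?K = "{n \<in> carrier M. xpow 1 \<odot>\<^bsub>M\<^esub> n = \<zero>\<^bsub>M\<^esub>}"
  have "submodule ?K kG (res M)"
  proof (rule R.submoduleI)
    fix u n assume u: "u \<in> carrier kG" and n: "n \<in> ?K"
    then obtain u' where u': "u' \<in> carrier kG" "u = tw 1 u'" using tw_surj[of 1] by blast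
    have "xpow 1 \<odot>\<^bsub>M\<^esub> (group_to_ore u \<odot>\<^bsub>M\<^esub> n) = (group_to_ore u' \<otimes>\<^bsub>H\<^esub> xpow 1) \<odot>\<^bsub>M\<^esub> n"
      using n u u' xpow_commute[OF u'(1), of 1]
      by (simp add: M.smult_assoc[symmetric] group_to_ore_closed xpow_closed)
    also have "\<dots> = \<zero>\<^bsub>M\<^esub>"
      using n u'(1) by (simp add: M.smult_assoc group_to_ore_closed xpow_closed M.smult_zero_right)
    finally show "u \<odot>\<^bsub>res M\<^esub> n \<in> ?K" using n u by (simp add: M.smult_closed group_to_ore_closed)
  qed (auto simp: M.smult_zero_right M.smult_r_distr xpow_closed)
  then have "submodule ?K H M"
    by (rule hopf_ore_submodule[OF LM]) (auto simp: M.smult_zero_right xpow_closed)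
  from simple_moduleD(2)[OF M this] show ?thesis using assms(2-5) by blast
qed

lemma xpow_injective:
  assumes M: "left_module H M" and inj: "\<And>n. \<lbrakk>n \<in> carrier M; xpow 1 \<odot>\<^bsub>M\<^esub> n = \<zero>\<^bsub>M\<^esub>\<rbrakk> \<Longrightarrow> n = \<zero>\<^bsub>M\<^esub>"
  shows "\<lbrakk>n \<in> carrier M; xpow i \<odot>\<^bsub>M\<^esub> n = \<zero>\<^bsub>M\<^esub>\<rbrakk> \<Longrightarrow> n = \<zero>\<^bsub>M\<^esub>"
proof (induction i)
  case 0
  then show ?case using left_module.smult_one[OF M] by (simp add: xpow_0)
next
  case (Suc i)
  interpret M: left_module H M by fact
  have "xpow 1 \<odot>\<^bsub>M\<^esub> (xpow i \<odot>\<^bsub>M\<^esub> n) = \<zero>\<^bsub>M\<^esub>"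
    using Suc.prems by (simp add: M.smult_assoc[symmetric] xpow_closed xpow_mult)
  then have "xpow i \<odot>\<^bsub>M\<^esub> n = \<zero>\<^bsub>M\<^esub>" by (rule inj[OF M.smult_closed[OF xpow_closed Suc.prems(1)]])
  then show ?case by (rule Suc.IH[OF Suc.prems(1)])
qed

text \<open>This is the relation \<open>g x\<^sup>i = \<chi>(g)\<^sup>i x\<^sup>i g\<close>.\<close>

lemma xpow_module_map:
  assumes M: "left_module H M" and f: "module_map kG V (res M) f"
  shows "module_map kG (restrict_scalars (tw i) V) (res M) (\<lambda>v. xpow i \<odot>\<^bsub>M\<^esub> f v)"
proof (rule module_mapI)
  interpret M: left_module H M by fact
  have f1: "f v \<in> carrier M" if "v \<in> carrier V" for v using module_mapD(1)[OF f that] by simp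
  show "xpow i \<odot>\<^bsub>M\<^esub> f v \<in> carrier (res M)" if "v \<in> carrier (restrict_scalars (tw i) V)" for v
    using that f1 by (simp add: M.smult_closed xpow_closed)
  show "xpow i \<odot>\<^bsub>M\<^esub> f (v \<oplus>\<^bsub>restrict_scalars (tw i) V\<^esub> w) = xpow i \<odot>\<^bsub>M\<^esub> f v \<oplus>\<^bsub>res M\<^esub> xpow i \<odot>\<^bsub>M\<^esub> f w"
    if "v \<in> carrier (restrict_scalars (tw i) V)" "w \<in> carrier (restrict_scalars (tw i) V)" for v w
    using that f1 by (simp add: module_mapD[OF f] M.smult_r_distr xpow_closed)
  show "xpow i \<odot>\<^bsub>M\<^esub> f (u \<odot>\<^bsub>restrict_scalars (tw i) V\<^esub> v) = u \<odot>\<^bsub>res M\<^esub> (xpow i \<odot>\<^bsub>M\<^esub> f v)"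
    if "u \<in> carrier kG" "v \<in> carrier (restrict_scalars (tw i) V)" for u v
    using that f1[of v] tw_closed[of u i]
    by (simp add: module_mapD[OF f] M.smult_assoc[symmetric] xpow_closed group_to_ore_closed xpow_commute)
qed

lemma group_xpow:
  assumes M: "left_module H M" and g: "g \<in> carrier G" and m: "m \<in> carrier M"
  shows "ore_group g \<odot>\<^bsub>M\<^esub> (xpow i \<odot>\<^bsub>M\<^esub> m) = (\<chi> g ^ i \<odot>\<^bsub>H\<^esub> \<one>\<^bsub>H\<^esub>) \<odot>\<^bsub>M\<^esub> (xpow i \<odot>\<^bsub>M\<^esub> (ore_group g \<odot>\<^bsub>M\<^esub> m))"
proof -
  interpret M: left_module H M by fact
  have cl: "ore_group g \<in> carrier H" using g by (simp add: ore_group_def hopf_ore_simps)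
  have "ore_group g \<otimes>\<^bsub>H\<^esub> xpow i = (\<chi> g ^ i \<odot>\<^bsub>H\<^esub> \<one>\<^bsub>H\<^esub>) \<otimes>\<^bsub>H\<^esub> (xpow i \<otimes>\<^bsub>H\<^esub> ore_group g)"
    using g character_nonzero[OF character g]
    by (simp add: ore_group_def xpow_def hopf_ore_simps character_one[OF G.is_group character] field_simps)
  then show ?thesis
    using m cl by (simp add: M.smult_assoc[symmetric] xpow_closed H.scal_closed)
qed

lemma scal_commute:
  assumes M: "left_module H M" and h: "h \<in> carrier H" and m: "m \<in> carrier M"
  shows "h \<odot>\<^bsub>M\<^esub> ((c \<odot>\<^bsub>H\<^esub> \<one>\<^bsub>H\<^esub>) \<odot>\<^bsub>M\<^esub> m) = (c \<odot>\<^bsub>H\<^esub> \<one>\<^bsub>H\<^esub>) \<odot>\<^bsub>M\<^esub> (h \<odot>\<^bsub>M\<^esub> m)"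
  using assms by (simp add: left_module.smult_assoc[OF M, symmetric] H.scal_closed H.scal_central)

lemma group_linear_op:
  assumes M: "left_module H M" and h: "h \<in> carrier H"
  shows "vspace.linear_op (scalar_module H M) (\<lambda>m. h \<odot>\<^bsub>M\<^esub> m)"
proof -
  interpret M: left_module H M by fact
  interpret W: vspace "scalar_module H M" by (rule H.vspace_scalar_module[OF M])
  show ?thesis
    unfolding W.linear_op_def using h by (simp add: M.smult_closed M.smult_r_distr scal_commute[OF M])
qed

end

locale hopf_ore_closed = hopf_ore_setting G \<chi> a
  for G :: "('g, 'z) monoid_scheme" (structure) and \<chi> :: "'g \<Rightarrow> 'k::alg_closed_field" and a :: 'g
begin

text \<open>
  Powers of \<open>x\<close> move an eigenvector of \<open>g\<close> with eigenvalue \<open>\<mu>\<close> to eigenvectors with eigenvalues \<open>\<mu> \<chi>(g)\<^sup>i\<close>,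
  \<open>i = 0, 1, \<dots>\<close>. If \<open>M\<close> is spanned by \<open>n\<close> vectors, at most \<open>n\<close> of them are distinct, so \<open>\<chi>(g)\<close> is a root
  of unity of order at most \<open>n\<close>, and \<open>n!\<close> is a common exponent for all \<open>g\<close>.
\<close>

lemma injective_x_finite_order:
  fixes M :: "('g \<times> nat \<Rightarrow>\<^sub>0 'k, 'm) module"
  assumes M: "left_module H M" and fd: "finite_dim H M" and nz: "m \<in> carrier M" "m \<noteq> \<zero>\<^bsub>M\<^esub>"
    and inj: "\<And>n. \<lbrakk>n \<in> carrier M; xpow 1 \<odot>\<^bsub>M\<^esub> n = \<zero>\<^bsub>M\<^esub>\<rbrakk> \<Longrightarrow> n = \<zero>\<^bsub>M\<^esub>"
  shows "\<exists>N>0. \<forall>g\<in>carrier G. \<chi> g ^ N = 1"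
proof -
  interpret M: left_module H M by fact
  define W where "W = scalar_module H M"
  interpret W: vspace W unfolding W_def by (rule H.vspace_scalar_module[OF M])
  have Wc: "carrier W = carrier M" "\<zero>\<^bsub>W\<^esub> = \<zero>\<^bsub>M\<^esub>" by (simp_all add: W_def)
  obtain n L where cover: "poly_cover W n L" using H.finite_dim_cover[OF M fd] unfolding W_def by blast
  have "\<chi> g ^ fact n = 1" if g: "g \<in> carrier G" for g
  proof (rule ccontr)
    assume contra: "\<chi> g ^ fact n \<noteq> 1"
    have og: "ore_group g \<in> carrier H" using g by (simp add: ore_group_def hopf_ore_simps)
    define T where "T = (\<lambda>m. ore_group g \<odot>\<^bsub>M\<^esub> m)"
    have T: "W.linear_op T" using group_linear_op[OF M og] by (simp add: T_def W_def)
    obtain v \<mu> where v: "v \<in> carrier M" "v \<noteq> \<zero>\<^bsub>M\<^esub>" "T v = \<mu> \<odot>\<^bsub>W\<^esub> v"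
      using eigenvector_exists[OF W.vspace_axioms cover T, of m] nz by (auto simp: Wc)
    have \<mu>: "\<mu> \<noteq> 0"
    proof
      assume "\<mu> = 0"
      then have "T v = \<zero>\<^bsub>M\<^esub>" using v W.scale_zero_left[of v] by (simp add: Wc)
      then have "ore_group (inv g) \<odot>\<^bsub>M\<^esub> (ore_group g \<odot>\<^bsub>M\<^esub> v) = \<zero>\<^bsub>M\<^esub>"
        using g by (simp add: T_def M.smult_zero_right ore_group_def hopf_ore_simps)
      moreover have "ore_group (inv g) \<otimes>\<^bsub>H\<^esub> ore_group g = \<one>\<^bsub>H\<^esub>"
        using g by (simp add: ore_group_def hopf_ore_simps)
      moreover have "ore_group (inv g) \<in> carrier H" using g by (simp add: ore_group_def hopf_ore_simps)
      ultimately have "v = \<zero>\<^bsub>M\<^esub>" using v(1) og by (simp add: M.smult_assoc[symmetric] M.smult_one)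
      then show False using v(2) by simp
    qed
    define w where "w = (\<lambda>i. xpow i \<odot>\<^bsub>M\<^esub> v)"
    have w: "w i \<in> carrier W" for i using v(1) by (simp add: w_def Wc M.smult_closed xpow_closed)
    have Tw: "T (w i) = (\<mu> * \<chi> g ^ i) \<odot>\<^bsub>W\<^esub> w i" for i
    proof -
      have "T (w i) = \<chi> g ^ i \<odot>\<^bsub>W\<^esub> (xpow i \<odot>\<^bsub>M\<^esub> (\<mu> \<odot>\<^bsub>W\<^esub> v))"
        using group_xpow[OF M g v(1)] v(3) by (simp add: T_def w_def W_def)
      also have "xpow i \<odot>\<^bsub>M\<^esub> (\<mu> \<odot>\<^bsub>W\<^esub> v) = \<mu> \<odot>\<^bsub>W\<^esub> w i"
        using scal_commute[OF M xpow_closed v(1)] by (simp add: w_def W_def)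
      finally show ?thesis using W.scale_scale[OF w] by (simp add: mult.commute)
    qed
    have inj_w: "inj_on (\<lambda>i. \<mu> * \<chi> g ^ i) {..<Suc n}"
    proof (rule linorder_inj_onI)
      fix i j :: nat assume ij: "i < j" "i \<in> {..<Suc n}" "j \<in> {..<Suc n}"
      show "\<mu> * \<chi> g ^ i \<noteq> \<mu> * \<chi> g ^ j"
      proof
        assume "\<mu> * \<chi> g ^ i = \<mu> * \<chi> g ^ j"
        then have "\<chi> g ^ i = \<chi> g ^ j" using \<mu> by simp
        also have "\<dots> = \<chi> g ^ i * \<chi> g ^ (j - i)" using ij(1) by (simp flip: power_add)
        finally have one: "\<chi> g ^ (j - i) = 1" using character_nonzero[OF character g] by simp
        have "j - i dvd fact n" using ij by (intro dvd_fact) auto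
        then obtain l where "fact n = (j - i) * l" by (rule dvdE)
        then show False using contra one by (simp add: power_mult)
      qed
    qed auto
    obtain p where p: "p \<noteq> 0" "Polynomial.degree p \<le> n"
      "(\<Oplus>\<^bsub>W\<^esub>i\<in>{..<Suc n}. Polynomial.coeff p i \<odot>\<^bsub>W\<^esub> w i) = \<zero>\<^bsub>W\<^esub>"
      using W.linear_from_poly_kernel[OF cover W.linear_combination_from_poly[of "Suc n" w]] w by blast
    have "\<forall>i\<in>{..<Suc n}. Polynomial.coeff p i \<odot>\<^bsub>W\<^esub> w i \<in> {\<zero>\<^bsub>W\<^esub>}"
    proof (rule W.eigenvector_components[OF T W.zero_subspace _ _ _ _ inj_w])
      show "T (Polynomial.coeff p i \<odot>\<^bsub>W\<^esub> w i) = (\<mu> * \<chi> g ^ i) \<odot>\<^bsub>W\<^esub> (Polynomial.coeff p i \<odot>\<^bsub>W\<^esub> w i)" for i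
        using w by (simp add: W.linear_opD(3)[OF T] Tw W.scale_scale mult.commute)
    qed (use w p(3) W.linear_op_zero[OF T] in auto)
    then have "Polynomial.coeff p i = 0" if "i \<le> n" for i
      using that W.scale_eq_zero[OF w, of "Polynomial.coeff p i" i] xpow_injective[OF M inj v(1), of i] v(2)
      by (auto simp: w_def Wc less_Suc_eq_le)
    then have "p = 0" using p(2) by (intro poly_eqI) (metis Polynomial.coeff_0 Polynomial.coeff_eq_0 le_trans not_le)
    then show False using p(1) by simp
  qed
  then show ?thesis by (intro exI[of _ "fact n"]) simp
qed

end

section \<open>Tensor products and quotient modules\<close>

text \<open>
  The tensor product of a right module \<open>M\<close> and a left module \<open>N\<close>. Its additive structure and its
  universal property depend on the scalars only through the balancing relations.
\<close>

locale tensor_setup = M: abelian_group M + N: abelian_group N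
  for R :: "('r, 'y) ring_scheme" and M :: "('r, 'm) module" and N :: "('r, 'n) module" +
  assumes smult_M: "\<lbrakk>r \<in> carrier R; m \<in> carrier M\<rbrakk> \<Longrightarrow> r \<odot>\<^bsub>M\<^esub> m \<in> carrier M"
    and smult_N: "\<lbrakk>r \<in> carrier R; n \<in> carrier N\<rbrakk> \<Longrightarrow> r \<odot>\<^bsub>N\<^esub> n \<in> carrier N"
begin

abbreviation F :: "('m \<times> 'n \<Rightarrow>\<^sub>0 int) monoid" where "F \<equiv> free_Abelian_group (carrier M \<times> carrier N)"

text \<open>
  \<open>F\<close> is the free abelian group on the pairs, \<open>rel\<close> its subgroup of relations, \<open>cl t\<close> the class of \<open>t\<close> modulo
  \<open>rel\<close>, and \<open>T act\<close> the tensor product on which \<open>h\<close> acts by the representatives \<open>act h\<close>.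
\<close>

definition rel :: "('m \<times> 'n \<Rightarrow>\<^sub>0 int) set" where "rel = generate F (tensor_relations R M N)"

definition cl :: "('m \<times> 'n \<Rightarrow>\<^sub>0 int) \<Rightarrow> ('m \<times> 'n \<Rightarrow>\<^sub>0 int) set" where "cl t = rel #>\<^bsub>F\<^esub> t"

sublocale F: comm_group F by (rule abelian_free_Abelian_group)

lemma frag_of_F: "\<lbrakk>m \<in> carrier M; n \<in> carrier N\<rbrakk> \<Longrightarrow> frag_of (m, n) \<in> carrier F"
  by simp

lemma add_F: "\<lbrakk>t \<in> carrier F; u \<in> carrier F\<rbrakk> \<Longrightarrow> t + u \<in> carrier F"
  using F.m_closed[of t u] by (simp only: mult_free_Abelian_group)

lemma diff_F: "\<lbrakk>t \<in> carrier F; u \<in> carrier F\<rbrakk> \<Longrightarrow> t - u \<in> carrier F"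
  using keys_diff[of t u] by auto

lemma relations_F: "tensor_relations R M N \<subseteq> carrier F"
  unfolding tensor_relations_def
  by (auto simp del: carrier_free_Abelian_group_iff intro!: diff_F frag_of_F smult_M smult_N)

lemma rel_subgroup: "subgroup rel F"
  unfolding rel_def by (rule F.generate_is_subgroup[OF relations_F])

lemma rel_normal: "rel \<lhd> F"
  by (rule F.subgroup_imp_normal[OF rel_subgroup])

lemma rel_F: "t \<in> rel \<Longrightarrow> t \<in> carrier F"
  using subgroup.subset[OF rel_subgroup] by blast

lemma rel_closed:
  "0 \<in> rel" "\<lbrakk>t \<in> rel; u \<in> rel\<rbrakk> \<Longrightarrow> t + u \<in> rel" "t \<in> rel \<Longrightarrow> - t \<in> rel" "\<lbrakk>t \<in> rel; u \<in> rel\<rbrakk> \<Longrightarrow> t - u \<in> rel"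
proof -
  show "0 \<in> rel" using subgroup.one_closed[OF rel_subgroup] by simp
  show add: "t + u \<in> rel" if "t \<in> rel" "u \<in> rel" for t u
    using subgroup.m_closed[OF rel_subgroup that] by simp
  show minus: "- t \<in> rel" if "t \<in> rel" for t
    using subgroup.m_inv_closed[OF rel_subgroup that] rel_F[OF that] by simp
  show "t - u \<in> rel" if "t \<in> rel" "u \<in> rel"
    using add[OF that(1) minus[OF that(2)]] by simp
qed

lemma cl_mem: "u \<in> cl t \<longleftrightarrow> u - t \<in> rel"
  by (auto simp: cl_def r_coset_def) (metis diff_add_cancel)

lemma cl_eq: "cl t = cl u \<longleftrightarrow> t - u \<in> rel"
proof
  assume "cl t = cl u"
  moreover have "t \<in> cl t" by (simp add: cl_mem rel_closed)
  ultimately show "t - u \<in> rel" by (simp add: cl_mem)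
next
  assume tu: "t - u \<in> rel"
  have "v - t \<in> rel \<longleftrightarrow> v - u \<in> rel" for v
    using rel_closed(2)[OF _ tu, of "v - t"] rel_closed(4)[OF _ tu, of "v - u"] by auto
  then show "cl t = cl u" by (auto simp: cl_mem)
qed

lemma rel_induct [consumes 1, case_names zero diff gen]:
  assumes "t \<in> rel" and zero: "P 0" and diff: "\<And>t u. \<lbrakk>t \<in> rel; u \<in> rel; P t; P u\<rbrakk> \<Longrightarrow> P (t - u)"
    and gen: "\<And>t. t \<in> tensor_relations R M N \<Longrightarrow> P t"
  shows "P t"
proof -
  have "t \<in> generate F (tensor_relations R M N)" using assms(1) by (simp add: rel_def)
  then show ?thesis
  proof (induction t rule: generate.induct)
    case one
    then show ?case using zero by simp
  next
    case (incl t)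
    then show ?case by (rule gen)
  next
    case (inv t)
    then have "t \<in> rel" by (auto simp: rel_def intro: generate.incl)
    then show ?case using diff[OF rel_closed(1) _ zero gen[OF inv], of] rel_F[of t] by simp
  next
    case (eng t u)
    then have tu: "t \<in> rel" "u \<in> rel" by (simp_all add: rel_def)
    have "P (0 - u)" using diff[OF rel_closed(1) tu(2) zero eng.IH(2)] .
    then have "P (t - (0 - u))"
      using rel_closed(3)[OF tu(2)] by (intro diff[OF tu(1) _ eng.IH(1)]) simp_all
    then show ?case by simp
  qed
qed

context
  fixes act :: "'h \<Rightarrow> 'm \<times> 'n \<Rightarrow> ('m \<times> 'n \<Rightarrow>\<^sub>0 int)"
begin

definition T :: "('h, ('m \<times> 'n \<Rightarrow>\<^sub>0 int) set) module" where "T = tensor_module R M N act"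

lemma T_simps:
  "carrier T = cl ` carrier F" "\<zero>\<^bsub>T\<^esub> = cl 0"
  "\<lbrakk>t \<in> carrier F; u \<in> carrier F\<rbrakk> \<Longrightarrow> cl t \<oplus>\<^bsub>T\<^esub> cl u = cl (t + u)"
  "h \<odot>\<^bsub>T\<^esub> Y = (\<Union>t\<in>Y. cl (frag_extend (act h) t))"
proof -
  show "carrier T = cl ` carrier F"
    by (auto simp: T_def tensor_module_def Let_def FactGroup_def RCOSETS_def cl_def rel_def)
  show "\<zero>\<^bsub>T\<^esub> = cl 0"
    by (simp add: T_def tensor_module_def Let_def FactGroup_def cl_def flip: rel_def)
      (use F.coset_mult_one[OF subgroup.subset[OF rel_subgroup]] in simp)
  show "cl t \<oplus>\<^bsub>T\<^esub> cl u = cl (t + u)" if "t \<in> carrier F" "u \<in> carrier F"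
    using normal.rcos_sum[OF rel_normal that]
    by (simp add: T_def tensor_module_def Let_def FactGroup_def cl_def flip: rel_def)
  show "h \<odot>\<^bsub>T\<^esub> Y = (\<Union>t\<in>Y. cl (frag_extend (act h) t))"
    by (simp add: T_def tensor_module_def Let_def cl_def rel_def)
qed

lemma T_abelian_group: "abelian_group T"
proof (rule abelian_groupI)
  fix Y assume "Y \<in> carrier T"
  then obtain t where t: "Y = cl t" "t \<in> carrier F" by (auto simp: T_simps)
  then have "0 - t \<in> carrier F" using diff_F[of 0 t] by simp
  then show "\<exists>Y'\<in>carrier T. Y' \<oplus>\<^bsub>T\<^esub> Y = \<zero>\<^bsub>T\<^esub>"
    using t T_simps(3)[of "0 - t" t] by (intro bexI[of _ "cl (0 - t)"]) (simp_all add: T_simps(1,2))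
next
  fix Y Z assume "Y \<in> carrier T" "Z \<in> carrier T"
  then obtain t u where "Y = cl t" "t \<in> carrier F" "Z = cl u" "u \<in> carrier F"
    by (auto simp: T_simps(1) simp del: carrier_free_Abelian_group_iff)
  then show "Y \<oplus>\<^bsub>T\<^esub> Z \<in> carrier T" "Y \<oplus>\<^bsub>T\<^esub> Z = Z \<oplus>\<^bsub>T\<^esub> Y"
    using add_F[of t u] by (simp_all add: T_simps add.commute)
next
  fix Y Z Z' assume "Y \<in> carrier T" "Z \<in> carrier T" "Z' \<in> carrier T"
  then obtain t u v where "Y = cl t" "t \<in> carrier F" "Z = cl u" "u \<in> carrier F" "Z' = cl v" "v \<in> carrier F"
    by (auto simp: T_simps(1) simp del: carrier_free_Abelian_group_iff)
  then show "Y \<oplus>\<^bsub>T\<^esub> Z \<oplus>\<^bsub>T\<^esub> Z' = Y \<oplus>\<^bsub>T\<^esub> (Z \<oplus>\<^bsub>T\<^esub> Z')"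
    using add_F[of t u] add_F[of u v] by (simp add: T_simps add.assoc)
next
  fix Y assume "Y \<in> carrier T"
  then obtain t where "Y = cl t" "t \<in> carrier F" by (auto simp: T_simps(1) simp del: carrier_free_Abelian_group_iff)
  then show "\<zero>\<^bsub>T\<^esub> \<oplus>\<^bsub>T\<^esub> Y = Y" using T_simps(3)[of 0 t] by (simp add: T_simps(2))
qed (auto simp: T_simps(1,2))

end

definition pure :: "'m \<Rightarrow> 'n \<Rightarrow> ('m \<times> 'n \<Rightarrow>\<^sub>0 int) set" where "pure m n = cl (frag_of (m, n))"

text \<open>
  The universal property of the tensor product, before passing to the quotient: the extension of a
  balanced map to the free abelian group vanishes on the relations.
\<close>

lemma balanced_lift:
  fixes P :: "('p, 'q) ring_scheme"
  assumes P: "abelian_group P"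
    and closed: "\<And>m n. \<lbrakk>m \<in> carrier M; n \<in> carrier N\<rbrakk> \<Longrightarrow> \<phi> m n \<in> carrier P"
    and add_left: "\<And>m m' n. \<lbrakk>m \<in> carrier M; m' \<in> carrier M; n \<in> carrier N\<rbrakk> \<Longrightarrow>
      \<phi> (m \<oplus>\<^bsub>M\<^esub> m') n = \<phi> m n \<oplus>\<^bsub>P\<^esub> \<phi> m' n"
    and add_right: "\<And>m n n'. \<lbrakk>m \<in> carrier M; n \<in> carrier N; n' \<in> carrier N\<rbrakk> \<Longrightarrow>
      \<phi> m (n \<oplus>\<^bsub>N\<^esub> n') = \<phi> m n \<oplus>\<^bsub>P\<^esub> \<phi> m n'"
    and balanced: "\<And>r m n. \<lbrakk>r \<in> carrier R; m \<in> carrier M; n \<in> carrier N\<rbrakk> \<Longrightarrow>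
      \<phi> (r \<odot>\<^bsub>M\<^esub> m) n = \<phi> m (r \<odot>\<^bsub>N\<^esub> n)"
  obtains f where "f \<in> hom F (add_monoid P)"
    "\<And>m n. \<lbrakk>m \<in> carrier M; n \<in> carrier N\<rbrakk> \<Longrightarrow> f (frag_of (m, n)) = \<phi> m n"
    "\<And>t. t \<in> rel \<Longrightarrow> f t = \<zero>\<^bsub>P\<^esub>"
proof -
  interpret P: abelian_group P by fact
  have "case_prod \<phi> ` (carrier M \<times> carrier N) \<subseteq> carrier (add_monoid P)" using closed by auto
  then obtain f where f: "f \<in> hom F (add_monoid P)"
    "\<And>x. x \<in> carrier M \<times> carrier N \<Longrightarrow> f (frag_of x) = case_prod \<phi> x"
    by (rule comm_group.free_Abelian_group_universal[OF P.a_comm_group]) blast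
  have fof: "f (frag_of (m, n)) = \<phi> m n" if "m \<in> carrier M" "n \<in> carrier N" for m n
    using f(2)[of "(m, n)"] that by simp
  have fcl: "f t \<in> carrier P" if "t \<in> carrier F" for t using hom_in_carrier[OF f(1) that] by simp
  have fadd: "f (t + u) = f t \<oplus>\<^bsub>P\<^esub> f u" if "t \<in> carrier F" "u \<in> carrier F" for t u
    using hom_mult[OF f(1) that] by simp
  have fdiff: "f (t - u) = f t \<ominus>\<^bsub>P\<^esub> f u" if tu: "t \<in> carrier F" "u \<in> carrier F" for t u
  proof -
    have "f t = f (t - u) \<oplus>\<^bsub>P\<^esub> f u" using fadd[OF diff_F[OF tu] tu(2)] by simp
    then show ?thesis using fcl[OF diff_F[OF tu]] fcl[OF tu(2)]
      by (simp add: a_minus_def P.a_assoc P.r_neg)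
  qed
  have f0: "f 0 = \<zero>\<^bsub>P\<^esub>" using fdiff[of 0 0] fcl[of 0] by (simp add: a_minus_def P.r_neg)
  have cancel: "x \<oplus>\<^bsub>P\<^esub> y \<ominus>\<^bsub>P\<^esub> x \<ominus>\<^bsub>P\<^esub> y = \<zero>\<^bsub>P\<^esub>" if "x \<in> carrier P" "y \<in> carrier P" for x y
    using that P.r_neg[of "x \<oplus>\<^bsub>P\<^esub> y"] by (simp add: a_minus_def P.minus_add P.a_assoc)
  have "f t = \<zero>\<^bsub>P\<^esub>" if "t \<in> rel" for t
    using that
  proof (induction t rule: rel_induct)
    case (diff t u)
    then show ?case using fdiff[OF rel_F rel_F, of t u] by (simp add: a_minus_def P.r_neg)
  next
    case (gen t)
    then consider
      (1) m m' n where "t = frag_of (m \<oplus>\<^bsub>M\<^esub> m', n) - frag_of (m, n) - frag_of (m', n)"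
        "m \<in> carrier M" "m' \<in> carrier M" "n \<in> carrier N"
      | (2) m n n' where "t = frag_of (m, n \<oplus>\<^bsub>N\<^esub> n') - frag_of (m, n) - frag_of (m, n')"
        "m \<in> carrier M" "n \<in> carrier N" "n' \<in> carrier N"
      | (3) r m n where "t = frag_of (r \<odot>\<^bsub>M\<^esub> m, n) - frag_of (m, r \<odot>\<^bsub>N\<^esub> n)"
        "r \<in> carrier R" "m \<in> carrier M" "n \<in> carrier N"
      unfolding tensor_relations_def by blast
    then show ?case
    proof cases
      case 1
      then show ?thesis
        by (simp only: fdiff diff_F frag_of_F fof add_left M.a_closed cancel closed)
    next
      case 2
      then show ?thesis
        by (simp only: fdiff diff_F frag_of_F fof add_right N.a_closed cancel closed)
    next
      case 3
      then show ?thesis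
        using closed[OF 3(3) smult_N[OF 3(2,4)]]
        by (simp only: fdiff diff_F frag_of_F fof balanced smult_M smult_N) (simp add: a_minus_def P.r_neg)
    qed
  qed (rule f0)
  then show thesis using that f(1) fof by blast
qed

lemma relations:
  "\<lbrakk>m \<in> carrier M; m' \<in> carrier M; n \<in> carrier N\<rbrakk> \<Longrightarrow>
    frag_of (m \<oplus>\<^bsub>M\<^esub> m', n) - frag_of (m, n) - frag_of (m', n) \<in> tensor_relations R M N"
  "\<lbrakk>m \<in> carrier M; n \<in> carrier N; n' \<in> carrier N\<rbrakk> \<Longrightarrow>
    frag_of (m, n \<oplus>\<^bsub>N\<^esub> n') - frag_of (m, n) - frag_of (m, n') \<in> tensor_relations R M N"
  "\<lbrakk>r \<in> carrier R; m \<in> carrier M; n \<in> carrier N\<rbrakk> \<Longrightarrow>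
    frag_of (r \<odot>\<^bsub>M\<^esub> m, n) - frag_of (m, r \<odot>\<^bsub>N\<^esub> n) \<in> tensor_relations R M N"
  unfolding tensor_relations_def by blast+

lemma pure_simps:
  assumes "m \<in> carrier M" "n \<in> carrier N"
  shows "pure m n \<in> carrier (T act)"
    and "m' \<in> carrier M \<Longrightarrow> pure (m \<oplus>\<^bsub>M\<^esub> m') n = pure m n \<oplus>\<^bsub>T act\<^esub> pure m' n"
    and "n' \<in> carrier N \<Longrightarrow> pure m (n \<oplus>\<^bsub>N\<^esub> n') = pure m n \<oplus>\<^bsub>T act\<^esub> pure m n'"
    and "r \<in> carrier R \<Longrightarrow> pure (r \<odot>\<^bsub>M\<^esub> m) n = pure m (r \<odot>\<^bsub>N\<^esub> n)"
proof -
  have gen: "t \<in> rel" if "t \<in> tensor_relations R M N" for t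
    using that unfolding rel_def by (rule generate.incl)
  show "pure m n \<in> carrier (T act)" using assms by (simp add: pure_def T_simps(1))
  show "pure (m \<oplus>\<^bsub>M\<^esub> m') n = pure m n \<oplus>\<^bsub>T act\<^esub> pure m' n" if "m' \<in> carrier M"
    using assms that unfolding pure_def
    by (subst T_simps(3)) (auto simp: cl_eq diff_diff_eq[symmetric] intro!: gen relations)
  show "pure m (n \<oplus>\<^bsub>N\<^esub> n') = pure m n \<oplus>\<^bsub>T act\<^esub> pure m n'" if "n' \<in> carrier N"
    using assms that unfolding pure_def
    by (subst T_simps(3)) (auto simp: cl_eq diff_diff_eq[symmetric] intro!: gen relations)
  show "pure (r \<odot>\<^bsub>M\<^esub> m) n = pure m (r \<odot>\<^bsub>N\<^esub> n)" if "r \<in> carrier R"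
    using assms that unfolding pure_def by (auto simp: cl_eq intro!: gen relations)
qed

lemma T_induct:
  assumes Y: "Y \<in> carrier (T act)" and zero: "P \<zero>\<^bsub>T act\<^esub>"
    and diff: "\<And>Y Z. \<lbrakk>Y \<in> carrier (T act); Z \<in> carrier (T act); P Y; P Z\<rbrakk> \<Longrightarrow> P (Y \<ominus>\<^bsub>T act\<^esub> Z)"
    and pure: "\<And>m n. \<lbrakk>m \<in> carrier M; n \<in> carrier N\<rbrakk> \<Longrightarrow> P (pure m n)"
  shows "P Y"
proof -
  interpret T: abelian_group "T act" by (rule T_abelian_group)
  obtain t where t: "Y = cl t" "t \<in> carrier F" using Y by (auto simp: T_simps(1))
  have "P (cl t)"
  proof (rule free_Abelian_group_induct[of t "carrier M \<times> carrier N" "\<lambda>t. P (cl t)"])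
    show "Poly_Mapping.keys t \<subseteq> carrier M \<times> carrier N" using t(2) by simp
    show "P (cl 0)" using zero by (simp add: T_simps(2))
  next
    fix t u
    assume *: "Poly_Mapping.keys t \<subseteq> carrier M \<times> carrier N" "Poly_Mapping.keys u \<subseteq> carrier M \<times> carrier N"
      "P (cl t)" "P (cl u)"
    then have F: "t \<in> carrier F" "u \<in> carrier F" by simp_all
    have cl: "cl t \<in> carrier (T act)" "cl u \<in> carrier (T act)" "cl (t - u) \<in> carrier (T act)"
      using F diff_F[OF F] by (simp_all add: T_simps(1) del: carrier_free_Abelian_group_iff)
    have "cl (t - u) \<oplus>\<^bsub>T act\<^esub> cl u = cl t" using T_simps(3)[OF diff_F[OF F] F(2)] by simp
    then have "cl t \<ominus>\<^bsub>T act\<^esub> cl u = (cl (t - u) \<oplus>\<^bsub>T act\<^esub> cl u) \<oplus>\<^bsub>T act\<^esub> \<ominus>\<^bsub>T act\<^esub> cl u"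
      by (simp add: a_minus_def)
    also have "\<dots> = cl (t - u)" using cl by (simp add: T.a_assoc T.r_neg)
    finally show "P (cl (t - u))" using diff[OF cl(1,2) *(3,4)] by simp
  next
    fix p assume "p \<in> carrier M \<times> carrier N"
    then show "P (cl (frag_of p))" using pure[of "fst p" "snd p"] by (simp add: pure_def mem_Times_iff)
  qed
  then show ?thesis using t by simp
qed

lemma T_lift:
  fixes P :: "('p, 'q) ring_scheme"
  assumes P: "abelian_group P"
    and closed: "\<And>m n. \<lbrakk>m \<in> carrier M; n \<in> carrier N\<rbrakk> \<Longrightarrow> \<phi> m n \<in> carrier P"
    and add_left: "\<And>m m' n. \<lbrakk>m \<in> carrier M; m' \<in> carrier M; n \<in> carrier N\<rbrakk> \<Longrightarrow>
      \<phi> (m \<oplus>\<^bsub>M\<^esub> m') n = \<phi> m n \<oplus>\<^bsub>P\<^esub> \<phi> m' n"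
    and add_right: "\<And>m n n'. \<lbrakk>m \<in> carrier M; n \<in> carrier N; n' \<in> carrier N\<rbrakk> \<Longrightarrow>
      \<phi> m (n \<oplus>\<^bsub>N\<^esub> n') = \<phi> m n \<oplus>\<^bsub>P\<^esub> \<phi> m n'"
    and balanced: "\<And>r m n. \<lbrakk>r \<in> carrier R; m \<in> carrier M; n \<in> carrier N\<rbrakk> \<Longrightarrow>
      \<phi> (r \<odot>\<^bsub>M\<^esub> m) n = \<phi> m (r \<odot>\<^bsub>N\<^esub> n)"
  shows "\<exists>f. (\<forall>Y\<in>carrier (T act). f Y \<in> carrier P) \<and>
    (\<forall>Y\<in>carrier (T act). \<forall>Z\<in>carrier (T act). f (Y \<oplus>\<^bsub>T act\<^esub> Z) = f Y \<oplus>\<^bsub>P\<^esub> f Z) \<and>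
    (\<forall>m\<in>carrier M. \<forall>n\<in>carrier N. f (pure m n) = \<phi> m n)"
proof -
  interpret P: abelian_group P by fact
  obtain f where f: "f \<in> hom F (add_monoid P)"
    "\<And>m n. \<lbrakk>m \<in> carrier M; n \<in> carrier N\<rbrakk> \<Longrightarrow> f (frag_of (m, n)) = \<phi> m n"
    "\<And>t. t \<in> rel \<Longrightarrow> f t = \<zero>\<^bsub>P\<^esub>"
    by (rule balanced_lift[OF P closed add_left add_right balanced]) (assumption | blast)+
  have fcl: "f t \<in> carrier P" if "t \<in> carrier F" for t using hom_in_carrier[OF f(1) that] by simp
  have fadd: "f (t + u) = f t \<oplus>\<^bsub>P\<^esub> f u" if "t \<in> carrier F" "u \<in> carrier F" for t u
    using hom_mult[OF f(1) that] by simp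
  have wd: "f t = f u" if "t \<in> carrier F" "u \<in> carrier F" "cl t = cl u" for t u
  proof -
    have "t - u \<in> rel" using that(3) by (simp add: cl_eq)
    then have "f ((t - u) + u) = \<zero>\<^bsub>P\<^esub> \<oplus>\<^bsub>P\<^esub> f u"
      using fadd[OF rel_F that(2), of "t - u"] f(3)[of "t - u"] by simp
    then show ?thesis using fcl[OF that(2)] by simp
  qed
  define g where "g = (\<lambda>Y. f (SOME t. t \<in> carrier F \<and> Y = cl t))"
  have g: "g (cl t) = f t" if "t \<in> carrier F" for t
  proof -
    define u where "u = (SOME u. u \<in> carrier F \<and> cl t = cl u)"
    have u: "u \<in> carrier F \<and> cl t = cl u"
      unfolding u_def using that by (intro someI[of "\<lambda>u. u \<in> carrier F \<and> cl t = cl u" t]) simp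
    have "f t = f u" using wd[OF that, of u] u by (simp del: carrier_free_Abelian_group_iff)
    then show ?thesis unfolding g_def u_def by simp
  qed
  have rep: "\<exists>t\<in>carrier F. Y = cl t" if "Y \<in> carrier (T act)" for Y
    using that unfolding T_simps(1) by blast
  show ?thesis
  proof (intro exI[of _ g] conjI ballI)
    fix Y assume "Y \<in> carrier (T act)"
    then obtain t where "t \<in> carrier F" "Y = cl t" using rep by blast
    then show "g Y \<in> carrier P" using g[of t] fcl[of t] by (simp del: carrier_free_Abelian_group_iff)
  next
    fix Y Z assume "Y \<in> carrier (T act)" "Z \<in> carrier (T act)"
    then obtain t u where "t \<in> carrier F" "Y = cl t" "u \<in> carrier F" "Z = cl u" using rep by blast
    then show "g (Y \<oplus>\<^bsub>T act\<^esub> Z) = g Y \<oplus>\<^bsub>P\<^esub> g Z"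
      using g[of t] g[of u] g[of "t + u"] fadd[of t u] add_F[of t u] by (simp add: T_simps(3) del: carrier_free_Abelian_group_iff)
  next
    fix m n assume "m \<in> carrier M" "n \<in> carrier N"
    then show "g (pure m n) = \<phi> m n" using g[OF frag_of_F, of m n] f(2)[of m n] by (simp add: pure_def)
  qed
qed

text \<open>
  With \<open>\<alpha>\<close> the difference of two additive maps, this compares maps modulo relations by their values on
  generators.
\<close>

lemma additive_into_rel:
  assumes "t \<in> carrier F" and zero: "\<alpha> 0 = 0" and diff: "\<And>t u. \<alpha> (t - u) = \<alpha> t - (\<alpha> u :: 'm \<times> 'n \<Rightarrow>\<^sub>0 int)"
    and gen: "\<And>m n. \<lbrakk>m \<in> carrier M; n \<in> carrier N\<rbrakk> \<Longrightarrow> \<alpha> (frag_of (m, n)) \<in> rel"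
  shows "\<alpha> t \<in> rel"
  by (rule free_Abelian_group_induct[of t "carrier M \<times> carrier N" "\<lambda>t. \<alpha> t \<in> rel"])
    (use assms in \<open>auto simp: rel_closed\<close>)

text \<open>
  The action is well defined if the representatives respect the defining relations, and the module
  axioms hold if they hold modulo relations on pure tensors.
\<close>

lemma T_left_module:
  fixes A :: "('h, 'w) ring_scheme" and act :: "'h \<Rightarrow> 'm \<times> 'n \<Rightarrow> ('m \<times> 'n \<Rightarrow>\<^sub>0 int)"
  assumes A: "ring A"
    and closed: "\<And>h m n. \<lbrakk>h \<in> carrier A; m \<in> carrier M; n \<in> carrier N\<rbrakk> \<Longrightarrow> act h (m, n) \<in> carrier F"
    and rels: "\<And>h t. \<lbrakk>h \<in> carrier A; t \<in> tensor_relations R M N\<rbrakk> \<Longrightarrow> frag_extend (act h) t \<in> rel"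
    and add: "\<And>h h' m n. \<lbrakk>h \<in> carrier A; h' \<in> carrier A; m \<in> carrier M; n \<in> carrier N\<rbrakk> \<Longrightarrow>
      act (h \<oplus>\<^bsub>A\<^esub> h') (m, n) - (act h (m, n) + act h' (m, n)) \<in> rel"
    and mult: "\<And>h h' m n. \<lbrakk>h \<in> carrier A; h' \<in> carrier A; m \<in> carrier M; n \<in> carrier N\<rbrakk> \<Longrightarrow>
      act (h \<otimes>\<^bsub>A\<^esub> h') (m, n) - frag_extend (act h) (act h' (m, n)) \<in> rel"
    and one: "\<And>m n. \<lbrakk>m \<in> carrier M; n \<in> carrier N\<rbrakk> \<Longrightarrow> act \<one>\<^bsub>A\<^esub> (m, n) - frag_of (m, n) \<in> rel"
  shows "left_module A (T act)"
    and "\<And>h t. \<lbrakk>h \<in> carrier A; t \<in> carrier F\<rbrakk> \<Longrightarrow> h \<odot>\<^bsub>T act\<^esub> cl t = cl (frag_extend (act h) t)"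
proof -
  interpret A: ring A by fact
  have ext: "frag_extend (act h) t \<in> rel" if "h \<in> carrier A" "t \<in> rel" for h t
    using that(2) by (induction t rule: rel_induct) (auto simp: frag_extend_diff rel_closed rels that(1))
  have smult: "h \<odot>\<^bsub>T act\<^esub> cl t = cl (frag_extend (act h) t)" if "h \<in> carrier A" for h t
  proof -
    have "cl (frag_extend (act h) u) = cl (frag_extend (act h) t)" if "u \<in> cl t" for u
      using ext[of h "u - t"] that \<open>h \<in> carrier A\<close> by (simp add: cl_mem cl_eq frag_extend_diff)
    then have "(\<Union>u\<in>cl t. cl (frag_extend (act h) u)) = (\<Union>u\<in>cl t. cl (frag_extend (act h) t))"
      by (intro SUP_cong refl)
    also have "\<dots> = cl (frag_extend (act h) t)" using rel_closed(1) cl_mem[of t t] by auto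
    finally show ?thesis by (simp add: T_simps(4))
  qed
  show "h \<odot>\<^bsub>T act\<^esub> cl t = cl (frag_extend (act h) t)" if "h \<in> carrier A" "t \<in> carrier F" for h t
    using smult that by simp
  have extF: "frag_extend (act h) t \<in> carrier F" if "h \<in> carrier A" "t \<in> carrier F" for h t
  proof (rule free_Abelian_group_induct[of t "carrier M \<times> carrier N" "\<lambda>t. frag_extend (act h) t \<in> carrier F"])
    show "frag_extend (act h) (t - u) \<in> carrier F"
      if "frag_extend (act h) t \<in> carrier F" "frag_extend (act h) u \<in> carrier F" for t u
      unfolding frag_extend_diff using that by (rule diff_F)
    show "frag_extend (act h) (frag_of p) \<in> carrier F" if "p \<in> carrier M \<times> carrier N" for p
      using closed[OF \<open>h \<in> carrier A\<close>, of "fst p" "snd p"] that by (simp only: frag_extend_of mem_Times_iff prod.collapse)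
  qed (use that in simp_all)
  have rep: "\<exists>t\<in>carrier F. Y = cl t" if "Y \<in> carrier (T act)" for Y
    using that unfolding T_simps(1) by blast
  note [simp del] = carrier_free_Abelian_group_iff
  show "left_module A (T act)"
  proof (intro left_module.intro left_module_axioms.intro A T_abelian_group)
    fix h Y assume h: "h \<in> carrier A" and "Y \<in> carrier (T act)"
    then obtain t where t: "t \<in> carrier F" "Y = cl t" using rep by blast
    then show "h \<odot>\<^bsub>T act\<^esub> Y \<in> carrier (T act)" using h extF smult by (auto simp: T_simps(1))
    fix h' assume h': "h' \<in> carrier A"
    have "frag_extend (act (h \<oplus>\<^bsub>A\<^esub> h')) t - (frag_extend (act h) t + frag_extend (act h') t) \<in> rel"
      by (rule additive_into_rel[OF t(1)]) (auto simp: frag_extend_diff add h h')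
    then show "(h \<oplus>\<^bsub>A\<^esub> h') \<odot>\<^bsub>T act\<^esub> Y = h \<odot>\<^bsub>T act\<^esub> Y \<oplus>\<^bsub>T act\<^esub> h' \<odot>\<^bsub>T act\<^esub> Y"
      using t h h' by (simp add: smult T_simps(3) extF cl_eq)
    have "frag_extend (act (h \<otimes>\<^bsub>A\<^esub> h')) t - frag_extend (act h) (frag_extend (act h') t) \<in> rel"
      by (rule additive_into_rel[OF t(1)]) (auto simp: frag_extend_diff mult h h')
    then show "(h \<otimes>\<^bsub>A\<^esub> h') \<odot>\<^bsub>T act\<^esub> Y = h \<odot>\<^bsub>T act\<^esub> (h' \<odot>\<^bsub>T act\<^esub> Y)"
      using t h h' by (simp add: smult cl_eq)
    fix Z assume "Z \<in> carrier (T act)"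
    then obtain u where u: "u \<in> carrier F" "Z = cl u" using rep by blast
    then show "h \<odot>\<^bsub>T act\<^esub> (Y \<oplus>\<^bsub>T act\<^esub> Z) = h \<odot>\<^bsub>T act\<^esub> Y \<oplus>\<^bsub>T act\<^esub> h \<odot>\<^bsub>T act\<^esub> Z"
      using t h by (simp add: T_simps(3) smult extF frag_extend_add add_F)
  next
    fix Y assume "Y \<in> carrier (T act)"
    then obtain t where t: "t \<in> carrier F" "Y = cl t" using rep by blast
    have "frag_extend (act \<one>\<^bsub>A\<^esub>) t - t \<in> rel"
      by (rule additive_into_rel[OF t(1)]) (auto simp: frag_extend_diff one)
    then show "\<one>\<^bsub>A\<^esub> \<odot>\<^bsub>T act\<^esub> Y = Y" using t by (simp add: smult cl_eq)
  qed
qed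

end

subsection \<open>Quotient modules\<close>

lemma quotient_projection:
  fixes M :: "('r, 'm) module"
  assumes M: "left_module R M" and N: "submodule N R M"
  shows "left_module R (quotient_module M N)"
    and "module_map R M (quotient_module M N) (\<lambda>x. N +>\<^bsub>M\<^esub> x)"
    and "carrier (quotient_module M N) = (\<lambda>x. N +>\<^bsub>M\<^esub> x) ` carrier M"
    and "\<zero>\<^bsub>quotient_module M N\<^esub> = N +>\<^bsub>M\<^esub> \<zero>\<^bsub>M\<^esub>"
    and "\<And>x y. \<lbrakk>x \<in> carrier M; y \<in> carrier M\<rbrakk> \<Longrightarrow> N +>\<^bsub>M\<^esub> x = N +>\<^bsub>M\<^esub> y \<longleftrightarrow> x \<ominus>\<^bsub>M\<^esub> y \<in> N"
proof -
  interpret left_module R M by fact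
  let ?Q = "quotient_module M N" and ?p = "\<lambda>x. N +>\<^bsub>M\<^esub> x"
  note sub = submodule.axioms(1)[OF N]
  interpret N: abelian_subgroup N M
    by (rule abelian_subgroupI3[OF additive_subgroupI[OF sub] M.abelian_group_axioms])
  show car: "carrier ?Q = ?p ` carrier M"
    by (auto simp: quotient_module_def A_RCOSETS_def')
  show zero: "\<zero>\<^bsub>?Q\<^esub> = ?p \<zero>\<^bsub>M\<^esub>"
    using M.a_coset_add_zero[OF N.a_subset] by (simp add: quotient_module_def)
  show eq: "?p x = ?p y \<longleftrightarrow> x \<ominus>\<^bsub>M\<^esub> y \<in> N" if "x \<in> carrier M" "y \<in> carrier M" for x y
  proof
    assume "?p x = ?p y"
    then have "x \<in> ?p y" using N.a_rcos_self[OF that(1)] by simp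
    then show "x \<ominus>\<^bsub>M\<^esub> y \<in> N" using N.a_rcos_module[OF that(2,1)] by (simp add: a_minus_def)
  next
    assume "x \<ominus>\<^bsub>M\<^esub> y \<in> N"
    then have "x \<in> ?p y" using N.a_rcos_module[OF that(2,1)] by (simp add: a_minus_def)
    then show "?p x = ?p y" using N.a_repr_independence'[OF _ that(2)] by simp
  qed
  have add: "?p x \<oplus>\<^bsub>?Q\<^esub> ?p y = ?p (x \<oplus>\<^bsub>M\<^esub> y)" if "x \<in> carrier M" "y \<in> carrier M" for x y
    using N.a_rcos_sum[OF that] by (simp add: quotient_module_def)
  have smult: "r \<odot>\<^bsub>?Q\<^esub> ?p x = ?p (r \<odot>\<^bsub>M\<^esub> x)" if r: "r \<in> carrier R" and x: "x \<in> carrier M" for r x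
  proof -
    have "?p (r \<odot>\<^bsub>M\<^esub> y) = ?p (r \<odot>\<^bsub>M\<^esub> x)" if y: "y \<in> ?p x" for y
    proof -
      obtain n where n: "n \<in> N" "y = n \<oplus>\<^bsub>M\<^esub> x" using y by (auto simp: a_r_coset_def r_coset_def)
      then have nM: "n \<in> carrier M" using N.a_subset by blast
      then have "r \<odot>\<^bsub>M\<^esub> y \<ominus>\<^bsub>M\<^esub> r \<odot>\<^bsub>M\<^esub> x = r \<odot>\<^bsub>M\<^esub> n"
        using r x n smult_closed by (simp add: smult_r_distr a_minus_def M.a_assoc M.r_neg)
      also have "\<dots> \<in> N" using submodule_smult[OF N r n(1)] .
      finally show ?thesis using eq r x n(2) nM smult_closed by simp
    qed
    then have "(\<Union>y\<in>?p x. ?p (r \<odot>\<^bsub>M\<^esub> y)) = (\<Union>y\<in>?p x. ?p (r \<odot>\<^bsub>M\<^esub> x))"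
      by (intro SUP_cong refl)
    also have "\<dots> = ?p (r \<odot>\<^bsub>M\<^esub> x)" using N.a_rcos_self[OF x] by blast
    finally show ?thesis by (simp add: quotient_module_def)
  qed
  have "abelian_group ?Q"
  proof (rule abelian_groupI)
    fix Y assume "Y \<in> carrier ?Q"
    then obtain x where "x \<in> carrier M" "Y = ?p x" unfolding car by blast
    then show "\<exists>Z\<in>carrier ?Q. Z \<oplus>\<^bsub>?Q\<^esub> Y = \<zero>\<^bsub>?Q\<^esub>"
      unfolding car zero by (intro bexI[of _ "?p (\<ominus>\<^bsub>M\<^esub> x)"]) (simp_all add: add M.l_neg)
  qed (auto simp: car zero add M.a_ac)
  then show "left_module R ?Q"
    by (intro left_module.intro left_module_axioms.intro R.ring_axioms)
      (auto simp: car smult add smult_closed smult_l_distr smult_r_distr smult_assoc smult_one)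
  show "module_map R M ?Q ?p"
    by (rule module_mapI) (auto simp: car add smult)
qed

lemma quotient_lift:
  fixes M :: "('r, 'm) module"
  assumes M: "left_module R M" and N: "submodule N R M" and P: "left_module R P"
    and g: "module_map R M P g" and kill: "\<And>n. n \<in> N \<Longrightarrow> g n = \<zero>\<^bsub>P\<^esub>"
  shows "\<exists>f. module_map R (quotient_module M N) P f \<and> (\<forall>x\<in>carrier M. f (N +>\<^bsub>M\<^esub> x) = g x)"
proof -
  interpret M: left_module R M by fact
  interpret P: left_module R P by fact
  note q = quotient_projection[OF M N]
  let ?p = "\<lambda>x. N +>\<^bsub>M\<^esub> x"
  define f where "f = (\<lambda>Y. g (SOME x. x \<in> carrier M \<and> Y = ?p x))"
  have f: "f (?p x) = g x" if "x \<in> carrier M" for x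
  proof -
    define y where "y = (SOME y. y \<in> carrier M \<and> ?p x = ?p y)"
    have y: "y \<in> carrier M \<and> ?p x = ?p y"
      unfolding y_def using that by (intro someI[of "\<lambda>y. y \<in> carrier M \<and> ?p x = ?p y" x]) simp
    then have "x \<ominus>\<^bsub>M\<^esub> y \<in> N" using q(5)[OF that, of y] by simp
    then have "g (x \<oplus>\<^bsub>M\<^esub> \<ominus>\<^bsub>M\<^esub> y) = \<zero>\<^bsub>P\<^esub>" using kill by (simp add: a_minus_def)
    then have "g x \<oplus>\<^bsub>P\<^esub> \<ominus>\<^bsub>P\<^esub> g y = \<zero>\<^bsub>P\<^esub>"
      using y that by (simp add: module_mapD[OF g] module_map_minus[OF M P g])
    then have "g x = g y"
      using y that module_mapD(1)[OF g] P.M.minus_equality[of "g x" "\<ominus>\<^bsub>P\<^esub> g y"] by simp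
    then show ?thesis by (simp add: f_def y_def)
  qed
  have "module_map R (quotient_module M N) P f"
  proof (rule module_mapI)
    fix Y Z assume "Y \<in> carrier (quotient_module M N)" "Z \<in> carrier (quotient_module M N)"
    then obtain y z where yz: "y \<in> carrier M" "Y = ?p y" "z \<in> carrier M" "Z = ?p z" unfolding q(3) by blast
    show "f (Y \<oplus>\<^bsub>quotient_module M N\<^esub> Z) = f Y \<oplus>\<^bsub>P\<^esub> f Z"
      using yz module_mapD(2)[OF q(2), of y z] by (simp add: f module_mapD[OF g] flip: module_mapD(2)[OF q(2)])
  next
    fix r Y assume r: "r \<in> carrier R" and "Y \<in> carrier (quotient_module M N)"
    then obtain y where y: "y \<in> carrier M" "Y = ?p y" unfolding q(3) by blast
    then show "f (r \<odot>\<^bsub>quotient_module M N\<^esub> Y) = r \<odot>\<^bsub>P\<^esub> f Y"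
      using r M.smult_closed by (simp add: f module_mapD[OF g] flip: module_mapD(3)[OF q(2)])
  next
    fix Y assume "Y \<in> carrier (quotient_module M N)"
    then show "f Y \<in> carrier P" unfolding q(3) by (auto simp: f module_mapD[OF g])
  qed
  then show ?thesis using f by blast
qed

section \<open>The modules \<open>V(i, \<beta>)\<close>\<close>

locale induced_setting = hopf_ore_setting G \<chi> a + V: left_module "group_algebra G :: ('k::field, 'g) hopf" V
  for G :: "('g, 'z) monoid_scheme" (structure) and \<chi> :: "'g \<Rightarrow> 'k::field" and a :: 'g
    and V :: "('g \<Rightarrow>\<^sub>0 'k, 'v) module" +
  fixes s :: nat and \<beta> :: 'k
  assumes s_pos: "s > 0" and char_pow: "g \<in> carrier G \<Longrightarrow> \<chi> g ^ s = 1"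
begin

text \<open>
  \<open>H\<close> as a right \<open>kG\<close>-module, the left factor of \<open>H \<otimes>\<^bsub>kG\<^esub> V\<close>.
\<close>

definition Hr :: "('g \<Rightarrow>\<^sub>0 'k, 'g \<times> nat \<Rightarrow>\<^sub>0 'k) module" where
  "Hr = \<lparr>carrier = carrier H, monoid.mult = monoid.mult H, one = one H, ring.zero = \<zero>\<^bsub>H\<^esub>,
       add = add H, module.smult = (\<lambda>r h. h \<otimes>\<^bsub>H\<^esub> group_to_ore r)\<rparr>"

lemma Hr_simps [simp]:
  "carrier Hr = carrier H" "u \<oplus>\<^bsub>Hr\<^esub> v = u \<oplus>\<^bsub>H\<^esub> v" "r \<odot>\<^bsub>Hr\<^esub> h = h \<otimes>\<^bsub>H\<^esub> group_to_ore r"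
  by (simp_all add: Hr_def)

lemma Hr_abelian_group: "abelian_group Hr"
  by (rule abelian_group_cong[OF H.abelian_group_axioms]) (simp_all add: Hr_def)

sublocale ten: tensor_setup kG Hr V
  by (intro tensor_setup.intro tensor_setup_axioms.intro Hr_abelian_group V.M.abelian_group_axioms)
    (auto intro: V.smult_closed H.m_closed group_to_ore_closed)

definition act :: "('g \<times> nat \<Rightarrow>\<^sub>0 'k) \<Rightarrow> ('g \<times> nat \<Rightarrow>\<^sub>0 'k) \<times> 'v \<Rightarrow> (('g \<times> nat \<Rightarrow>\<^sub>0 'k) \<times> 'v \<Rightarrow>\<^sub>0 int)" where
  "act = (\<lambda>h (u, v). frag_of (h \<otimes>\<^bsub>H\<^esub> u, v))"

abbreviation "Ind \<equiv> induced_module G H V"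

lemma Ind_eq: "Ind = ten.T act"
  unfolding induced_module_def ten.T_def act_def unfolding Hr_def ..

lemma act_relations:
  assumes h: "h \<in> carrier H" and t: "t \<in> tensor_relations kG Hr V"
  shows "frag_extend (act h) t \<in> ten.rel"
proof -
  consider
    (1) m m' n where "t = frag_of (m \<oplus>\<^bsub>H\<^esub> m', n) - frag_of (m, n) - frag_of (m', n)"
      "m \<in> carrier H" "m' \<in> carrier H" "n \<in> carrier V"
    | (2) m n n' where "t = frag_of (m, n \<oplus>\<^bsub>V\<^esub> n') - frag_of (m, n) - frag_of (m, n')"
      "m \<in> carrier H" "n \<in> carrier V" "n' \<in> carrier V"
    | (3) r m n where "t = frag_of (m \<otimes>\<^bsub>H\<^esub> group_to_ore r, n) - frag_of (m, r \<odot>\<^bsub>V\<^esub> n)"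
      "r \<in> carrier kG" "m \<in> carrier H" "n \<in> carrier V"
    using t unfolding tensor_relations_def Hr_simps by blast
  then have "frag_extend (act h) t \<in> tensor_relations kG Hr V"
  proof cases
    case 1
    then show ?thesis
      using h ten.relations(1)[of "h \<otimes>\<^bsub>H\<^esub> m" "h \<otimes>\<^bsub>H\<^esub> m'" n] by (simp add: frag_extend_diff act_def H.r_distr)
  next
    case 2
    then show ?thesis
      using h ten.relations(2)[of "h \<otimes>\<^bsub>H\<^esub> m" n n'] by (simp add: frag_extend_diff act_def)
  next
    case 3
    then show ?thesis
      using h ten.relations(3)[of r "h \<otimes>\<^bsub>H\<^esub> m" n]
      by (simp add: frag_extend_diff act_def H.m_assoc group_to_ore_closed)
  qed
  then show ?thesis unfolding ten.rel_def by (rule generate.incl)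
qed

lemma Ind_left_module: "left_module H Ind"
  and Ind_action: "\<lbrakk>h \<in> carrier H; t \<in> carrier ten.F\<rbrakk> \<Longrightarrow> h \<odot>\<^bsub>Ind\<^esub> ten.cl t = ten.cl (frag_extend (act h) t)"
proof -
  have rel1: "t \<in> ten.rel" if "t \<in> tensor_relations kG Hr V" for t
    using that unfolding ten.rel_def by (rule generate.incl)
  have add: "act (h \<oplus>\<^bsub>H\<^esub> h') (m, n) - (act h (m, n) + act h' (m, n)) \<in> ten.rel"
    if "h \<in> carrier H" "h' \<in> carrier H" "m \<in> carrier Hr" "n \<in> carrier V" for h h' m n
    using ten.relations(1)[of "h \<otimes>\<^bsub>H\<^esub> m" "h' \<otimes>\<^bsub>H\<^esub> m" n] that
    by (intro rel1) (simp add: act_def H.l_distr diff_diff_eq)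
  show "left_module H Ind"
    unfolding Ind_eq
    by (rule ten.T_left_module[OF H.ring_axioms _ act_relations add])
      (auto simp: act_def H.m_assoc ten.rel_closed intro: H.m_closed)
  show "h \<odot>\<^bsub>Ind\<^esub> ten.cl t = ten.cl (frag_extend (act h) t)" if "h \<in> carrier H" "t \<in> carrier ten.F"
    unfolding Ind_eq
    by (rule ten.T_left_module(2)[OF H.ring_axioms _ act_relations add _ _ that])
      (auto simp: act_def H.m_assoc ten.rel_closed intro: H.m_closed)
qed

lemma Ind_pure: "\<lbrakk>h \<in> carrier H; u \<in> carrier H; v \<in> carrier V\<rbrakk> \<Longrightarrow> h \<odot>\<^bsub>Ind\<^esub> ten.pure u v = ten.pure (h \<otimes>\<^bsub>H\<^esub> u) v"
  unfolding ten.pure_def by (subst Ind_action) (simp_all add: act_def)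

sublocale Ind: left_module H Ind by (rule Ind_left_module)

lemma minus_zero_Ind [simp]: "\<ominus>\<^bsub>Ind\<^esub> \<zero>\<^bsub>Ind\<^esub> = \<zero>\<^bsub>Ind\<^esub>"
  by (rule Ind.M.minus_equality) simp_all

lemma pure_closed: "\<lbrakk>u \<in> carrier H; v \<in> carrier V\<rbrakk> \<Longrightarrow> ten.pure u v \<in> carrier Ind"
  unfolding Ind_eq by (rule ten.pure_simps(1)) simp_all

text \<open>\<open>V(i, \<beta>)\<close> is the quotient by the image of the action of this central element.\<close>

definition z :: "'g \<times> nat \<Rightarrow>\<^sub>0 'k" where "z = xpow s \<ominus>\<^bsub>H\<^esub> \<beta> \<odot>\<^bsub>H\<^esub> \<one>\<^bsub>H\<^esub>"

lemma z_closed: "z \<in> carrier H"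
  unfolding z_def by (intro H.minus_closed xpow_closed H.scal_closed)

lemma z_central: "h \<in> carrier H \<Longrightarrow> z \<otimes>\<^bsub>H\<^esub> h = h \<otimes>\<^bsub>H\<^esub> z"
  using xpow_central[OF char_pow, of h] H.scal_central[of h \<beta>] xpow_closed[of s] H.scal_closed[of \<beta>]
  by (simp add: z_def a_minus_def H.l_distr H.r_distr H.l_minus H.r_minus)

definition zInd where "zInd = {z \<odot>\<^bsub>Ind\<^esub> m | m. m \<in> carrier Ind}"

abbreviation Q where "Q \<equiv> induced_quotient G H s V \<beta>"

lemma Q_eq: "Q = quotient_module Ind zInd"
  by (simp add: induced_quotient_def Let_def zInd_def z_def xpow_pow)

lemma z_map: "module_map H Ind Ind (\<lambda>m. z \<odot>\<^bsub>Ind\<^esub> m)"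
  by (rule module_mapI)
    (auto simp: Ind.smult_closed z_closed Ind.smult_r_distr z_central simp flip: Ind.smult_assoc)

lemma zInd_submodule: "submodule zInd H Ind"
proof -
  have "zInd = (\<lambda>m. z \<odot>\<^bsub>Ind\<^esub> m) ` carrier Ind" by (auto simp: zInd_def)
  then show ?thesis using module_map_image[OF Ind_left_module Ind_left_module z_map Ind.carrier_submodule] by simp
qed

lemmas Q_projection = quotient_projection[OF Ind_left_module zInd_submodule, folded Q_eq]

sublocale Q: left_module H Q by (rule Q_projection(1))

text \<open>
  The canonical map \<open>v \<mapsto> 1 \<otimes> v\<close> from \<open>V\<close> to \<open>V(i, \<beta>)\<close>.
\<close>

definition emb :: "'v \<Rightarrow> (('g \<times> nat \<Rightarrow>\<^sub>0 'k) \<times> 'v \<Rightarrow>\<^sub>0 int) set set" where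
  "emb v = zInd +>\<^bsub>Ind\<^esub> ten.pure \<one>\<^bsub>H\<^esub> v"

lemma pure_add:
  assumes "u \<in> carrier H" "v \<in> carrier V"
  shows "w \<in> carrier V \<Longrightarrow> ten.pure u (v \<oplus>\<^bsub>V\<^esub> w) = ten.pure u v \<oplus>\<^bsub>Ind\<^esub> ten.pure u w"
    and "w' \<in> carrier H \<Longrightarrow> ten.pure (u \<oplus>\<^bsub>H\<^esub> w') v = ten.pure u v \<oplus>\<^bsub>Ind\<^esub> ten.pure w' v"
    and "r \<in> carrier kG \<Longrightarrow> ten.pure (u \<otimes>\<^bsub>H\<^esub> group_to_ore r) v = ten.pure u (r \<odot>\<^bsub>V\<^esub> v)"
  using ten.pure_simps(2-4)[of u v] assms by (simp_all add: Ind_eq)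

lemma emb_module_map: "module_map kG V (res Q) emb"
proof (rule module_mapI)
  fix v w assume v: "v \<in> carrier V" "w \<in> carrier V"
  then show "emb (v \<oplus>\<^bsub>V\<^esub> w) = emb v \<oplus>\<^bsub>res Q\<^esub> emb w"
    using module_mapD(2)[OF Q_projection(2)] by (simp add: emb_def pure_add(1) pure_closed)
next
  fix v assume v: "v \<in> carrier V"
  then show "emb v \<in> carrier (res Q)"
    using module_mapD(1)[OF Q_projection(2)] by (simp add: emb_def pure_closed)
  fix r :: "'g \<Rightarrow>\<^sub>0 'k" assume r: "r \<in> carrier kG"
  have "group_to_ore r \<odot>\<^bsub>Q\<^esub> emb v = zInd +>\<^bsub>Ind\<^esub> ten.pure (group_to_ore r \<otimes>\<^bsub>H\<^esub> \<one>\<^bsub>H\<^esub>) v"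
    using module_mapD(3)[OF Q_projection(2), of "ten.pure \<one>\<^bsub>H\<^esub> v" "group_to_ore r"] v r
    by (simp add: emb_def pure_closed group_to_ore_closed Ind_pure del: H.r_one)
  also have "group_to_ore r \<otimes>\<^bsub>H\<^esub> \<one>\<^bsub>H\<^esub> = \<one>\<^bsub>H\<^esub> \<otimes>\<^bsub>H\<^esub> group_to_ore r"
    using r by (simp add: group_to_ore_closed)
  also have "zInd +>\<^bsub>Ind\<^esub> ten.pure (\<one>\<^bsub>H\<^esub> \<otimes>\<^bsub>H\<^esub> group_to_ore r) v = emb (r \<odot>\<^bsub>V\<^esub> v)"
    using pure_add(3)[OF H.one_closed v r] by (simp add: emb_def del: H.l_one)
  finally show "emb (r \<odot>\<^bsub>V\<^esub> v) = r \<odot>\<^bsub>res Q\<^esub> emb v" by simp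
qed

text \<open>
  \<open>H \<otimes>\<^bsub>kG\<^esub> V\<close> is generated by the pure tensors \<open>u \<otimes> v = u (1 \<otimes> v)\<close>.
\<close>

lemma Q_generated:
  assumes U: "submodule U H Q" and emb: "\<And>v. v \<in> carrier V \<Longrightarrow> emb v \<in> U"
  shows "U = carrier Q"
proof -
  let ?p = "\<lambda>y. zInd +>\<^bsub>Ind\<^esub> y"
  have "submodule {y \<in> carrier Ind. ?p y \<in> U} H Ind"
    by (rule module_map_preimage[OF Ind_left_module Q_projection(1,2) U])
  note sub = submodule_zero[OF this] submodule_add[OF this] submodule_minus[OF this] submodule_smult[OF this]
  have "Y \<in> {y \<in> carrier Ind. ?p y \<in> U}" if "Y \<in> carrier Ind" for Y
    using that unfolding Ind_eq
  proof (rule ten.T_induct)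
    show "\<zero>\<^bsub>ten.T act\<^esub> \<in> {y \<in> carrier (ten.T act). zInd +>\<^bsub>ten.T act\<^esub> y \<in> U}"
      using sub(1) by (simp add: Ind_eq)
  next
    fix Y Z assume "Y \<in> {y \<in> carrier (ten.T act). zInd +>\<^bsub>ten.T act\<^esub> y \<in> U}"
      "Z \<in> {y \<in> carrier (ten.T act). zInd +>\<^bsub>ten.T act\<^esub> y \<in> U}"
    then show "Y \<ominus>\<^bsub>ten.T act\<^esub> Z \<in> {y \<in> carrier (ten.T act). zInd +>\<^bsub>ten.T act\<^esub> y \<in> U}"
      using sub(2)[OF _ sub(3)] unfolding a_minus_def Ind_eq by blast
  next
    fix u v assume "u \<in> carrier Hr" "v \<in> carrier V"
    then show "ten.pure u v \<in> {y \<in> carrier (ten.T act). zInd +>\<^bsub>ten.T act\<^esub> y \<in> U}"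
      using sub(4)[of u "ten.pure \<one>\<^bsub>H\<^esub> v"] emb[of v] Ind_pure[of u "\<one>\<^bsub>H\<^esub>" v] pure_closed[of "\<one>\<^bsub>H\<^esub>" v]
      by (simp add: emb_def Ind_eq)
  qed
  then show ?thesis using submodule_subset[OF U] Q_projection(3) by auto
qed

lemma xpow_scalar:
  assumes M: "left_module H M" and m: "m \<in> carrier M"
  shows "z \<odot>\<^bsub>M\<^esub> m = \<zero>\<^bsub>M\<^esub> \<longleftrightarrow> xpow s \<odot>\<^bsub>M\<^esub> m = (\<beta> \<odot>\<^bsub>H\<^esub> \<one>\<^bsub>H\<^esub>) \<odot>\<^bsub>M\<^esub> m"
proof -
  interpret M: left_module H M by fact
  let ?b = "\<beta> \<odot>\<^bsub>H\<^esub> \<one>\<^bsub>H\<^esub>"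
  have cl: "xpow s \<odot>\<^bsub>M\<^esub> m \<in> carrier M" "?b \<odot>\<^bsub>M\<^esub> m \<in> carrier M"
    using m by (simp_all add: M.smult_closed xpow_closed H.scal_closed)
  have "z \<odot>\<^bsub>M\<^esub> m = xpow s \<odot>\<^bsub>M\<^esub> m \<oplus>\<^bsub>M\<^esub> \<ominus>\<^bsub>M\<^esub> (?b \<odot>\<^bsub>M\<^esub> m)"
    using m unfolding z_def a_minus_def
    by (simp add: M.smult_l_distr xpow_closed H.scal_closed M.smult_minus_left)
  then show ?thesis
    using cl M.M.minus_equality[of "xpow s \<odot>\<^bsub>M\<^esub> m" "\<ominus>\<^bsub>M\<^esub> (?b \<odot>\<^bsub>M\<^esub> m)"] by (auto simp: M.M.r_neg)
qed

lemma Q_xpow: "y \<in> carrier Q \<Longrightarrow> xpow s \<odot>\<^bsub>Q\<^esub> y = (\<beta> \<odot>\<^bsub>H\<^esub> \<one>\<^bsub>H\<^esub>) \<odot>\<^bsub>Q\<^esub> y"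
proof -
  assume y: "y \<in> carrier Q"
  then obtain m where m: "m \<in> carrier Ind" "y = zInd +>\<^bsub>Ind\<^esub> m" unfolding Q_projection(3) by blast
  have "z \<odot>\<^bsub>Q\<^esub> y = zInd +>\<^bsub>Ind\<^esub> (z \<odot>\<^bsub>Ind\<^esub> m)"
    using module_mapD(3)[OF Q_projection(2) m(1) z_closed] m(2) by simp
  also have "\<dots> = \<zero>\<^bsub>Q\<^esub>"
    unfolding Q_projection(4)
    using m(1) z_closed by (subst Q_projection(5)) (auto simp: Ind.smult_closed a_minus_def zInd_def)
  finally show ?thesis using xpow_scalar[OF Q_projection(1) y] by simp
qed

text \<open>
  The right \<open>kG\<close>-linear map \<open>H \<rightarrow> kG\<close> with \<open>g x\<^sup>i \<mapsto> \<beta>\<^sup>i\<^sup>/\<^sup>s g\<close> if \<open>s\<close> divides \<open>i\<close>, and \<open>g x\<^sup>i \<mapsto> 0\<close> otherwise. It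
  shows that \<open>V\<close> survives in the quotient.
\<close>

definition retract :: "('g \<times> nat \<Rightarrow>\<^sub>0 'k) \<Rightarrow> ('g \<Rightarrow>\<^sub>0 'k)" where
  "retract = lin_extend (\<lambda>(g, i). if s dvd i then Poly_Mapping.single g (\<beta> ^ (i div s)) else 0)"

lemma retract_simps [simp]:
  "retract (u + v) = retract u + retract v" "retract 0 = 0"
  "retract (pm_scale c u) = pm_scale c (retract u)"
  "retract (Poly_Mapping.single (g, i) c) = (if s dvd i then Poly_Mapping.single g (c * \<beta> ^ (i div s)) else 0)"
  by (simp_all add: retract_def lin_extend_add lin_extend_scale)

lemma retract_closed: "u \<in> carrier H \<Longrightarrow> retract u \<in> carrier kG"
  unfolding retract_def by (simp add: group_algebra_simps hopf_ore_simps) (rule keys_lin_extend, fastforce split: if_splits)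

lemma retract_right_linear:
  assumes "u \<in> carrier H" "r \<in> carrier kG"
  shows "retract (u \<otimes>\<^bsub>H\<^esub> group_to_ore r) = retract u \<otimes>\<^bsub>kG\<^esub> r"
proof -
  have keys: "Poly_Mapping.keys u \<subseteq> carrier G \<times> UNIV" "Poly_Mapping.keys r \<subseteq> carrier G"
    using assms by (simp_all add: group_algebra_simps hopf_ore_simps)
  have single: "retract (Poly_Mapping.single p c \<otimes>\<^bsub>H\<^esub> group_to_ore r) = retract (Poly_Mapping.single p c) \<otimes>\<^bsub>kG\<^esub> r"
    if "p \<in> carrier G \<times> UNIV" for p c
    using keys(2)
  proof (induction r rule: poly_mapping_carrier_induct)
    case zero
    have "Poly_Mapping.single p c \<in> carrier H" using that by (simp add: hopf_ore_simps)
    then show ?case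
      using H.r_null[of "Poly_Mapping.single p c"] kG.r_null[of "retract (Poly_Mapping.single p c)"] retract_closed
      by (simp add: hopf_ore_simps group_algebra_simps)
  next
    case (single h d)
    obtain g i where p: "p = (g, i)" by (cases p)
    have "inverse (\<chi> h) ^ i = 1" if sdi: "s dvd i"
    proof -
      obtain l where "i = s * l" using sdi by (rule dvdE)
      then show ?thesis using char_pow[OF single] by (simp add: power_mult power_inverse)
    qed
    then show ?case
      using kG.l_null[of "Poly_Mapping.single h d"] kG.single_closed[OF single, of d]
      by (auto simp: p hopf_ore_simps group_algebra_simps mult_ac)
  next
    case (add u v)
    then have uv: "u \<in> carrier kG" "v \<in> carrier kG" by (simp_all add: group_algebra_simps)
    have p: "Poly_Mapping.single p c \<in> carrier H" using that by (simp add: hopf_ore_simps)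
    note cl = group_to_ore_closed[OF uv(1)] group_to_ore_closed[OF uv(2)] p uv retract_closed[OF p]
    show ?case
      using add H.r_distr[OF cl(1,2,3)] kG.r_distr[OF cl(4,5,6)] by (simp add: hopf_ore_simps(4) group_algebra_simps(4))
  qed
  from keys(1) show ?thesis
  proof (induction u rule: poly_mapping_carrier_induct)
    case zero
    show ?case using H.l_null[OF group_to_ore_closed[OF assms(2)]] kG.l_null[OF assms(2)]
      by (simp add: hopf_ore_simps group_algebra_simps)
  next
    case (single p c)
    then show ?case by (rule \<open>\<And>p c. p \<in> carrier G \<times> UNIV \<Longrightarrow> _ p c\<close>)
  next
    case (add u v)
    have cl: "u \<in> carrier H" "v \<in> carrier H" "retract u \<in> carrier kG" "retract v \<in> carrier kG"
      using add retract_closed[of u] retract_closed[of v] by (auto simp: hopf_ore_simps)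
    then show ?case
      using add H.l_distr[OF cl(1,2) group_to_ore_closed[OF assms(2)]] kG.l_distr[OF cl(3,4) assms(2)]
      by (simp add: hopf_ore_simps(4) group_algebra_simps(4))
  qed
qed

lemma retract_z: "u \<in> carrier H \<Longrightarrow> retract (z \<otimes>\<^bsub>H\<^esub> u) = 0"
proof -
  assume u: "u \<in> carrier H"
  have "retract (xpow s \<otimes>\<^bsub>H\<^esub> u) = pm_scale \<beta> (retract u)"
  proof -
    have "Poly_Mapping.keys u \<subseteq> carrier G \<times> UNIV" using u by (simp add: hopf_ore_simps)
    then show ?thesis
    proof (induction u rule: poly_mapping_carrier_induct)
      case zero
      show ?case using H.r_null[OF xpow_closed] by (simp add: hopf_ore_simps)
    next
      case (single p c)
      obtain g i where p: "p = (g, i)" by (cases p)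
      have "inverse (\<chi> g) ^ s = 1" using char_pow[of g] single by (simp add: p power_inverse)
      then show ?case using single s_pos
        by (simp add: p xpow_def hopf_ore_simps mult_ac)
    next
      case (add u v)
      then have "u \<in> carrier H" "v \<in> carrier H" by (simp_all add: hopf_ore_simps)
      then show ?case using add H.r_distr[of u v "xpow s"] xpow_closed
        by (simp add: hopf_ore_simps(4) pm_scale_add)
    qed
  qed
  moreover have "z \<otimes>\<^bsub>H\<^esub> u = xpow s \<otimes>\<^bsub>H\<^esub> u + pm_scale (- \<beta>) u"
  proof -
    have "z = xpow s \<oplus>\<^bsub>H\<^esub> pm_scale (- \<beta>) \<one>\<^bsub>H\<^esub>"
      unfolding z_def H.minus_eq[OF xpow_closed H.scal_closed]
      by (rule poly_mapping_eqI) (simp add: hopf_ore_simps lookup_minus lookup_add)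
    then show ?thesis
      using H.l_distr[OF xpow_closed H.pm_scale_closed[OF H.one_closed] u] u
      by (simp add: H.mult_scale_left H.add_eq)
  qed
  ultimately show ?thesis
    by (simp add: pm_scale_add(2)[symmetric])
qed

lemma retract_one: "retract \<one>\<^bsub>H\<^esub> = \<one>\<^bsub>kG\<^esub>"
  by (simp add: hopf_ore_simps group_algebra_simps ore_group_def)

text \<open>
  The additive map \<open>u \<otimes> v \<mapsto> retract(u) v\<close> kills the multiples of \<open>x\<^sup>s - \<beta>\<close> and sends \<open>1 \<otimes> v\<close> to \<open>v\<close>.
\<close>

lemma emb_inj: "v \<in> carrier V \<Longrightarrow> emb v = \<zero>\<^bsub>Q\<^esub> \<Longrightarrow> v = \<zero>\<^bsub>V\<^esub>"
proof -
  assume v: "v \<in> carrier V" and "emb v = \<zero>\<^bsub>Q\<^esub>"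
  then have "ten.pure \<one>\<^bsub>H\<^esub> v \<ominus>\<^bsub>Ind\<^esub> \<zero>\<^bsub>Ind\<^esub> \<in> zInd"
    unfolding emb_def Q_projection(4) using pure_closed[OF H.one_closed v] by (simp add: Q_projection(5))
  then have "ten.pure \<one>\<^bsub>H\<^esub> v \<in> zInd" using pure_closed[OF H.one_closed v] by (simp add: a_minus_def)
  then obtain m where m: "m \<in> carrier Ind" "ten.pure \<one>\<^bsub>H\<^esub> v = z \<odot>\<^bsub>Ind\<^esub> m" by (auto simp: zInd_def)
  have "\<exists>f. (\<forall>Y\<in>carrier Ind. f Y \<in> carrier V) \<and>
    (\<forall>Y\<in>carrier Ind. \<forall>Z\<in>carrier Ind. f (Y \<oplus>\<^bsub>Ind\<^esub> Z) = f Y \<oplus>\<^bsub>V\<^esub> f Z) \<and>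
    (\<forall>u\<in>carrier Hr. \<forall>v\<in>carrier V. f (ten.pure u v) = retract u \<odot>\<^bsub>V\<^esub> v)"
    unfolding Ind_eq
    by (rule ten.T_lift[OF V.M.abelian_group_axioms])
      (auto simp: V.smult_closed retract_closed V.smult_r_distr retract_right_linear V.smult_assoc
        V.smult_l_distr[unfolded group_algebra_simps(4)] H.add_eq)
  then obtain f where f: "\<And>Y. Y \<in> carrier Ind \<Longrightarrow> f Y \<in> carrier V"
    "\<And>Y Z. \<lbrakk>Y \<in> carrier Ind; Z \<in> carrier Ind\<rbrakk> \<Longrightarrow> f (Y \<oplus>\<^bsub>Ind\<^esub> Z) = f Y \<oplus>\<^bsub>V\<^esub> f Z"
    "\<And>u v. \<lbrakk>u \<in> carrier H; v \<in> carrier V\<rbrakk> \<Longrightarrow> f (ten.pure u v) = retract u \<odot>\<^bsub>V\<^esub> v"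
    unfolding Hr_simps by blast
  have f0: "f \<zero>\<^bsub>Ind\<^esub> = \<zero>\<^bsub>V\<^esub>"
    by (rule additive_map_zero[OF Ind.M.abelian_group_axioms V.M.abelian_group_axioms])
      (simp_all add: f del: Ind.M.l_zero Ind.M.r_zero)
  have zm: "z \<odot>\<^bsub>Ind\<^esub> Y \<in> carrier Ind" if "Y \<in> carrier Ind" for Y using that by (simp add: Ind.smult_closed z_closed)
  have "f (z \<odot>\<^bsub>Ind\<^esub> Y) = \<zero>\<^bsub>V\<^esub>" if "Y \<in> carrier Ind" for Y
    using that unfolding Ind_eq
  proof (rule ten.T_induct)
    show "f (z \<odot>\<^bsub>ten.T act\<^esub> \<zero>\<^bsub>ten.T act\<^esub>) = \<zero>\<^bsub>V\<^esub>"
      using Ind.smult_zero_right[OF z_closed] f0 by (simp add: Ind_eq)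
  next
    fix Y Z assume "Y \<in> carrier (ten.T act)" "Z \<in> carrier (ten.T act)"
    then have YZ: "Y \<in> carrier Ind" "Z \<in> carrier Ind" by (simp_all add: Ind_eq)
    assume "f (z \<odot>\<^bsub>ten.T act\<^esub> Y) = \<zero>\<^bsub>V\<^esub>" "f (z \<odot>\<^bsub>ten.T act\<^esub> Z) = \<zero>\<^bsub>V\<^esub>"
    then have fYZ: "f (z \<odot>\<^bsub>Ind\<^esub> Y) = \<zero>\<^bsub>V\<^esub>" "f (z \<odot>\<^bsub>Ind\<^esub> Z) = \<zero>\<^bsub>V\<^esub>" by (simp_all add: Ind_eq)
    have D: "Y \<ominus>\<^bsub>Ind\<^esub> Z \<in> carrier Ind" using YZ by simp
    have "(Y \<ominus>\<^bsub>Ind\<^esub> Z) \<oplus>\<^bsub>Ind\<^esub> Z = Y" using YZ by (simp add: a_minus_def Ind.M.a_assoc Ind.M.l_neg)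
    then have "f (z \<odot>\<^bsub>Ind\<^esub> (Y \<ominus>\<^bsub>Ind\<^esub> Z)) \<oplus>\<^bsub>V\<^esub> f (z \<odot>\<^bsub>Ind\<^esub> Z) = f (z \<odot>\<^bsub>Ind\<^esub> Y)"
      using f(2)[OF zm[OF D] zm[OF YZ(2)]] Ind.smult_r_distr[OF z_closed D YZ(2)] by simp
    then show "f (z \<odot>\<^bsub>ten.T act\<^esub> (Y \<ominus>\<^bsub>ten.T act\<^esub> Z)) = \<zero>\<^bsub>V\<^esub>"
      using fYZ f(1)[OF zm[OF D]] by (simp add: Ind_eq)
  next
    fix u v assume "u \<in> carrier Hr" "v \<in> carrier V"
    then show "f (z \<odot>\<^bsub>ten.T act\<^esub> ten.pure u v) = \<zero>\<^bsub>V\<^esub>"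
      using Ind_pure[OF z_closed, of u v] f(3)[of "z \<otimes>\<^bsub>H\<^esub> u" v] z_closed retract_z[of u] V.smult_zero_left[of v]
      by (simp add: Ind_eq group_algebra_simps)
  qed
  then have "f (ten.pure \<one>\<^bsub>H\<^esub> v) = \<zero>\<^bsub>V\<^esub>" using m by simp
  then show "v = \<zero>\<^bsub>V\<^esub>" using f(3)[OF H.one_closed v] V.smult_one[OF v] by (simp add: retract_one)
qed

text \<open>
  The balanced map \<open>u \<otimes> v \<mapsto> u f(v)\<close> kills the multiples of \<open>x\<^sup>s - \<beta>\<close> because \<open>x\<^sup>s - \<beta>\<close> acts as zero on
  the target.
\<close>

lemma Q_universal:
  fixes M :: "('g \<times> nat \<Rightarrow>\<^sub>0 'k, 'm) module"
  assumes M: "left_module H M" and xM: "\<And>m. m \<in> carrier M \<Longrightarrow> xpow s \<odot>\<^bsub>M\<^esub> m = (\<beta> \<odot>\<^bsub>H\<^esub> \<one>\<^bsub>H\<^esub>) \<odot>\<^bsub>M\<^esub> m"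
    and f: "module_map kG V (res M) f"
  shows "\<exists>F. module_map H Q M F \<and> (\<forall>v\<in>carrier V. F (emb v) = f v)"
proof -
  interpret M: left_module H M by fact
  have fV: "f v \<in> carrier M" if "v \<in> carrier V" for v using module_mapD(1)[OF f that] by simp
  have "\<exists>g. (\<forall>Y\<in>carrier Ind. g Y \<in> carrier M) \<and>
    (\<forall>Y\<in>carrier Ind. \<forall>Z\<in>carrier Ind. g (Y \<oplus>\<^bsub>Ind\<^esub> Z) = g Y \<oplus>\<^bsub>M\<^esub> g Z) \<and>
    (\<forall>u\<in>carrier Hr. \<forall>v\<in>carrier V. g (ten.pure u v) = u \<odot>\<^bsub>M\<^esub> f v)"
    unfolding Ind_eq
    by (rule ten.T_lift[OF M.M.abelian_group_axioms])
      (auto simp: M.smult_closed fV M.smult_l_distr M.smult_r_distr module_mapD[OF f] M.smult_assoc group_to_ore_closed)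
  then obtain g where g: "\<And>Y. Y \<in> carrier Ind \<Longrightarrow> g Y \<in> carrier M"
    "\<And>Y Z. \<lbrakk>Y \<in> carrier Ind; Z \<in> carrier Ind\<rbrakk> \<Longrightarrow> g (Y \<oplus>\<^bsub>Ind\<^esub> Z) = g Y \<oplus>\<^bsub>M\<^esub> g Z"
    "\<And>u v. \<lbrakk>u \<in> carrier H; v \<in> carrier V\<rbrakk> \<Longrightarrow> g (ten.pure u v) = u \<odot>\<^bsub>M\<^esub> f v"
    unfolding Hr_simps by blast
  have g0: "g \<zero>\<^bsub>Ind\<^esub> = \<zero>\<^bsub>M\<^esub>"
    by (rule additive_map_zero[OF Ind.M.abelian_group_axioms M.M.abelian_group_axioms])
      (simp_all add: g del: Ind.M.l_zero Ind.M.r_zero)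
  have gdiff: "g (Y \<ominus>\<^bsub>Ind\<^esub> Z) = g Y \<ominus>\<^bsub>M\<^esub> g Z" if "Y \<in> carrier Ind" "Z \<in> carrier Ind" for Y Z
  proof -
    have D: "Y \<ominus>\<^bsub>Ind\<^esub> Z \<in> carrier Ind" using that by simp
    have "(Y \<ominus>\<^bsub>Ind\<^esub> Z) \<oplus>\<^bsub>Ind\<^esub> Z = Y" using that by (simp add: a_minus_def Ind.M.a_assoc Ind.M.l_neg)
    then have "g Y = g (Y \<ominus>\<^bsub>Ind\<^esub> Z) \<oplus>\<^bsub>M\<^esub> g Z" using g(2)[OF D that(2)] by simp
    then show ?thesis using g(1)[OF D] g(1)[OF that(2)] by (simp add: a_minus_def M.M.a_assoc M.M.r_neg)
  qed
  have smult: "g (h \<odot>\<^bsub>Ind\<^esub> Y) = h \<odot>\<^bsub>M\<^esub> g Y" if h: "h \<in> carrier H" and Y: "Y \<in> carrier Ind" for h Y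
    using Y unfolding Ind_eq
  proof (rule ten.T_induct)
    show "g (h \<odot>\<^bsub>ten.T act\<^esub> \<zero>\<^bsub>ten.T act\<^esub>) = h \<odot>\<^bsub>M\<^esub> g \<zero>\<^bsub>ten.T act\<^esub>"
      using Ind.smult_zero_right[OF h] M.smult_zero_right[OF h] g0 by (simp add: Ind_eq)
  next
    fix Y Z assume "Y \<in> carrier (ten.T act)" "Z \<in> carrier (ten.T act)"
    then have YZ: "Y \<in> carrier Ind" "Z \<in> carrier Ind" by (simp_all add: Ind_eq)
    assume "g (h \<odot>\<^bsub>ten.T act\<^esub> Y) = h \<odot>\<^bsub>M\<^esub> g Y" "g (h \<odot>\<^bsub>ten.T act\<^esub> Z) = h \<odot>\<^bsub>M\<^esub> g Z"
    then have gYZ: "g (h \<odot>\<^bsub>Ind\<^esub> Y) = h \<odot>\<^bsub>M\<^esub> g Y" "g (h \<odot>\<^bsub>Ind\<^esub> Z) = h \<odot>\<^bsub>M\<^esub> g Z" by (simp_all add: Ind_eq)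
    have "h \<odot>\<^bsub>Ind\<^esub> (Y \<ominus>\<^bsub>Ind\<^esub> Z) = h \<odot>\<^bsub>Ind\<^esub> Y \<ominus>\<^bsub>Ind\<^esub> h \<odot>\<^bsub>Ind\<^esub> Z"
      using h YZ by (simp add: a_minus_def Ind.smult_r_distr Ind.smult_minus_right)
    then have "g (h \<odot>\<^bsub>Ind\<^esub> (Y \<ominus>\<^bsub>Ind\<^esub> Z)) = h \<odot>\<^bsub>M\<^esub> g Y \<ominus>\<^bsub>M\<^esub> h \<odot>\<^bsub>M\<^esub> g Z"
      using gdiff[of "h \<odot>\<^bsub>Ind\<^esub> Y" "h \<odot>\<^bsub>Ind\<^esub> Z"] gYZ h YZ by (simp add: Ind.smult_closed)
    also have "\<dots> = h \<odot>\<^bsub>M\<^esub> g (Y \<ominus>\<^bsub>Ind\<^esub> Z)"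
      using gdiff[OF YZ] h g(1)[OF YZ(1)] g(1)[OF YZ(2)] by (simp add: a_minus_def M.smult_r_distr M.smult_minus_right)
    finally show "g (h \<odot>\<^bsub>ten.T act\<^esub> (Y \<ominus>\<^bsub>ten.T act\<^esub> Z)) = h \<odot>\<^bsub>M\<^esub> g (Y \<ominus>\<^bsub>ten.T act\<^esub> Z)"
      by (simp add: Ind_eq)
  next
    fix u v assume "u \<in> carrier Hr" "v \<in> carrier V"
    then show "g (h \<odot>\<^bsub>ten.T act\<^esub> ten.pure u v) = h \<odot>\<^bsub>M\<^esub> g (ten.pure u v)"
      using Ind_pure[OF h, of u v] g(3)[of "h \<otimes>\<^bsub>H\<^esub> u" v] g(3)[of u v] h fV[of v] by (simp add: Ind_eq M.smult_assoc)
  qed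
  have gmap: "module_map H Ind M g" by (rule module_mapI) (simp_all add: g smult)
  have "g n = \<zero>\<^bsub>M\<^esub>" if "n \<in> zInd" for n
    using that smult[OF z_closed] g(1) xpow_scalar[OF M] xM by (auto simp: zInd_def)
  from quotient_lift[OF Ind_left_module zInd_submodule M gmap this] obtain F where
    F: "module_map H Q M F" "\<And>y. y \<in> carrier Ind \<Longrightarrow> F (zInd +>\<^bsub>Ind\<^esub> y) = g y"
    unfolding Q_eq by blast
  then show ?thesis
    using g(3)[OF H.one_closed] fV M.smult_one by (intro exI[of _ F]) (auto simp: emb_def pure_closed)
qed

text \<open>
  The element \<open>x\<^sup>i \<otimes> v\<close> of the quotient.
\<close>

definition xe :: "nat \<Rightarrow> 'v \<Rightarrow> (('g \<times> nat \<Rightarrow>\<^sub>0 'k) \<times> 'v \<Rightarrow>\<^sub>0 int) set set" where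
  "xe i v = xpow i \<odot>\<^bsub>Q\<^esub> emb v"

lemma xe_module_map: "module_map kG (restrict_scalars (tw i) V) (res Q) (xe i)"
  using xpow_module_map[OF Q_projection(1) emb_module_map, of i] by (simp add: xe_def[abs_def])

lemma xe_simps:
  assumes "v \<in> carrier V"
  shows "xe i v \<in> carrier Q" "w \<in> carrier V \<Longrightarrow> xe i (v \<oplus>\<^bsub>V\<^esub> w) = xe i v \<oplus>\<^bsub>Q\<^esub> xe i w"
    "u \<in> carrier kG \<Longrightarrow> group_to_ore u \<odot>\<^bsub>Q\<^esub> xe i v = xe i (tw i u \<odot>\<^bsub>V\<^esub> v)"
  using module_mapD[OF xe_module_map, of v i] assms by simp_all

lemma xe_zero: "xe i \<zero>\<^bsub>V\<^esub> = \<zero>\<^bsub>Q\<^esub>"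
  by (rule additive_map_zero[OF V.M.abelian_group_axioms Q.M.abelian_group_axioms])
    (simp_all add: xe_simps del: V.M.l_zero V.M.r_zero)

lemma xe_scale:
  assumes v: "v \<in> carrier V"
  shows "xe i ((c \<odot>\<^bsub>kG\<^esub> \<one>\<^bsub>kG\<^esub>) \<odot>\<^bsub>V\<^esub> v) = (c \<odot>\<^bsub>H\<^esub> \<one>\<^bsub>H\<^esub>) \<odot>\<^bsub>Q\<^esub> xe i v"
proof -
  have "tw i (c \<odot>\<^bsub>kG\<^esub> \<one>\<^bsub>kG\<^esub>) = c \<odot>\<^bsub>kG\<^esub> \<one>\<^bsub>kG\<^esub>" "group_to_ore (c \<odot>\<^bsub>kG\<^esub> \<one>\<^bsub>kG\<^esub>) = c \<odot>\<^bsub>H\<^esub> \<one>\<^bsub>H\<^esub>"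
    using tw_algebra_map group_to_ore_algebra_map by (simp_all add: algebra_map_def)
  then show ?thesis using xe_simps(3)[OF v kG.scal_closed[of c], of i] by simp
qed

lemma xpow_xe: "v \<in> carrier V \<Longrightarrow> xpow i \<odot>\<^bsub>Q\<^esub> xe l v = xe (i + l) v"
  using module_mapD(1)[OF emb_module_map]
  by (simp add: xe_def Q.smult_assoc[symmetric] xpow_closed xpow_mult)

lemma emb_xe: "v \<in> carrier V \<Longrightarrow> emb v = xe 0 v"
  using module_mapD(1)[OF emb_module_map] by (simp add: xe_def xpow_0 Q.smult_one)

lemma xe_wrap: "v \<in> carrier V \<Longrightarrow> xe s v = xe 0 ((\<beta> \<odot>\<^bsub>kG\<^esub> \<one>\<^bsub>kG\<^esub>) \<odot>\<^bsub>V\<^esub> v)"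
  using Q_xpow[of "emb v"] module_mapD(1)[OF emb_module_map, of v] xe_scale[of v 0 \<beta>]
  by (simp add: emb_xe[symmetric]) (simp add: xe_def)

text \<open>Adding one \<open>x\<^sup>n V\<close> at a time, the closure properties follow by induction, without reindexing sums.\<close>

primrec layers :: "nat \<Rightarrow> (('g \<times> nat \<Rightarrow>\<^sub>0 'k) \<times> 'v \<Rightarrow>\<^sub>0 int) set set set" where
  "layers 0 = {\<zero>\<^bsub>Q\<^esub>}"
| "layers (Suc n) = {y \<oplus>\<^bsub>Q\<^esub> xe n v | y v. y \<in> layers n \<and> v \<in> carrier V}"

lemma layers_sub: "y \<in> layers n \<Longrightarrow> y \<in> carrier Q"
  by (induction n arbitrary: y) (auto simp: xe_simps)

lemma layers_mono: "y \<in> layers n \<Longrightarrow> y \<in> layers (Suc n)"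
  using layers_sub[of y n] V.M.zero_closed xe_zero[of n] by (auto intro!: exI[of _ y] exI[of _ "\<zero>\<^bsub>V\<^esub>"])

lemma layers_zero: "\<zero>\<^bsub>Q\<^esub> \<in> layers n"
proof (induction n)
  case (Suc n)
  then show ?case by (rule layers_mono)
qed simp

lemma layers_add: "\<lbrakk>y \<in> layers n; y' \<in> layers n\<rbrakk> \<Longrightarrow> y \<oplus>\<^bsub>Q\<^esub> y' \<in> layers n"
proof (induction n arbitrary: y y')
  case (Suc n)
  then obtain z v z' v' where *: "y = z \<oplus>\<^bsub>Q\<^esub> xe n v" "z \<in> layers n" "v \<in> carrier V"
    "y' = z' \<oplus>\<^bsub>Q\<^esub> xe n v'" "z' \<in> layers n" "v' \<in> carrier V" by auto
  then have "y \<oplus>\<^bsub>Q\<^esub> y' = (z \<oplus>\<^bsub>Q\<^esub> z') \<oplus>\<^bsub>Q\<^esub> xe n (v \<oplus>\<^bsub>V\<^esub> v')"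
    using layers_sub[of z n] layers_sub[of z' n] by (simp add: xe_simps Q.M.a_ac)
  then show ?case using Suc.IH[OF *(2,5)] *(3,6) by auto
qed simp

lemma layers_group: "\<lbrakk>u \<in> carrier kG; y \<in> layers n\<rbrakk> \<Longrightarrow> group_to_ore u \<odot>\<^bsub>Q\<^esub> y \<in> layers n"
proof (induction n arbitrary: y)
  case 0
  then show ?case by (simp add: Q.smult_zero_right group_to_ore_closed)
next
  case (Suc n)
  then obtain z v where *: "y = z \<oplus>\<^bsub>Q\<^esub> xe n v" "z \<in> layers n" "v \<in> carrier V" by auto
  then have "group_to_ore u \<odot>\<^bsub>Q\<^esub> y = group_to_ore u \<odot>\<^bsub>Q\<^esub> z \<oplus>\<^bsub>Q\<^esub> xe n (tw n u \<odot>\<^bsub>V\<^esub> v)"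
    using layers_sub[of z n] Suc.prems(1) by (simp add: Q.smult_r_distr group_to_ore_closed xe_simps)
  then show ?case using Suc.IH[OF Suc.prems(1) *(2)] V.smult_closed[OF tw_closed[OF Suc.prems(1)] *(3)] by auto
qed

lemma layers_x: "y \<in> layers n \<Longrightarrow> xpow 1 \<odot>\<^bsub>Q\<^esub> y \<in> layers (Suc n)"
proof (induction n arbitrary: y)
  case 0
  then show ?case using layers_zero[of 1] by (simp add: Q.smult_zero_right xpow_closed)
next
  case (Suc n)
  then obtain z v where *: "y = z \<oplus>\<^bsub>Q\<^esub> xe n v" "z \<in> layers n" "v \<in> carrier V" by auto
  then have "xpow 1 \<odot>\<^bsub>Q\<^esub> y = xpow 1 \<odot>\<^bsub>Q\<^esub> z \<oplus>\<^bsub>Q\<^esub> xe (Suc n) v"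
    using layers_sub[of z n] xpow_xe[of v 1 n] by (simp add: Q.smult_r_distr xpow_closed xe_simps)
  then show ?case using Suc.IH[OF *(2)] *(3) unfolding layers.simps(2)[of "Suc n"] by blast
qed

lemma xe_layers: "\<lbrakk>i < n; v \<in> carrier V\<rbrakk> \<Longrightarrow> xe i v \<in> layers n"
proof (induction n)
  case (Suc n)
  show ?case
  proof (cases "i = n")
    case True
    then show ?thesis
      using Suc.prems layers_zero[of n] xe_simps(1)[of v n] by (auto intro!: exI[of _ "\<zero>\<^bsub>Q\<^esub>"] exI[of _ v])
  next
    case False
    then show ?thesis using Suc by (intro layers_mono) simp
  qed
qed simp

text \<open>
  \<open>x\<^sup>s v = \<beta> v\<close> already lies in \<open>x\<^sup>0 V\<close>.
\<close>

lemma layers_wrap: "y \<in> layers (Suc s) \<Longrightarrow> y \<in> layers s"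
  using xe_layers[OF s_pos] V.smult_closed[OF kG.scal_closed] by (auto simp: xe_wrap intro!: layers_add)

text \<open>
  The sums of elements of \<open>x\<^sup>i V\<close> with \<open>i < s\<close> are closed under \<open>kG\<close> and, by the wrap-around, under \<open>x\<close>.
\<close>

lemma carrier_Q_layers: "carrier Q = layers s"
proof (rule Q_generated[symmetric])
  show "submodule (layers s) H Q"
  proof (rule hopf_ore_submodule[OF Q_projection(1)])
    interpret R: left_module kG "res Q" by (rule res_left_module[OF Q_projection(1)])
    show "submodule (layers s) kG (res Q)"
      by (rule R.submoduleI) (auto simp: layers_zero layers_add layers_group dest: layers_sub)
    show "xpow 1 \<odot>\<^bsub>Q\<^esub> y \<in> layers s" if "y \<in> layers s" for y
      by (rule layers_wrap[OF layers_x[OF that]])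
  qed
  show "emb v \<in> layers s" if "v \<in> carrier V" for v
    using that s_pos by (simp add: emb_xe xe_layers)
qed

lemma layers_finsum:
  "y \<in> layers n \<Longrightarrow> \<exists>v. (\<forall>i. v i \<in> carrier V) \<and> y = (\<Oplus>\<^bsub>Q\<^esub>i\<in>{..<n}. xe i (v i))"
proof (induction n arbitrary: y)
  case 0
  then show ?case using V.M.zero_closed by (intro exI[of _ "\<lambda>_. \<zero>\<^bsub>V\<^esub>"]) simp
next
  case (Suc n)
  then obtain z w where *: "y = z \<oplus>\<^bsub>Q\<^esub> xe n w" "z \<in> layers n" "w \<in> carrier V" by auto
  then obtain v where v: "\<forall>i. v i \<in> carrier V" "z = (\<Oplus>\<^bsub>Q\<^esub>i\<in>{..<n}. xe i (v i))" using Suc.IH by blast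
  have "(\<Oplus>\<^bsub>Q\<^esub>i\<in>{..<Suc n}. xe i ((v(n := w)) i)) = xe n w \<oplus>\<^bsub>Q\<^esub> (\<Oplus>\<^bsub>Q\<^esub>i\<in>{..<n}. xe i ((v(n := w)) i))"
    unfolding lessThan_Suc using v(1) *(3) by (subst Q.M.finsum_insert) (auto simp: xe_simps)
  also have "(\<Oplus>\<^bsub>Q\<^esub>i\<in>{..<n}. xe i ((v(n := w)) i)) = z"
    unfolding v(2) using v(1) by (intro Q.M.finsum_cong') (auto simp: xe_simps)
  finally have "y = (\<Oplus>\<^bsub>Q\<^esub>i\<in>{..<Suc n}. xe i ((v(n := w)) i))"
    using *(1,3) layers_sub[OF *(2)] by (simp add: Q.M.a_comm xe_simps)
  then show ?case using v(1) *(3) by (intro exI[of _ "v(n := w)"]) simp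
qed

lemma Q_finite_dim:
  assumes fd: "finite_dim kG V"
  shows "finite_dim H Q"
proof -
  interpret W: vspace "scalar_module kG V" by (rule kG.vspace_scalar_module[OF V.left_module_axioms])
  obtain S where S: "spanned_by (scalar_module kG V) S" using fd by (auto simp: finite_dim_iff_spanned)
  then have SV: "v \<in> carrier V" if "v \<in> S" for v using that by (auto simp: spanned_by_def)
  have "spanned_by (scalar_module H Q) ((\<lambda>(i, v). xe i v) ` ({..<s} \<times> S))"
    unfolding spanned_by_def
  proof (intro conjI allI impI)
    fix U assume U: "submodule U (ring_of_type_algebra :: 'k ring) (scalar_module H Q) \<and>
      (\<lambda>(i, v). xe i v) ` ({..<s} \<times> S) \<subseteq> U"
    note sub = submodule_zero[OF conjunct1[OF U]] submodule_add[OF conjunct1[OF U]]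
      submodule_smult[OF conjunct1[OF U]]
    have xeU: "xe i v \<in> U" if i: "i < s" and v: "v \<in> carrier V" for i v
    proof -
      have "submodule {v \<in> carrier V. xe i v \<in> U} ring_of_type_algebra (scalar_module kG V)"
      proof (rule W.subspaceI)
        fix c v assume "v \<in> {v \<in> carrier V. xe i v \<in> U}"
        then show "c \<odot>\<^bsub>scalar_module kG V\<^esub> v \<in> {v \<in> carrier V. xe i v \<in> U}"
          using sub(3)[of c "xe i v"] by (simp add: V.smult_closed kG.scal_closed xe_scale)
      next
        fix v w assume "v \<in> {v \<in> carrier V. xe i v \<in> U}" "w \<in> {v \<in> carrier V. xe i v \<in> U}"
        then show "v \<oplus>\<^bsub>scalar_module kG V\<^esub> w \<in> {v \<in> carrier V. xe i v \<in> U}"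
          using sub(2)[of "xe i v" "xe i w"] by (simp add: xe_simps)
      qed (use sub(1) xe_zero in auto)
      moreover have "S \<subseteq> {v \<in> carrier V. xe i v \<in> U}" using U i SV by auto
      ultimately have "{v \<in> carrier V. xe i v \<in> U} = carrier (scalar_module kG V)"
        using S unfolding spanned_by_def by blast
      then have "v \<in> {v \<in> carrier V. xe i v \<in> U}" using v by simp
      then show ?thesis by simp
    qed
    have "y \<in> U" if "y \<in> layers n" "n \<le> s" for y n
      using that
    proof (induction n arbitrary: y)
      case (Suc n)
      then obtain z v where "y = z \<oplus>\<^bsub>Q\<^esub> xe n v" "z \<in> layers n" "v \<in> carrier V" by auto
      then show ?case using Suc sub(2)[of z "xe n v"] xeU[of n v] by simp
    qed (use sub(1) in simp)
    then show "U = carrier (scalar_module H Q)"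
      using submodule_subset[OF conjunct1[OF U]] carrier_Q_layers by auto
  qed (use S SV xe_simps(1) in \<open>auto simp: spanned_by_def\<close>)
  then show ?thesis by (auto simp: finite_dim_iff_spanned)
qed

end

section \<open>Tensoring with \<open>V\<^sub>\<chi>\<close> and the permutation \<open>\<sigma>\<close>\<close>

context hopf_ore_setting
begin

lemma char_module_smult: "Poly_Mapping.single g c \<odot>\<^bsub>char_module \<chi>\<^esub> z = c * \<chi> g * z"
  by (simp add: char_module_def)

lemma comult_group_algebra:
  "Poly_Mapping.lookup (comult kG h) (b, c) = (if b = c then Poly_Mapping.lookup h b else 0)"
  "Poly_Mapping.keys (comult kG h) = (\<lambda>g. (g, g)) ` Poly_Mapping.keys h"
proof -
  have eq: "comult kG h = lin_extend (\<lambda>g. Poly_Mapping.single (g, g) 1) h"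
    by (simp add: group_algebra_def module.defs hopf_algebra.defs)
  show lookup: "Poly_Mapping.lookup (comult kG h) (b, c) = (if b = c then Poly_Mapping.lookup h b else 0)" for b c
    unfolding eq lin_extend_def
    by (cases "b = c") (auto simp: lookup_sum lookup_single when_def in_keys_iff sum.delta intro!: sum.neutral)
  show "Poly_Mapping.keys (comult kG h) = (\<lambda>g. (g, g)) ` Poly_Mapping.keys h"
    by (auto simp: in_keys_iff lookup image_iff split: if_splits)
qed

text \<open>
  Every element of \<open>V\<^sub>\<chi> \<otimes> V\<close> has the form \<open>1 \<otimes> v\<close>, so the map \<open>f(z \<otimes> w) = z w\<close> is bijective. Its injectivity
  also shows that the action on the tensor product is well defined: representatives of the same
  element are sent by \<open>h\<close> to elements with the same image under \<open>f\<close>.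
\<close>

lemma hopf_tensor_iso:
  fixes V :: "('g \<Rightarrow>\<^sub>0 'k, 'v) module"
  assumes V: "left_module kG V"
  defines "E \<equiv> hopf_tensor kG (char_module \<chi>) V"
  shows "module_isomorphic kG E (restrict_scalars (tw 1) V)"
    and "\<lbrakk>Y \<in> carrier E; Z \<in> carrier E\<rbrakk> \<Longrightarrow> Y \<oplus>\<^bsub>E\<^esub> Z \<in> carrier E"
    and "\<lbrakk>h \<in> carrier kG; Y \<in> carrier E\<rbrakk> \<Longrightarrow> h \<odot>\<^bsub>E\<^esub> Y \<in> carrier E"
proof -
  interpret V: left_module kG V by fact
  interpret W: vspace "scalar_module kG V" by (rule kG.vspace_scalar_module[OF V])
  define C where "C = scalar_module kG (char_module \<chi> :: ('g \<Rightarrow>\<^sub>0 'k, 'k) module)"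
  define W where "W = scalar_module kG V"
  have C: "carrier C = UNIV" "x \<oplus>\<^bsub>C\<^esub> y = x + y" "\<zero>\<^bsub>C\<^esub> = 0" "c \<odot>\<^bsub>C\<^esub> z = c * z" for x y z c
    by (simp_all add: C_def group_algebra_simps char_module_smult character_one[OF G.is_group character])
      (simp_all add: char_module_def)
  have "abelian_group C"
    by (rule abelian_groupI) (auto simp: C intro: exI[of _ "- _"])
  then interpret ten: tensor_setup "ring_of_type_algebra :: 'k ring" C W
    by (intro tensor_setup.intro tensor_setup_axioms.intro)
      (auto simp: C W_def W.M.abelian_group_axioms V.smult_closed kG.scal_closed)
  define act where "act = (\<lambda>h (v, w). \<Sum>(b, c)\<in>Poly_Mapping.keys (comult kG h).
         frag_of (Poly_Mapping.single b (Poly_Mapping.lookup (comult kG h) (b, c)) \<odot>\<^bsub>char_module \<chi>\<^esub> v,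
                  Poly_Mapping.single c 1 \<odot>\<^bsub>V\<^esub> w))"
  have E: "E = ten.T act"
    unfolding E_def hopf_tensor_def ten.T_def act_def unfolding C_def W_def ..
  interpret E: abelian_group E unfolding E by (rule ten.T_abelian_group)
  have Wc: "carrier W = carrier V" and Wadd: "x \<oplus>\<^bsub>W\<^esub> y = x \<oplus>\<^bsub>V\<^esub> y" for x y by (simp_all add: W_def)
  have Ws: "z \<odot>\<^bsub>W\<^esub> w = Poly_Mapping.single \<one> z \<odot>\<^bsub>V\<^esub> w" for z w
    by (simp add: W_def group_algebra_simps)
  have sing: "Poly_Mapping.single g c \<in> carrier kG" if "g \<in> carrier G" for g c
    using that by (simp add: group_algebra_simps)
  obtain f where f: "\<And>Y. Y \<in> carrier E \<Longrightarrow> f Y \<in> carrier V"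
    "\<And>Y Z. \<lbrakk>Y \<in> carrier E; Z \<in> carrier E\<rbrakk> \<Longrightarrow> f (Y \<oplus>\<^bsub>E\<^esub> Z) = f Y \<oplus>\<^bsub>V\<^esub> f Z"
    "\<And>z w. w \<in> carrier V \<Longrightarrow> f (ten.pure z w) = z \<odot>\<^bsub>W\<^esub> w"
  proof -
    have "\<exists>f. (\<forall>Y\<in>carrier E. f Y \<in> carrier W) \<and>
        (\<forall>Y\<in>carrier E. \<forall>Z\<in>carrier E. f (Y \<oplus>\<^bsub>E\<^esub> Z) = f Y \<oplus>\<^bsub>W\<^esub> f Z) \<and>
        (\<forall>z\<in>carrier C. \<forall>w\<in>carrier W. f (ten.pure z w) = z \<odot>\<^bsub>W\<^esub> w)"
      unfolding E
      by (rule ten.T_lift)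
        (use W.scale_closed W.scale_left_distrib W.scale_right_distrib W.scale_scale W.M.abelian_group_axioms in
          \<open>simp_all add: C mult.commute flip: W_def\<close>)
    then obtain f where f: "\<forall>Y\<in>carrier E. f Y \<in> carrier V"
      "\<forall>Y\<in>carrier E. \<forall>Z\<in>carrier E. f (Y \<oplus>\<^bsub>E\<^esub> Z) = f Y \<oplus>\<^bsub>V\<^esub> f Z"
      "\<forall>z\<in>UNIV. \<forall>w\<in>carrier V. f (ten.pure z w) = z \<odot>\<^bsub>W\<^esub> w"
      unfolding C Wc Wadd by blast
    show thesis by (rule that[of f]) (use f in simp_all)
  qed
  have pure: "ten.pure z w \<in> carrier E" if "w \<in> carrier V" for z w
    unfolding E using ten.pure_simps(1)[of z w] that by (simp add: C Wc)
  have pure_add: "ten.pure z (v \<oplus>\<^bsub>V\<^esub> w) = ten.pure z v \<oplus>\<^bsub>E\<^esub> ten.pure z w"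
    if "v \<in> carrier V" "w \<in> carrier V" for z v w
    unfolding E using ten.pure_simps(3)[of z v w] that by (simp add: C Wc) (simp add: W_def)
  have f0: "f \<zero>\<^bsub>E\<^esub> = \<zero>\<^bsub>V\<^esub>"
    by (rule additive_map_zero[OF E.abelian_group_axioms V.M.abelian_group_axioms]) (simp_all add: f del: E.l_zero E.r_zero)
  have p0: "ten.pure 1 \<zero>\<^bsub>V\<^esub> = \<zero>\<^bsub>E\<^esub>"
    by (rule additive_map_zero[OF V.M.abelian_group_axioms E.abelian_group_axioms])
      (simp_all add: pure pure_add del: V.M.l_zero V.M.r_zero)
  \<comment> \<open>The normal form \<open>1 \<otimes> v\<close>.\<close>
  have pure_1: "Y = ten.pure 1 (f Y)" if "Y \<in> carrier E" for Y
    using that unfolding E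
  proof (rule ten.T_induct)
    show "\<zero>\<^bsub>ten.T act\<^esub> = ten.pure 1 (f \<zero>\<^bsub>ten.T act\<^esub>)" using f0 p0 by (simp add: E)
  next
    fix Y Z assume "Y \<in> carrier (ten.T act)" "Z \<in> carrier (ten.T act)"
    then have YZ: "Y \<in> carrier E" "Z \<in> carrier E" by (simp_all add: E)
    assume *: "Y = ten.pure 1 (f Y)" "Z = ten.pure 1 (f Z)"
    have "ten.pure 1 (f (Y \<ominus>\<^bsub>E\<^esub> Z)) \<oplus>\<^bsub>E\<^esub> Z = ten.pure 1 (f (Y \<ominus>\<^bsub>E\<^esub> Z) \<oplus>\<^bsub>V\<^esub> f Z)"
      using pure_add[of "f (Y \<ominus>\<^bsub>E\<^esub> Z)" "f Z" 1] *(2) f(1) YZ by simp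
    also have "\<dots> = ten.pure 1 (f ((Y \<ominus>\<^bsub>E\<^esub> Z) \<oplus>\<^bsub>E\<^esub> Z))" using YZ by (simp add: f(2))
    also have "(Y \<ominus>\<^bsub>E\<^esub> Z) \<oplus>\<^bsub>E\<^esub> Z = Y" using YZ by (simp add: a_minus_def E.a_assoc E.l_neg)
    finally have "ten.pure 1 (f (Y \<ominus>\<^bsub>E\<^esub> Z)) \<oplus>\<^bsub>E\<^esub> Z = Y" using *(1) by simp
    then have "Y \<ominus>\<^bsub>E\<^esub> Z = (ten.pure 1 (f (Y \<ominus>\<^bsub>E\<^esub> Z)) \<oplus>\<^bsub>E\<^esub> Z) \<ominus>\<^bsub>E\<^esub> Z" by simp
    also have "\<dots> = ten.pure 1 (f (Y \<ominus>\<^bsub>E\<^esub> Z))"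
      using YZ pure[OF f(1), of "Y \<ominus>\<^bsub>E\<^esub> Z" 1] by (simp add: a_minus_def E.a_assoc E.r_neg)
    finally show "Y \<ominus>\<^bsub>ten.T act\<^esub> Z = ten.pure 1 (f (Y \<ominus>\<^bsub>ten.T act\<^esub> Z))" unfolding E .
  next
    fix z w assume "z \<in> carrier C" "w \<in> carrier W"
    then have w: "w \<in> carrier V" "w \<in> carrier W" by (simp_all add: Wc)
    show "ten.pure z w = ten.pure 1 (f (ten.pure z w))"
      unfolding f(3)[OF w(1)] using ten.pure_simps(4)[of 1 w z] w(2) by (simp add: C)
  qed
  have f_inj: "Y = Z" if "Y \<in> carrier E" "Z \<in> carrier E" "f Y = f Z" for Y Z
    using pure_1[OF that(1)] pure_1[OF that(2)] that(3) by simp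
  have E_cl: "ten.cl t \<in> carrier E" if "t \<in> carrier ten.F" for t unfolding E ten.T_simps(1) using that by blast
  have E_add: "ten.cl (t + u) = ten.cl t \<oplus>\<^bsub>E\<^esub> ten.cl u" if "t \<in> carrier ten.F" "u \<in> carrier ten.F" for t u
    unfolding E by (rule ten.T_simps(3)[OF that, symmetric])
  have E_0: "ten.cl 0 = \<zero>\<^bsub>E\<^esub>" unfolding E ten.T_simps(2) ..
  have gen: "act h (z, w) \<in> carrier ten.F \<and> f (ten.cl (act h (z, w))) = tw 1 h \<odot>\<^bsub>V\<^esub> (z \<odot>\<^bsub>W\<^esub> w)"
    if h: "h \<in> carrier kG" and w: "w \<in> carrier V" for h z w
  proof -
    let ?t = "\<lambda>g. frag_of ((Poly_Mapping.lookup h g * \<chi> g) * z, Poly_Mapping.single g 1 \<odot>\<^bsub>V\<^esub> w)"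
    have act: "act h (z, w) = (\<Sum>g\<in>Poly_Mapping.keys h. ?t g)"
      by (simp add: act_def comult_group_algebra sum.reindex inj_on_def char_module_smult)
    have zw: "z \<odot>\<^bsub>W\<^esub> w \<in> carrier V" using w by (simp add: Ws V.smult_closed sing)
    have A: "(\<Sum>g\<in>A. ?t g) \<in> carrier ten.F \<and>
        (\<Sum>g\<in>A. Poly_Mapping.single g (\<chi> g * Poly_Mapping.lookup h g)) \<in> carrier kG \<and>
        f (ten.cl (\<Sum>g\<in>A. ?t g)) = (\<Sum>g\<in>A. Poly_Mapping.single g (\<chi> g * Poly_Mapping.lookup h g)) \<odot>\<^bsub>V\<^esub> (z \<odot>\<^bsub>W\<^esub> w)"
      if "finite A" "A \<subseteq> carrier G" for A
      using that
    proof (induction A rule: finite_induct)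
      case empty
      then show ?case
        using V.smult_zero_left[OF zw] E_0 f0 by (simp add: group_algebra_simps)
    next
      case (insert g A)
      have g: "g \<in> carrier G" using insert.prems by simp
      let ?c = "Poly_Mapping.lookup h g * \<chi> g"
      have tg: "?t g \<in> carrier ten.F" using g w by (simp add: C Wc V.smult_closed sing)
      have IH: "(\<Sum>g\<in>A. ?t g) \<in> carrier ten.F"
        "(\<Sum>g\<in>A. Poly_Mapping.single g (\<chi> g * Poly_Mapping.lookup h g)) \<in> carrier kG"
        "f (ten.cl (\<Sum>g\<in>A. ?t g)) = (\<Sum>g\<in>A. Poly_Mapping.single g (\<chi> g * Poly_Mapping.lookup h g)) \<odot>\<^bsub>V\<^esub> (z \<odot>\<^bsub>W\<^esub> w)"
        using insert.IH insert.prems by auto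
      have "f (ten.cl (?t g)) = (?c * z) \<odot>\<^bsub>W\<^esub> (Poly_Mapping.single g 1 \<odot>\<^bsub>V\<^esub> w)"
        using f(3)[of "Poly_Mapping.single g 1 \<odot>\<^bsub>V\<^esub> w" "?c * z"] g w
        by (simp add: ten.pure_def V.smult_closed sing)
      also have "\<dots> = Poly_Mapping.single g (\<chi> g * Poly_Mapping.lookup h g) \<odot>\<^bsub>V\<^esub> (z \<odot>\<^bsub>W\<^esub> w)"
        using g w by (simp add: Ws V.smult_assoc[symmetric] sing) (simp add: group_algebra_simps mult_ac)
      finally have tg': "f (ten.cl (?t g)) = Poly_Mapping.single g (\<chi> g * Poly_Mapping.lookup h g) \<odot>\<^bsub>V\<^esub> (z \<odot>\<^bsub>W\<^esub> w)" .
      have sum_t: "(\<Sum>g\<in>insert g A. ?t g) = ?t g + (\<Sum>g\<in>A. ?t g)"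
        "(\<Sum>g\<in>insert g A. Poly_Mapping.single g (\<chi> g * Poly_Mapping.lookup h g)) =
          Poly_Mapping.single g (\<chi> g * Poly_Mapping.lookup h g) \<oplus>\<^bsub>kG\<^esub>
          (\<Sum>g\<in>A. Poly_Mapping.single g (\<chi> g * Poly_Mapping.lookup h g))"
        using insert.hyps by (simp_all add: group_algebra_simps)
      show ?case
        unfolding sum_t
        using ten.add_F[OF tg IH(1)] kG.a_closed[OF sing[OF g] IH(2)] E_add[OF tg IH(1)] f(2)[OF E_cl E_cl, OF tg IH(1)]
          V.smult_l_distr[OF sing[OF g] IH(2) zw] tg' IH(3)
        by simp
    qed
    have "(\<Sum>g\<in>Poly_Mapping.keys h. Poly_Mapping.single g (\<chi> g * Poly_Mapping.lookup h g)) = tw 1 h"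
      by (simp add: tw_def twist_def lin_extend_def mult.commute)
    then show ?thesis using A[of "Poly_Mapping.keys h"] h unfolding act by (simp add: group_algebra_simps)
  qed
  have ext: "frag_extend (act h) t \<in> carrier ten.F \<and> f (ten.cl (frag_extend (act h) t)) = tw 1 h \<odot>\<^bsub>V\<^esub> f (ten.cl t)"
    if h: "h \<in> carrier kG" and t: "t \<in> carrier ten.F" for h and t :: "'k \<times> 'v \<Rightarrow>\<^sub>0 int"
  proof (rule free_Abelian_group_induct[of t "carrier C \<times> carrier W"])
    show "Poly_Mapping.keys t \<subseteq> carrier C \<times> carrier W" using t by simp
    show "frag_extend (act h) 0 \<in> carrier ten.F \<and> f (ten.cl (frag_extend (act h) 0)) = tw 1 h \<odot>\<^bsub>V\<^esub> f (ten.cl 0)"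
      using V.smult_zero_right[OF tw_closed[OF h]] by (simp add: E_0 f0)
  next
    fix p assume "p \<in> carrier C \<times> carrier W"
    then obtain z w where "p = (z, w)" "w \<in> carrier V" by (auto simp: Wc)
    then show "frag_extend (act h) (frag_of p) \<in> carrier ten.F \<and>
        f (ten.cl (frag_extend (act h) (frag_of p))) = tw 1 h \<odot>\<^bsub>V\<^esub> f (ten.cl (frag_of p))"
      using gen[OF h, of w z] f(3)[of w z] by (simp add: ten.pure_def)
  next
    fix t u :: "'k \<times> 'v \<Rightarrow>\<^sub>0 int"
    assume "Poly_Mapping.keys t \<subseteq> carrier C \<times> carrier W" "Poly_Mapping.keys u \<subseteq> carrier C \<times> carrier W"
    then have tu: "t \<in> carrier ten.F" "u \<in> carrier ten.F" by simp_all
    assume t: "frag_extend (act h) t \<in> carrier ten.F \<and> f (ten.cl (frag_extend (act h) t)) = tw 1 h \<odot>\<^bsub>V\<^esub> f (ten.cl t)"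
      and u: "frag_extend (act h) u \<in> carrier ten.F \<and> f (ten.cl (frag_extend (act h) u)) = tw 1 h \<odot>\<^bsub>V\<^esub> f (ten.cl u)"
    have diff: "f (ten.cl (t - u)) = f (ten.cl t) \<ominus>\<^bsub>V\<^esub> f (ten.cl u)"
      if "t \<in> carrier ten.F" "u \<in> carrier ten.F" for t u :: "'k \<times> 'v \<Rightarrow>\<^sub>0 int"
    proof -
      have *: "t - u \<in> carrier ten.F" by (rule ten.diff_F[OF that])
      have "f (ten.cl t) = f (ten.cl (t - u)) \<oplus>\<^bsub>V\<^esub> f (ten.cl u)"
        using E_add[OF * that(2)] f(2)[OF E_cl E_cl, OF * that(2)] by simp
      then show ?thesis using f(1)[OF E_cl, OF *] f(1)[OF E_cl, OF that(2)]
        by (simp add: a_minus_def V.M.a_assoc V.M.r_neg)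
    qed
    show "frag_extend (act h) (t - u) \<in> carrier ten.F \<and>
        f (ten.cl (frag_extend (act h) (t - u))) = tw 1 h \<odot>\<^bsub>V\<^esub> f (ten.cl (t - u))"
      unfolding frag_extend_diff diff[OF tu] diff[OF conjunct1[OF t] conjunct1[OF u]]
      using ten.diff_F[OF conjunct1[OF t] conjunct1[OF u]] t u f(1)[OF E_cl, OF tu(1)] f(1)[OF E_cl, OF tu(2)]
      by (simp add: a_minus_def V.smult_r_distr V.smult_minus_right tw_closed[OF h] del: carrier_free_Abelian_group_iff)
  qed
  have smult: "h \<odot>\<^bsub>E\<^esub> ten.cl t = ten.cl (frag_extend (act h) t)" if h: "h \<in> carrier kG" and t: "t \<in> carrier ten.F" for h and t :: "'k \<times> 'v \<Rightarrow>\<^sub>0 int"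
  proof -
    have "ten.cl (frag_extend (act h) u) = ten.cl (frag_extend (act h) t)" if u: "u \<in> ten.cl t" for u
    proof -
      have "u - t \<in> ten.rel" using u by (simp add: ten.cl_mem)
      then have uF: "u \<in> carrier ten.F" and eq: "ten.cl u = ten.cl t"
        using ten.add_F[OF ten.rel_F t, of "u - t"] by (simp_all add: ten.cl_eq)
      show ?thesis
        by (rule f_inj) (use ext[OF h uF] ext[OF h t] E_cl eq in auto)
    qed
    then have "(\<Union>u\<in>ten.cl t. ten.cl (frag_extend (act h) u)) = (\<Union>u\<in>ten.cl t. ten.cl (frag_extend (act h) t))"
      by (intro SUP_cong refl)
    also have "\<dots> = ten.cl (frag_extend (act h) t)" using ten.rel_closed(1) ten.cl_mem[of t t] by auto
    finally show ?thesis by (simp add: E ten.T_simps(4))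
  qed
  have rep: "\<exists>t\<in>carrier ten.F. Y = ten.cl t" if "Y \<in> carrier E" for Y
    using that unfolding E ten.T_simps(1) by blast
  show "Y \<oplus>\<^bsub>E\<^esub> Z \<in> carrier E" if "Y \<in> carrier E" "Z \<in> carrier E" for Y Z using that by simp
  show "h \<odot>\<^bsub>E\<^esub> Y \<in> carrier E" if "h \<in> carrier kG" "Y \<in> carrier E" for h Y
    using rep[OF that(2)] smult[OF that(1)] ext[OF that(1)] E_cl by auto
  have "module_map kG E (restrict_scalars (tw 1) V) f"
  proof (rule module_mapI)
    fix h Y assume h: "h \<in> carrier kG" and "Y \<in> carrier E"
    then obtain t where t: "t \<in> carrier ten.F" "Y = ten.cl t" using rep by blast
    show "f (h \<odot>\<^bsub>E\<^esub> Y) = h \<odot>\<^bsub>restrict_scalars (tw 1) V\<^esub> f Y"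
      unfolding t(2) smult[OF h t(1)] using ext[OF h t(1)] by simp
  qed (simp_all add: f)
  moreover have "bij_betw f (carrier E) (carrier (restrict_scalars (tw 1) V))"
  proof (rule bij_betw_imageI)
    show "inj_on f (carrier E)" using f_inj by (rule inj_onI)
    have "v \<in> f ` carrier E" if "v \<in> carrier V" for v
      using pure[OF that, of 1] f(3)[OF that, of 1] that W.scale_one[of v]
      by (intro image_eqI[of _ _ "ten.pure 1 v"]) (simp_all add: W_def)
    then show "f ` carrier E = carrier (restrict_scalars (tw 1) V)" using f(1) by auto
  qed
  ultimately show "module_isomorphic kG E (restrict_scalars (tw 1) V)"
    by (auto simp: module_isomorphic_iff)
qed

end

lemma group_character_group:
  fixes G :: "('g, 'z) monoid_scheme"
  assumes "group G"
  shows "group (character_group G :: ('g \<Rightarrow> 'k::field) monoid)"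
proof (rule groupI)
  interpret group G by fact
  have mem: "\<psi> \<in> carrier (character_group G) \<longleftrightarrow> \<psi> \<in> extensional (carrier G) \<and>
      (\<forall>g\<in>carrier G. \<psi> g \<noteq> 0) \<and> (\<forall>g\<in>carrier G. \<forall>h\<in>carrier G. \<psi> (g \<otimes>\<^bsub>G\<^esub> h) = \<psi> g * \<psi> h)" for \<psi> :: "'g \<Rightarrow> 'k"
    by (auto simp: character_group_def hom_def ring_of_type_algebra_def)
  {
    fix \<psi> \<phi> :: "'g \<Rightarrow> 'k" assume "\<psi> \<in> carrier (character_group G)" "\<phi> \<in> carrier (character_group G)"
    then show "\<psi> \<otimes>\<^bsub>character_group G\<^esub> \<phi> \<in> carrier (character_group G)"
      unfolding mem by (auto simp: character_group_def)
  next
    show "\<one>\<^bsub>character_group G\<^esub> \<in> carrier (character_group G :: ('g \<Rightarrow> 'k) monoid)"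
      unfolding mem by (auto simp: character_group_def)
  next
    fix \<psi> \<phi> \<theta> :: "'g \<Rightarrow> 'k"
    show "\<psi> \<otimes>\<^bsub>character_group G\<^esub> \<phi> \<otimes>\<^bsub>character_group G\<^esub> \<theta> = \<psi> \<otimes>\<^bsub>character_group G\<^esub> (\<phi> \<otimes>\<^bsub>character_group G\<^esub> \<theta>)"
      by (auto simp: character_group_def)
  next
    fix \<psi> :: "'g \<Rightarrow> 'k" assume \<psi>: "\<psi> \<in> carrier (character_group G)"
    then show "\<one>\<^bsub>character_group G\<^esub> \<otimes>\<^bsub>character_group G\<^esub> \<psi> = \<psi>"
      unfolding mem by (auto simp: character_group_def extensional_def)
    show "\<exists>\<phi>\<in>carrier (character_group G). \<phi> \<otimes>\<^bsub>character_group G\<^esub> \<psi> = \<one>\<^bsub>character_group G\<^esub>"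
    proof (rule bexI[of _ "\<lambda>g\<in>carrier G. inverse (\<psi> g)"])
      show "(\<lambda>g\<in>carrier G. inverse (\<psi> g)) \<otimes>\<^bsub>character_group G\<^esub> \<psi> = \<one>\<^bsub>character_group G\<^esub>"
        using \<psi> unfolding mem by (auto simp: character_group_def)
      show "(\<lambda>g\<in>carrier G. inverse (\<psi> g)) \<in> carrier (character_group G)"
        using \<psi> unfolding mem by auto
    qed
  }
qed

lemma character_group_pow:
  assumes "\<psi> \<in> carrier (character_group G)"
  shows "\<psi> [^]\<^bsub>character_group G\<^esub> (n :: nat) = (\<lambda>g\<in>carrier G. \<psi> g ^ n)"
  by (induction n) (auto simp: nat_pow_def character_group_def mult.commute)

lemma character_pow_eq_one:
  assumes "group G" "\<psi> \<in> carrier (character_group G)"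
  shows "(\<forall>g\<in>carrier G. \<psi> g ^ n = 1) \<longleftrightarrow> group.ord (character_group G) \<psi> dvd n"
proof -
  have "\<psi> [^]\<^bsub>character_group G\<^esub> n = \<one>\<^bsub>character_group G\<^esub> \<longleftrightarrow> (\<forall>g\<in>carrier G. \<psi> g ^ n = 1)"
    unfolding character_group_pow[OF assms(2)] by (auto simp: character_group_def fun_eq_iff restrict_def)
  then show ?thesis using group.pow_eq_id[OF group_character_group[OF assms(1)] assms(2), of n] by simp
qed

lemma mult_of_pow_eq_one:
  fixes q :: "'k::field"
  assumes "q \<noteq> 0"
  shows "q ^ n = 1 \<longleftrightarrow> group.ord (mult_of (ring_of_type_algebra :: 'k ring)) q dvd n"
proof -
  interpret K: field "ring_of_type_algebra :: 'k ring" by (rule field_from_type_algebra)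
  have eq: "mult_of (ring_of_type_algebra :: 'k ring) = Multiplicative_Group.mult_of ring_of_type_algebra"
    by (simp add: Ring_Divisibility.mult_of_def Multiplicative_Group.mult_of_def)
  interpret group "mult_of (ring_of_type_algebra :: 'k ring)" unfolding eq by (rule K.field_mult_group)
  have pow: "q [^]\<^bsub>mult_of (ring_of_type_algebra :: 'k ring)\<^esub> n = q ^ n" for n :: nat
    by (induction n) (simp_all add: nat_pow_def mult.commute)
  show ?thesis using pow_eq_id[of q n] assms by (simp add: pow)
qed

context hopf_ore_setting
begin

lemma tw_simple_fd: "simple_fd kG V \<Longrightarrow> simple_fd kG (restrict_scalars (tw n) V)"
  by (rule restrict_scalars_simple_fd[OF _ tw_algebra_map tw_surj])

lemma tw_iso:
  "module_isomorphic kG V W \<Longrightarrow> module_isomorphic kG (restrict_scalars (tw n) V) (restrict_scalars (tw n) W)"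
  by (rule restrict_scalars_iso[OF _ algebra_map_hom[OF tw_algebra_map]])

lemma tw_tw: "restrict_scalars (tw m) (restrict_scalars (tw n) V) = restrict_scalars (tw (m + n)) V"
  by (simp add: restrict_scalars_def tw_add add.commute)

lemma tw_trivial:
  assumes "\<And>g. g \<in> carrier G \<Longrightarrow> \<chi> g ^ n = 1"
  shows "module_isomorphic kG (restrict_scalars (tw n) V) V"
proof (rule module_isomorphic_id)
  fix u v assume "u \<in> carrier kG"
  then have "tw n u = u" unfolding tw_def by (intro twist_one) (auto simp: group_algebra_simps assms)
  then show "u \<odot>\<^bsub>restrict_scalars (tw n) V\<^esub> v = u \<odot>\<^bsub>V\<^esub> v" by simp
qed simp_all

end

lemma carrier_BijGroup: "carrier (BijGroup I) = Bij I"
  by (simp add: BijGroup_def)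

lemma one_BijGroup: "i \<in> I \<Longrightarrow> \<one>\<^bsub>BijGroup I\<^esub> i = i"
  by (simp add: BijGroup_def)

lemma mult_BijGroup: "\<lbrakk>f \<in> Bij I; g \<in> Bij I; i \<in> I\<rbrakk> \<Longrightarrow> (f \<otimes>\<^bsub>BijGroup I\<^esub> g) i = f (g i)"
  by (simp add: BijGroup_def compose_def)

lemma BijGroup_pow:
  assumes "f \<in> Bij I" "i \<in> I"
  shows "(f [^]\<^bsub>BijGroup I\<^esub> (n :: nat)) i = (f ^^ n) i"
proof -
  interpret group "BijGroup I" by (rule group_BijGroup)
  have f: "f \<in> carrier (BijGroup I)" using assms(1) by (simp add: carrier_BijGroup)
  have "(f [^]\<^bsub>BijGroup I\<^esub> n) i = (f ^^ n) i" if "i \<in> I" for i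
    using that
  proof (induction n arbitrary: i)
    case 0
    then show ?case by (simp add: one_BijGroup)
  next
    case (Suc n)
    have "f [^]\<^bsub>BijGroup I\<^esub> n \<in> Bij I" using nat_pow_closed[OF f, of n] by (simp only: carrier_BijGroup)
    then have "(f [^]\<^bsub>BijGroup I\<^esub> Suc n) i = (f [^]\<^bsub>BijGroup I\<^esub> n) (f i)"
      unfolding nat_pow_Suc using assms(1) Suc.prems by (intro mult_BijGroup)
    also have "\<dots> = (f ^^ n) (f i)"
      by (rule Suc.IH) (use Suc.prems Bij_imp_funcset[OF assms(1)] in auto)
    finally show ?case by (simp add: funpow_swap1)
  qed
  then show ?thesis using assms(2) .
qed

locale simples_setting = hopf_ore_closed G \<chi> a
  for G :: "('g, 'z) monoid_scheme" (structure) and \<chi> :: "'g \<Rightarrow> 'k::alg_closed_field" and a :: 'g +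
  fixes I :: "'i set" and V :: "'i \<Rightarrow> ('g \<Rightarrow>\<^sub>0 'k, 'v) module"
  assumes complete: "complete_simples TYPE(nat \<Rightarrow> 'k) kG I V"
begin

lemma V_simple: "i \<in> I \<Longrightarrow> simple_fd kG (V i)"
  and V_iso: "\<lbrakk>i \<in> I; j \<in> I; module_isomorphic kG (V i) (V j)\<rbrakk> \<Longrightarrow> i = j"
  using complete by (auto simp: complete_simples_def nonisomorphic_simples_def)

lemma V_left_module: "i \<in> I \<Longrightarrow> left_module kG (V i)"
  using V_simple by (auto simp: simple_fd_def simple_module_def)

lemma V_complete:
  assumes "simple_fd kG M" shows "\<exists>i\<in>I. module_isomorphic kG M (V i)"
  by (rule kG.complete_simples_any_type[OF complete assms])

lemma V_iso_unique:
  assumes "i \<in> I" "j \<in> I" "simple_fd kG M" "module_isomorphic kG M (V i)" "module_isomorphic kG M (V j)"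
  shows "i = j"
proof (rule V_iso[OF assms(1,2)])
  have "left_module kG M" using assms(3) by (auto simp: simple_fd_def simple_module_def)
  then show "module_isomorphic kG (V i) (V j)"
    using module_isomorphic_trans[OF module_isomorphic_sym[OF _ assms(4)] assms(5)] by blast
qed

abbreviation \<sigma> where "\<sigma> \<equiv> twist_perm G \<chi> I V"

text \<open>
  The twist of \<open>V\<^sub>i\<close> by \<open>\<chi>\<close> is simple, so it is isomorphic to some \<open>V\<^sub>j\<close>, and \<open>j\<close> is unique; hence the
  definite description in \<open>\<sigma>\<close> has a value.
\<close>

lemma twist_perm_iso:
  assumes i: "i \<in> I"
  shows "\<sigma> i \<in> I" "module_isomorphic kG (restrict_scalars (tw 1) (V i)) (V (\<sigma> i))"
proof -
  let ?E = "hopf_tensor kG (char_module \<chi>) (V i)"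
  note E = hopf_tensor_iso[OF V_left_module[OF i]]
  have sym: "module_isomorphic kG W ?E" if "module_isomorphic kG ?E W" for W :: "('g \<Rightarrow>\<^sub>0 'k, 'w) module"
    using that E(2,3) by (rule module_isomorphic_sym_closed)
  obtain j where j: "j \<in> I" "module_isomorphic kG (restrict_scalars (tw 1) (V i)) (V j)"
    using V_complete[OF tw_simple_fd[OF V_simple[OF i]]] by blast
  have P: "j \<in> I \<and> module_isomorphic kG ?E (V j)"
    using j module_isomorphic_trans[OF E(1) j(2)] by simp
  have "\<sigma> i = (THE j. j \<in> I \<and> module_isomorphic kG ?E (V j))" using i by (simp add: twist_perm_def)
  also have "\<dots> = j"
  proof (rule the_equality)
    show "j \<in> I \<and> module_isomorphic kG ?E (V j)" by (rule P)
    fix l assume l: "l \<in> I \<and> module_isomorphic kG ?E (V l)"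
    have "module_isomorphic kG (V l) ?E"
      using conjunct2[OF l] E(2,3) by (rule module_isomorphic_sym_closed)
    then show "l = j" using l P by (intro V_iso) (auto intro: module_isomorphic_trans)
  qed
  finally show "\<sigma> i \<in> I" "module_isomorphic kG (restrict_scalars (tw 1) (V i)) (V (\<sigma> i))" using j by simp_all
qed

lemma twist_perm_pow:
  assumes i: "i \<in> I"
  shows "(\<sigma> ^^ n) i \<in> I \<and> module_isomorphic kG (restrict_scalars (tw n) (V i)) (V ((\<sigma> ^^ n) i))"
proof (induction n)
  case 0
  show ?case using i tw_trivial[of 0] by simp
next
  case (Suc n)
  have "module_isomorphic kG (restrict_scalars (tw (Suc n)) (V i)) (restrict_scalars (tw 1) (V ((\<sigma> ^^ n) i)))"
    using tw_iso[OF conjunct2[OF Suc], of 1] unfolding tw_tw by simp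
  then show ?case
    using twist_perm_iso[OF conjunct1[OF Suc]] by (auto intro: module_isomorphic_trans)
qed

end

text \<open>
  The order of \<open>\<chi>\<close> divides \<open>s\<close>, and \<open>s\<close> divides the order of \<open>q = \<chi>(a)\<close>; so both orders are \<open>s\<close>.
\<close>

locale finite_order_setting = simples_setting G \<chi> a I V
  for G :: "('g, 'z) monoid_scheme" (structure) and \<chi> :: "'g \<Rightarrow> 'k::alg_closed_field" and a :: 'g
    and I :: "'i set" and V :: "'i \<Rightarrow> ('g \<Rightarrow>\<^sub>0 'k, 'v) module" +
  fixes s :: nat
  assumes s_pos: "s > 0" and char_pow: "g \<in> carrier G \<Longrightarrow> \<chi> g ^ s = 1"
    and q_order: "\<chi> a ^ n = 1 \<Longrightarrow> s dvd n"
begin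

text \<open>
  \<open>\<sigma>\<^sup>s(i)\<close> is the index of the twist of \<open>V\<^sub>i\<close> by \<open>\<chi>\<^sup>s = 1\<close>.
\<close>

lemma twist_perm_order: "i \<in> I \<Longrightarrow> (\<sigma> ^^ s) i = i"
proof -
  assume i: "i \<in> I"
  show ?thesis
    using twist_perm_pow[OF i, of s] i tw_trivial[OF char_pow, of "V i"] tw_simple_fd[OF V_simple[OF i], of s]
    by (auto intro: V_iso_unique[of _ _ "restrict_scalars (tw s) (V i)"])
qed

lemma twist_perm_Bij: "\<sigma> \<in> Bij I"
proof -
  have mem: "\<sigma> i \<in> I" if "i \<in> I" for i by (rule twist_perm_iso(1)[OF that])
  obtain n where n: "s = Suc n" using s_pos gr0_conv_Suc by blast
  have l: "(\<sigma> ^^ n) (\<sigma> i) = i" and r: "\<sigma> ((\<sigma> ^^ n) i) = i" if "i \<in> I" for i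
    using twist_perm_order[OF that] by (simp_all add: n funpow_swap1)
  have "bij_betw \<sigma> I I"
    by (rule bij_betw_byWitness[of _ "\<sigma> ^^ n"]) (use l r mem twist_perm_pow in auto)
  then show ?thesis by (simp add: Bij_def twist_perm_def)
qed

lemma orbit_rel_pow:
  assumes "(i, j) \<in> orbit_rel I \<sigma>"
  shows "\<exists>n. j = (\<sigma> ^^ n) i"
proof -
  interpret B: group "BijGroup I" by (rule group_BijGroup)
  obtain t :: int where t: "i \<in> I" "j \<in> I" "i = (\<sigma> [^]\<^bsub>BijGroup I\<^esub> t) j"
    using assms by (auto simp: orbit_rel_def)
  have S: "\<sigma> \<in> carrier (BijGroup I)" using twist_perm_Bij by (simp add: carrier_BijGroup)
  have "\<sigma> [^]\<^bsub>BijGroup I\<^esub> s = \<one>\<^bsub>BijGroup I\<^esub>"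
  proof (rule extensionalityI[of _ I])
    show "\<sigma> [^]\<^bsub>BijGroup I\<^esub> s \<in> extensional I"
      using B.nat_pow_closed[OF S, of s] unfolding carrier_BijGroup by (rule Bij_imp_extensional)
    show "(\<sigma> [^]\<^bsub>BijGroup I\<^esub> s) i = \<one>\<^bsub>BijGroup I\<^esub> i" if "i \<in> I" for i
      unfolding BijGroup_pow[OF twist_perm_Bij that] one_BijGroup[OF that] by (rule twist_perm_order[OF that])
  qed (simp add: BijGroup_def)
  then have per: "\<sigma> [^]\<^bsub>BijGroup I\<^esub> (int s * l) = \<one>\<^bsub>BijGroup I\<^esub>" for l :: int
    using B.int_pow_pow[OF S, of "int s" l] by (simp add: int_pow_int B.int_pow_one)
  \<comment> \<open>Since \<open>\<sigma>\<^sup>s = 1\<close>, the power \<open>\<sigma>\<^sup>-\<^sup>t\<close> is \<open>\<sigma>\<^sup>n\<close> with a natural exponent \<open>n\<close>.\<close>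
  define n where "n = nat ((- t) mod int s)"
  have "int n = - t - int s * ((- t) div int s)"
    using s_pos by (simp add: n_def minus_mult_div_eq_mod)
  then have "int n + t = int s * (- ((- t) div int s))" by simp
  then have "\<sigma> [^]\<^bsub>BijGroup I\<^esub> int n \<otimes>\<^bsub>BijGroup I\<^esub> \<sigma> [^]\<^bsub>BijGroup I\<^esub> t = \<one>\<^bsub>BijGroup I\<^esub>"
    using B.int_pow_mult[OF S, of "int n" t] per[of "- ((- t) div int s)"] by simp
  then have "(\<sigma> [^]\<^bsub>BijGroup I\<^esub> int n) ((\<sigma> [^]\<^bsub>BijGroup I\<^esub> t) j) = j"
    using mult_BijGroup[OF B.int_pow_closed[OF S, of "int n", unfolded carrier_BijGroup]
        B.int_pow_closed[OF S, of t, unfolded carrier_BijGroup] t(2)] one_BijGroup[OF t(2)] by simp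
  then show ?thesis
    using t BijGroup_pow[OF twist_perm_Bij t(1), of n] by (auto simp: int_pow_int)
qed

lemma pow_orbit_rel:
  assumes "i \<in> I" shows "((\<sigma> ^^ n) i, i) \<in> orbit_rel I \<sigma>"
  using twist_perm_pow[OF assms, of n] assms BijGroup_pow[OF twist_perm_Bij assms, of n]
  by (auto simp: orbit_rel_def int_pow_int intro!: exI[of _ "int n"])

lemma transversal_representative:
  assumes "transversal I (orbit_rel I \<sigma>) J" "i \<in> I"
  shows "\<exists>j\<in>J. (i, j) \<in> orbit_rel I \<sigma>"
proof -
  have "orbit_rel I \<sigma> `` {i} \<in> I // orbit_rel I \<sigma>" using assms(2) by (rule quotientI)
  moreover have "\<forall>C\<in>I // orbit_rel I \<sigma>. \<exists>!j. j \<in> J \<inter> C" by (rule conjunct2[OF assms(1)[unfolded transversal_def]])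
  ultimately have "\<exists>!j. j \<in> J \<inter> orbit_rel I \<sigma> `` {i}" by (rule bspec[rotated])
  then obtain j where "j \<in> J \<inter> orbit_rel I \<sigma> `` {i}" by (rule ex1E)
  then show ?thesis by blast
qed

lemma transversal_unique:
  assumes "transversal I (orbit_rel I \<sigma>) J" "j \<in> J" "l \<in> J" "(j, l) \<in> orbit_rel I \<sigma>"
  shows "j = l"
proof -
  have jI: "j \<in> I" using assms(1,2) by (auto simp: transversal_def)
  have "(j, j) \<in> orbit_rel I \<sigma>" using pow_orbit_rel[OF jI, of 0] by simp
  then have mem: "j \<in> J \<inter> orbit_rel I \<sigma> `` {j}" "l \<in> J \<inter> orbit_rel I \<sigma> `` {j}" using assms(2-4) by simp_all
  have "\<forall>C\<in>I // orbit_rel I \<sigma>. \<exists>!m. m \<in> J \<inter> C" by (rule conjunct2[OF assms(1)[unfolded transversal_def]])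
  from bspec[OF this quotientI[OF jI]] obtain m where "\<forall>y. y \<in> J \<inter> orbit_rel I \<sigma> `` {j} \<longrightarrow> y = m"
    by (rule ex1E)
  then have eq: "y = m" if "y \<in> J \<inter> orbit_rel I \<sigma> `` {j}" for y using that by blast
  show ?thesis using eq[OF mem(1)] eq[OF mem(2)] by simp
qed

lemma q_powers_distinct: "inj_on (\<lambda>i. \<chi> a ^ i) {..<s}"
proof (rule linorder_inj_onI)
  fix i j assume ij: "i < j" "i \<in> {..<s}" "j \<in> {..<s}"
  show "\<chi> a ^ i \<noteq> \<chi> a ^ j"
  proof
    assume "\<chi> a ^ i = \<chi> a ^ j"
    also have "\<dots> = \<chi> a ^ i * \<chi> a ^ (j - i)" using ij(1) by (simp flip: power_add)
    finally have "\<chi> a ^ (j - i) = 1" using character_nonzero[OF character a_closed] by simp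
    then have "s dvd j - i" by (rule q_order)
    then show False using ij by (auto dest: dvd_imp_le)
  qed
qed auto

end

section \<open>The classification\<close>

context hopf_ore_setting
begin

lemma group_central: "u \<in> carrier kG \<Longrightarrow> Poly_Mapping.single a 1 \<otimes>\<^bsub>kG\<^esub> u = u \<otimes>\<^bsub>kG\<^esub> Poly_Mapping.single a 1"
proof -
  assume "u \<in> carrier kG"
  then have "Poly_Mapping.keys u \<subseteq> carrier G" by (simp add: group_algebra_simps)
  then show ?thesis
  proof (induction u rule: poly_mapping_carrier_induct)
    case zero
    show ?case
      using kG.l_null[OF kG.single_closed[OF a_closed]] kG.r_null[OF kG.single_closed[OF a_closed]]
      by (simp add: group_algebra_simps)
  next
    case (single g c)
    then show ?case by (simp add: group_algebra_simps a_central)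
  next
    case (add u v)
    then have "u \<in> carrier kG" "v \<in> carrier kG" by (simp_all add: group_algebra_simps)
    then show ?case
      using add kG.l_distr[of u v "Poly_Mapping.single a 1"] kG.r_distr[of u v "Poly_Mapping.single a 1"]
        kG.single_closed[OF a_closed, of 1] by (simp add: group_algebra_simps)
  qed
qed

end

text \<open>
  One module \<open>V(j, \<beta>)\<close> of the classification. The locale has the parameters \<open>j\<close> and \<open>\<beta>\<close> so that two such
  modules can be considered at a time.
\<close>

locale component_setting = finite_order_setting G \<chi> a I V s
  for G :: "('g, 'z) monoid_scheme" (structure) and \<chi> :: "'g \<Rightarrow> 'k::alg_closed_field" and a :: 'g
    and I :: "'i set" and V :: "'i \<Rightarrow> ('g \<Rightarrow>\<^sub>0 'k, 'v) module" and s :: nat +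
  fixes j :: 'i and \<beta> :: 'k
  assumes j: "j \<in> I" and \<beta>: "\<beta> \<noteq> 0"
begin

sublocale ind: induced_setting G \<chi> a "V j" s \<beta>
  by (intro induced_setting.intro induced_setting_axioms.intro hopf_ore_setting_axioms V_left_module[OF j] s_pos char_pow)

lemma Vj: "simple_module kG (V j)" "finite_dim kG (V j)"
  using V_simple[OF j] by (auto simp: simple_fd_def)

lemma a_scalar_ex: "\<exists>\<alpha>. \<forall>v\<in>carrier (V j). Poly_Mapping.single a 1 \<odot>\<^bsub>V j\<^esub> v = (\<alpha> \<odot>\<^bsub>kG\<^esub> \<one>\<^bsub>kG\<^esub>) \<odot>\<^bsub>V j\<^esub> v"
proof (rule simple_endomorphism_scalar[OF kG.scalar_ring_axioms V_simple[OF j]])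
  have a: "Poly_Mapping.single a 1 \<in> carrier kG" by (rule kG.single_closed[OF a_closed])
  show "module_map kG (V j) (V j) (\<lambda>v. Poly_Mapping.single a 1 \<odot>\<^bsub>V j\<^esub> v)"
    by (rule module_mapI)
      (simp_all add: a ind.V.smult_closed ind.V.smult_r_distr group_central flip: ind.V.smult_assoc)
qed

definition \<alpha> :: 'k where
  "\<alpha> = (SOME \<alpha>. \<forall>v\<in>carrier (V j). Poly_Mapping.single a 1 \<odot>\<^bsub>V j\<^esub> v = (\<alpha> \<odot>\<^bsub>kG\<^esub> \<one>\<^bsub>kG\<^esub>) \<odot>\<^bsub>V j\<^esub> v)"

lemma a_scalar: "v \<in> carrier (V j) \<Longrightarrow> Poly_Mapping.single a 1 \<odot>\<^bsub>V j\<^esub> v = (\<alpha> \<odot>\<^bsub>kG\<^esub> \<one>\<^bsub>kG\<^esub>) \<odot>\<^bsub>V j\<^esub> v"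
  using someI_ex[OF a_scalar_ex] unfolding \<alpha>_def by blast

lemma \<alpha>_nonzero: "\<alpha> \<noteq> 0"
proof
  assume "\<alpha> = 0"
  obtain v where v: "v \<in> carrier (V j)" "v \<noteq> \<zero>\<^bsub>V j\<^esub>" using simple_moduleD(3)[OF Vj(1)] by blast
  have "Poly_Mapping.single a 1 \<odot>\<^bsub>V j\<^esub> v = \<zero>\<^bsub>V j\<^esub>"
    using a_scalar[OF v(1)] \<open>\<alpha> = 0\<close> ind.V.smult_zero_left[OF v(1)] by (simp add: group_algebra_simps)
  then have "Poly_Mapping.single (inv a) 1 \<odot>\<^bsub>V j\<^esub> (Poly_Mapping.single a 1 \<odot>\<^bsub>V j\<^esub> v) = \<zero>\<^bsub>V j\<^esub>"
    using a_closed by (simp add: ind.V.smult_zero_right kG.single_closed)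
  moreover have "Poly_Mapping.single (inv a) 1 \<otimes>\<^bsub>kG\<^esub> Poly_Mapping.single a 1 = \<one>\<^bsub>kG\<^esub>"
    using a_closed by (simp add: group_algebra_simps)
  ultimately show False
    using v a_closed by (simp add: ind.V.smult_assoc[symmetric] kG.single_closed ind.V.smult_one)
qed

text \<open>Moving \<open>a\<close> past \<open>x\<^sup>i\<close> multiplies by \<open>q\<^sup>i\<close>, and on \<open>V\<^sub>j\<close> it is the scalar \<open>\<alpha>\<close>.\<close>

lemma a_xe:
  assumes v: "v \<in> carrier (V j)"
  shows "ore_group a \<odot>\<^bsub>ind.Q\<^esub> ind.xe i v = ((\<alpha> * \<chi> a ^ i) \<odot>\<^bsub>H\<^esub> \<one>\<^bsub>H\<^esub>) \<odot>\<^bsub>ind.Q\<^esub> ind.xe i v"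
proof -
  have a: "Poly_Mapping.single a 1 \<in> carrier kG" by (rule kG.single_closed[OF a_closed])
  have "tw i (Poly_Mapping.single a 1) = (\<chi> a ^ i \<odot>\<^bsub>kG\<^esub> \<one>\<^bsub>kG\<^esub>) \<otimes>\<^bsub>kG\<^esub> Poly_Mapping.single a 1"
    using a_closed by (simp add: tw_def group_algebra_simps)
  then have "tw i (Poly_Mapping.single a 1) \<odot>\<^bsub>V j\<^esub> v =
      (\<chi> a ^ i \<odot>\<^bsub>kG\<^esub> \<one>\<^bsub>kG\<^esub>) \<odot>\<^bsub>V j\<^esub> ((\<alpha> \<odot>\<^bsub>kG\<^esub> \<one>\<^bsub>kG\<^esub>) \<odot>\<^bsub>V j\<^esub> v)"
    using v a by (simp add: ind.V.smult_assoc kG.scal_closed a_scalar)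
  also have "\<dots> = ((\<alpha> * \<chi> a ^ i) \<odot>\<^bsub>kG\<^esub> \<one>\<^bsub>kG\<^esub>) \<odot>\<^bsub>V j\<^esub> v"
    using v by (simp add: ind.V.smult_assoc[symmetric] kG.scal_closed kG.scal_mult[symmetric] mult.commute)
  finally show ?thesis
    using ind.xe_simps(3)[OF v a, of i] ind.xe_scale[OF v, of i "\<alpha> * \<chi> a ^ i"] by (simp add: ore_group_def)
qed

lemma xe_injective:
  assumes v: "v \<in> carrier (V j)" and i: "i < s" and zero: "ind.xe i v = \<zero>\<^bsub>ind.Q\<^esub>"
  shows "v = \<zero>\<^bsub>V j\<^esub>"
proof -
  interpret W: vspace "scalar_module kG (V j)" by (rule kG.vspace_scalar_module[OF ind.V.left_module_axioms])
  have "ind.xe s v = \<zero>\<^bsub>ind.Q\<^esub>"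
    using ind.xpow_xe[OF v, of "s - i" i] i zero by (simp add: ind.Q.smult_zero_right xpow_closed)
  then have "ind.emb ((\<beta> \<odot>\<^bsub>kG\<^esub> \<one>\<^bsub>kG\<^esub>) \<odot>\<^bsub>V j\<^esub> v) = \<zero>\<^bsub>ind.Q\<^esub>"
    using v by (simp add: ind.xe_wrap ind.emb_xe ind.V.smult_closed kG.scal_closed)
  then have "(\<beta> \<odot>\<^bsub>kG\<^esub> \<one>\<^bsub>kG\<^esub>) \<odot>\<^bsub>V j\<^esub> v = \<zero>\<^bsub>V j\<^esub>"
    using v by (intro ind.emb_inj) (simp_all add: ind.V.smult_closed kG.scal_closed)
  then show ?thesis using W.scale_eq_zero[of v \<beta>] v \<beta> by simp
qed

text \<open>
  The components of an element lie in different eigenspaces of \<open>a\<close>.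
\<close>

lemma component_in:
  assumes N: "submodule N (ring_of_type_algebra :: 'k ring) (scalar_module H ind.Q)"
    and stable: "\<And>y. y \<in> N \<Longrightarrow> ore_group a \<odot>\<^bsub>ind.Q\<^esub> y \<in> N"
    and v: "\<And>i. v i \<in> carrier (V j)" and sum: "(\<Oplus>\<^bsub>ind.Q\<^esub>i\<in>{..<s}. ind.xe i (v i)) \<in> N" and i: "i < s"
  shows "ind.xe i (v i) \<in> N"
proof -
  interpret W: vspace "scalar_module H ind.Q" by (rule H.vspace_scalar_module[OF ind.Q.left_module_axioms])
  have a: "ore_group a \<in> carrier H" using a_closed by (simp add: ore_group_def hopf_ore_simps)
  have "finsum (scalar_module H ind.Q) f A = finsum ind.Q f A" for f and A :: "nat set"
    by (simp add: finsum_def finprod_def)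
  moreover have "inj_on (\<lambda>i. \<alpha> * \<chi> a ^ i) {..<s}"
    using q_powers_distinct \<alpha>_nonzero by (auto simp: inj_on_def)
  ultimately have "\<forall>i\<in>{..<s}. ind.xe i (v i) \<in> N"
    using v sum
    by (intro W.eigenvector_components[OF group_linear_op[OF ind.Q.left_module_axioms a] N stable])
      (auto simp: ind.xe_simps a_xe)
  then show ?thesis using i by blast
qed

text \<open>
  A nonzero submodule contains some component \<open>x\<^sup>i v \<noteq> 0\<close>, hence \<open>x\<^sup>s v = \<beta> v \<noteq> 0\<close>, hence \<open>V\<^sub>j\<close> by simplicity of
  \<open>V\<^sub>j\<close>, and \<open>V\<^sub>j\<close> generates.
\<close>

lemma Q_simple: "simple_fd H ind.Q"
proof -
  have "N = {\<zero>\<^bsub>ind.Q\<^esub>} \<or> N = carrier ind.Q" if N: "submodule N H ind.Q" for N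
  proof (cases "N = {\<zero>\<^bsub>ind.Q\<^esub>}")
    case False
    have a: "ore_group a \<in> carrier H" using a_closed by (simp add: ore_group_def hopf_ore_simps)
    obtain y where y: "y \<in> N" "y \<noteq> \<zero>\<^bsub>ind.Q\<^esub>" using False submodule_zero[OF N] by blast
    then have "y \<in> ind.layers s" using submodule_subset[OF N] ind.carrier_Q_layers by blast
    then obtain v where v: "\<forall>i. v i \<in> carrier (V j)" "y = (\<Oplus>\<^bsub>ind.Q\<^esub>i\<in>{..<s}. ind.xe i (v i))"
      using ind.layers_finsum by blast
    have comp: "ind.xe i (v i) \<in> N" if "i < s" for i
      by (rule component_in[OF H.submodule_subspace[OF N]])
        (use v y(1) that submodule_smult[OF N a] in auto)
    have "\<exists>i<s. v i \<noteq> \<zero>\<^bsub>V j\<^esub>"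
    proof (rule ccontr)
      assume "\<not> (\<exists>i<s. v i \<noteq> \<zero>\<^bsub>V j\<^esub>)"
      then have "y = (\<Oplus>\<^bsub>ind.Q\<^esub>i\<in>{..<s}. \<zero>\<^bsub>ind.Q\<^esub>)"
        unfolding v(2) by (intro ind.Q.M.finsum_cong') (auto simp: ind.xe_zero)
      then show False using y(2) by simp
    qed
    then obtain i where i: "i < s" "v i \<noteq> \<zero>\<^bsub>V j\<^esub>" by blast
    have vi: "v i \<in> carrier (V j)" using v(1) by simp
    interpret W: vspace "scalar_module kG (V j)" by (rule kG.vspace_scalar_module[OF ind.V.left_module_axioms])
    let ?b = "(\<beta> \<odot>\<^bsub>kG\<^esub> \<one>\<^bsub>kG\<^esub>) \<odot>\<^bsub>V j\<^esub> v i"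
    have b: "?b \<in> carrier (V j)" "?b \<noteq> \<zero>\<^bsub>V j\<^esub>"
      using vi i(2) W.scale_eq_zero[of "v i" \<beta>] \<beta> by (auto simp: ind.V.smult_closed kG.scal_closed)
    have "xpow (s - i) \<odot>\<^bsub>ind.Q\<^esub> ind.xe i (v i) \<in> N" by (rule submodule_smult[OF N xpow_closed comp[OF i(1)]])
    then have "ind.emb ?b \<in> N"
      using ind.xpow_xe[OF vi, of "s - i" i] i(1) vi b(1) by (simp add: ind.xe_wrap ind.emb_xe)
    moreover have "submodule {w \<in> carrier (V j). ind.emb w \<in> N} kG (V j)"
      using restrict_scalars_submodule[OF N algebra_map_hom[OF group_to_ore_algebra_map]]
      by (intro module_map_preimage[OF ind.V.left_module_axioms res_left_module[OF ind.Q.left_module_axioms]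
            ind.emb_module_map]) (simp add: res_def)
    ultimately have "{w \<in> carrier (V j). ind.emb w \<in> N} = carrier (V j)"
      using b by (intro simple_module_whole[OF Vj(1)]) auto
    then have "N = carrier ind.Q" by (intro ind.Q_generated[OF N]) blast
    then show ?thesis ..
  qed simp
  moreover have "carrier ind.Q \<noteq> {\<zero>\<^bsub>ind.Q\<^esub>}"
  proof -
    obtain v where v: "v \<in> carrier (V j)" "v \<noteq> \<zero>\<^bsub>V j\<^esub>" using simple_moduleD(3)[OF Vj(1)] by blast
    then show ?thesis
      using ind.emb_inj[OF v(1)] module_mapD(1)[OF ind.emb_module_map v(1)] by auto
  qed
  ultimately show ?thesis
    using ind.Q_finite_dim[OF Vj(2)] ind.Q.left_module_axioms by (simp add: simple_fd_def simple_module_def)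
qed

text \<open>
  The eigenspace of \<open>a\<close> for \<open>\<mu>\<close> is stable under \<open>a\<close>, so it contains the components of its elements; but the
  eigenvalues of different components differ.
\<close>

lemma a_eigenvector:
  assumes y: "y \<in> carrier ind.Q" "y \<noteq> \<zero>\<^bsub>ind.Q\<^esub>"
    and eig: "ore_group a \<odot>\<^bsub>ind.Q\<^esub> y = (\<mu> \<odot>\<^bsub>H\<^esub> \<one>\<^bsub>H\<^esub>) \<odot>\<^bsub>ind.Q\<^esub> y"
  shows "\<exists>i<s. \<mu> = \<alpha> * \<chi> a ^ i \<and> (\<exists>w\<in>carrier (V j). y = ind.xe i w)"
proof -
  interpret W: vspace "scalar_module H ind.Q" by (rule H.vspace_scalar_module[OF ind.Q.left_module_axioms])
  have a: "ore_group a \<in> carrier H" using a_closed by (simp add: ore_group_def hopf_ore_simps)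
  let ?N = "{y \<in> carrier ind.Q. ore_group a \<odot>\<^bsub>ind.Q\<^esub> y = (\<mu> \<odot>\<^bsub>H\<^esub> \<one>\<^bsub>H\<^esub>) \<odot>\<^bsub>ind.Q\<^esub> y}"
  note com = scal_commute[OF ind.Q.left_module_axioms]
  have N: "submodule ?N (ring_of_type_algebra :: 'k ring) (scalar_module H ind.Q)"
  proof (rule W.subspaceI)
    fix c y assume y: "y \<in> ?N"
    then have "ore_group a \<odot>\<^bsub>ind.Q\<^esub> ((c \<odot>\<^bsub>H\<^esub> \<one>\<^bsub>H\<^esub>) \<odot>\<^bsub>ind.Q\<^esub> y) =
        (c \<odot>\<^bsub>H\<^esub> \<one>\<^bsub>H\<^esub>) \<odot>\<^bsub>ind.Q\<^esub> ((\<mu> \<odot>\<^bsub>H\<^esub> \<one>\<^bsub>H\<^esub>) \<odot>\<^bsub>ind.Q\<^esub> y)"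
      using com[OF a, of y c] by simp
    also have "\<dots> = (\<mu> \<odot>\<^bsub>H\<^esub> \<one>\<^bsub>H\<^esub>) \<odot>\<^bsub>ind.Q\<^esub> ((c \<odot>\<^bsub>H\<^esub> \<one>\<^bsub>H\<^esub>) \<odot>\<^bsub>ind.Q\<^esub> y)"
      using y by (intro com) (simp_all add: H.scal_closed)
    finally show "c \<odot>\<^bsub>scalar_module H ind.Q\<^esub> y \<in> ?N"
      using y by (simp add: ind.Q.smult_closed H.scal_closed)
  qed (auto simp: ind.Q.smult_r_distr ind.Q.smult_zero_right a H.scal_closed)
  have stable: "ore_group a \<odot>\<^bsub>ind.Q\<^esub> y \<in> ?N" if "y \<in> ?N" for y
    using that com[OF a, of y \<mu>] a by (simp add: ind.Q.smult_closed H.scal_closed)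
  have "y \<in> ind.layers s" using y(1) ind.carrier_Q_layers by blast
  then obtain v where v: "\<forall>i. v i \<in> carrier (V j)" "y = (\<Oplus>\<^bsub>ind.Q\<^esub>i\<in>{..<s}. ind.xe i (v i))"
    using ind.layers_finsum by blast
  have comp: "\<mu> = \<alpha> * \<chi> a ^ i \<or> ind.xe i (v i) = \<zero>\<^bsub>ind.Q\<^esub>" if i: "i < s" for i
  proof -
    let ?x = "ind.xe i (v i)"
    have x: "?x \<in> carrier ind.Q" using v(1) by (simp add: ind.xe_simps)
    have "?x \<in> ?N" by (rule component_in[OF N stable _ _ i]) (use v y eig in auto)
    then have "(\<mu> \<odot>\<^bsub>H\<^esub> \<one>\<^bsub>H\<^esub>) \<odot>\<^bsub>ind.Q\<^esub> ?x = ((\<alpha> * \<chi> a ^ i) \<odot>\<^bsub>H\<^esub> \<one>\<^bsub>H\<^esub>) \<odot>\<^bsub>ind.Q\<^esub> ?x"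
      using a_xe[of "v i" i] v(1) by simp
    then have "(\<mu> + (- (\<alpha> * \<chi> a ^ i))) \<odot>\<^bsub>scalar_module H ind.Q\<^esub> ?x =
        ((\<alpha> * \<chi> a ^ i) + (- (\<alpha> * \<chi> a ^ i))) \<odot>\<^bsub>scalar_module H ind.Q\<^esub> ?x"
      using x by (subst (1 2) W.scale_left_distrib) simp_all
    also have "\<dots> = \<zero>\<^bsub>ind.Q\<^esub>" using W.scale_zero_left[of ?x] x by (simp del: scalar_module_simps(4))
    finally show ?thesis
      using W.scale_eq_zero[of ?x "\<mu> + (- (\<alpha> * \<chi> a ^ i))"] x by auto
  qed
  have "\<exists>i<s. ind.xe i (v i) \<noteq> \<zero>\<^bsub>ind.Q\<^esub>"
  proof (rule ccontr)
    assume "\<not> (\<exists>i<s. ind.xe i (v i) \<noteq> \<zero>\<^bsub>ind.Q\<^esub>)"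
    then have "y = (\<Oplus>\<^bsub>ind.Q\<^esub>i\<in>{..<s}. \<zero>\<^bsub>ind.Q\<^esub>)"
      unfolding v(2) by (intro ind.Q.M.finsum_cong') auto
    then show False using y(2) by simp
  qed
  then obtain i where i: "i < s" "ind.xe i (v i) \<noteq> \<zero>\<^bsub>ind.Q\<^esub>" by blast
  then have \<mu>: "\<mu> = \<alpha> * \<chi> a ^ i" using comp by blast
  have other: "ind.xe l (v l) = \<zero>\<^bsub>ind.Q\<^esub>" if l: "l < s" "l \<noteq> i" for l
  proof -
    have "\<alpha> * \<chi> a ^ l \<noteq> \<alpha> * \<chi> a ^ i"
      using inj_onD[OF q_powers_distinct, of l i] l i(1) \<alpha>_nonzero by auto
    then show ?thesis using comp[OF l(1)] \<mu> by auto
  qed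
  have "y = (\<Oplus>\<^bsub>ind.Q\<^esub>l\<in>{..<s}. if i = l then ind.xe l (v l) else \<zero>\<^bsub>ind.Q\<^esub>)"
    unfolding v(2) using v(1) other by (intro ind.Q.M.finsum_cong') (auto simp: ind.xe_simps)
  also have "\<dots> = ind.xe i (v i)"
    using i(1) v(1) by (intro ind.Q.M.finsum_singleton) (auto simp: ind.xe_simps)
  finally show ?thesis using i(1) \<mu> v(1) by blast
qed

lemma Q_x_nonzero:
  assumes "y \<in> carrier ind.Q" "xpow s \<odot>\<^bsub>ind.Q\<^esub> y = \<zero>\<^bsub>ind.Q\<^esub>"
  shows "y = \<zero>\<^bsub>ind.Q\<^esub>"
proof -
  interpret W: vspace "scalar_module H ind.Q" by (rule H.vspace_scalar_module[OF ind.Q.left_module_axioms])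
  show ?thesis using assms W.scale_eq_zero[of y \<beta>] \<beta> ind.Q_xpow[OF assms(1)] by simp
qed

text \<open>
  \<open>x\<^sup>s\<close> acts as zero on the one side and as \<open>\<beta> \<noteq> 0\<close> on the other.
\<close>

lemma Q_not_inflate:
  assumes W: "simple_fd kG W"
  shows "\<not> module_isomorphic H (inflate W) ind.Q"
proof
  assume "module_isomorphic H (inflate W) ind.Q"
  then obtain f where f: "module_map H (inflate W) ind.Q f" "bij_betw f (carrier W) (carrier ind.Q)"
    by (auto simp: module_isomorphic_iff)
  have W': "simple_module kG W" using W by (simp add: simple_fd_def)
  obtain w where w: "w \<in> carrier W" "w \<noteq> \<zero>\<^bsub>W\<^esub>" using simple_moduleD(3)[OF W'] by blast
  have LI: "left_module H (inflate W)" using inflate_simple_fd[OF W] by (simp add: simple_fd_def simple_module_def)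
  have f0: "f \<zero>\<^bsub>W\<^esub> = \<zero>\<^bsub>ind.Q\<^esub>" using module_map_zero[OF LI ind.Q.left_module_axioms f(1)] by simp
  have "xpow s \<odot>\<^bsub>ind.Q\<^esub> f w = \<zero>\<^bsub>ind.Q\<^esub>"
    using module_mapD(3)[OF f(1), of w "xpow s"] w(1) xpow_inflate[OF simple_moduleD(1)[OF W'] w(1) s_pos] f0
    by (simp add: xpow_closed del: inflate_simps(4))
  then have "f w = f \<zero>\<^bsub>W\<^esub>" using Q_x_nonzero module_mapD(1)[OF f(1)] w(1) f0 by simp
  moreover have "\<zero>\<^bsub>W\<^esub> \<in> carrier W"
    using submodule_subset[OF left_module.zero_submodule[OF simple_moduleD(1)[OF W']]] by simp
  ultimately show False
    using w inj_onD[OF bij_betw_imp_inj_on[OF f(2)], of w "\<zero>\<^bsub>W\<^esub>"] by simp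
qed

end

context finite_order_setting
begin

text \<open>
  Comparing the actions of \<open>x\<^sup>s\<close> gives \<open>\<beta> = \<gamma>\<close>. The image of \<open>V\<^sub>j\<close> consists of eigenvectors of \<open>a\<close> for one
  eigenvalue, so it lies in \<open>x\<^sup>i V\<^sub>l\<close> for one \<open>i\<close>, which is the twist of \<open>V\<^sub>l\<close> by \<open>\<chi>\<^sup>i\<close>.
\<close>

lemma induced_iso_unique:
  assumes J: "transversal I (orbit_rel I \<sigma>) J" and jl: "j \<in> J" "l \<in> J" and nz: "\<beta> \<noteq> 0" "\<gamma> \<noteq> 0"
    and iso: "module_isomorphic H (induced_quotient G H s (V j) \<beta>) (induced_quotient G H s (V l) \<gamma>)"
  shows "j = l \<and> \<beta> = \<gamma>"
proof -
  have I: "j \<in> I" "l \<in> I" using J jl by (auto simp: transversal_def)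
  interpret A: component_setting G \<chi> a I V s j \<beta> by unfold_locales (rule I nz)+
  interpret B: component_setting G \<chi> a I V s l \<gamma> by unfold_locales (rule I nz)+
  interpret W: vspace "scalar_module H B.ind.Q" by (rule H.vspace_scalar_module[OF B.ind.Q.left_module_axioms])
  obtain f where f: "module_map H A.ind.Q B.ind.Q f" "bij_betw f (carrier A.ind.Q) (carrier B.ind.Q)"
    using iso by (auto simp: module_isomorphic_iff)
  have f0: "f \<zero>\<^bsub>A.ind.Q\<^esub> = \<zero>\<^bsub>B.ind.Q\<^esub>"
    by (rule module_map_zero[OF A.ind.Q.left_module_axioms B.ind.Q.left_module_axioms f(1)])
  have f_nz: "f y \<noteq> \<zero>\<^bsub>B.ind.Q\<^esub>" if "y \<in> carrier A.ind.Q" "y \<noteq> \<zero>\<^bsub>A.ind.Q\<^esub>" for y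
    using that f0 inj_onD[OF bij_betw_imp_inj_on[OF f(2)], of y "\<zero>\<^bsub>A.ind.Q\<^esub>"] by auto
  have emb: "A.ind.emb v \<in> carrier A.ind.Q" if "v \<in> carrier (V j)" for v
    using module_mapD(1)[OF A.ind.emb_module_map that] by simp
  have femb: "f (A.ind.emb v) \<in> carrier B.ind.Q" if "v \<in> carrier (V j)" for v
    by (rule module_mapD(1)[OF f(1) emb[OF that]])
  obtain v0 where v0: "v0 \<in> carrier (V j)" "v0 \<noteq> \<zero>\<^bsub>V j\<^esub>" using simple_moduleD(3)[OF A.Vj(1)] by blast
  have emb0: "A.ind.emb v0 \<noteq> \<zero>\<^bsub>A.ind.Q\<^esub>" using A.ind.emb_inj v0 by blast
  define y where "y = f (A.ind.emb v0)"
  have y: "y \<in> carrier B.ind.Q" "y \<noteq> \<zero>\<^bsub>B.ind.Q\<^esub>"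
    using femb[OF v0(1)] f_nz[OF emb[OF v0(1)] emb0] by (simp_all add: y_def)
  have "(\<beta> \<odot>\<^bsub>H\<^esub> \<one>\<^bsub>H\<^esub>) \<odot>\<^bsub>B.ind.Q\<^esub> y = f (xpow s \<odot>\<^bsub>A.ind.Q\<^esub> A.ind.emb v0)"
    using module_mapD(3)[OF f(1) emb[OF v0(1)] H.scal_closed] A.ind.Q_xpow[OF emb[OF v0(1)]] by (simp add: y_def)
  also have "\<dots> = (\<gamma> \<odot>\<^bsub>H\<^esub> \<one>\<^bsub>H\<^esub>) \<odot>\<^bsub>B.ind.Q\<^esub> y"
    using module_mapD(3)[OF f(1) emb[OF v0(1)] xpow_closed[of s]] B.ind.Q_xpow[OF y(1)] by (simp add: y_def)
  finally have "(\<beta> + (- \<gamma>)) \<odot>\<^bsub>scalar_module H B.ind.Q\<^esub> y = (\<gamma> + (- \<gamma>)) \<odot>\<^bsub>scalar_module H B.ind.Q\<^esub> y"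
    using y(1) by (subst (1 2) W.scale_left_distrib) simp_all
  also have "\<dots> = \<zero>\<^bsub>B.ind.Q\<^esub>" using W.scale_zero_left[of y] y(1) by (simp del: scalar_module_simps(4))
  finally have "\<beta> = \<gamma>" using W.scale_eq_zero[of y "\<beta> + (- \<gamma>)"] y by auto
  have a: "ore_group a \<in> carrier H" using a_closed by (simp add: ore_group_def hopf_ore_simps)
  have eig: "ore_group a \<odot>\<^bsub>B.ind.Q\<^esub> f (A.ind.emb v) = (A.\<alpha> \<odot>\<^bsub>H\<^esub> \<one>\<^bsub>H\<^esub>) \<odot>\<^bsub>B.ind.Q\<^esub> f (A.ind.emb v)"
    if v: "v \<in> carrier (V j)" for v
    using A.a_xe[OF v, of 0] module_mapD(3)[OF f(1) emb[OF v] a] module_mapD(3)[OF f(1) emb[OF v] H.scal_closed]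
    by (simp add: A.ind.emb_xe[OF v, symmetric])
  obtain i where i: "i < s" "A.\<alpha> = B.\<alpha> * \<chi> a ^ i"
    using B.a_eigenvector[OF y] eig[OF v0(1)] unfolding y_def by blast
  have "\<exists>w. w \<in> carrier (V l) \<and> f (A.ind.emb v) = B.ind.xe i w" if v: "v \<in> carrier (V j)" for v
  proof (cases "v = \<zero>\<^bsub>V j\<^esub>")
    case True
    have "A.ind.emb \<zero>\<^bsub>V j\<^esub> = \<zero>\<^bsub>A.ind.Q\<^esub>" using A.ind.xe_zero[of 0] A.ind.emb_xe[of "\<zero>\<^bsub>V j\<^esub>"] by simp
    then show ?thesis using True f0 B.ind.xe_zero[of i] by (intro exI[of _ "\<zero>\<^bsub>V l\<^esub>"]) simp
  next
    case False
    then have "f (A.ind.emb v) \<noteq> \<zero>\<^bsub>B.ind.Q\<^esub>" using f_nz[OF emb[OF v]] A.ind.emb_inj[OF v] by blast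
    then obtain i' where i': "i' < s" "A.\<alpha> = B.\<alpha> * \<chi> a ^ i'" "\<exists>w\<in>carrier (V l). f (A.ind.emb v) = B.ind.xe i' w"
      using B.a_eigenvector[OF femb[OF v] _ eig[OF v]] by blast
    have "i' = i" using i i'(1,2) B.\<alpha>_nonzero inj_onD[OF q_powers_distinct, of i' i] by simp
    then show ?thesis using i'(3) by blast
  qed
  \<comment> \<open>The isomorphism, restricted to \<open>V\<^sub>j\<close>, with \<open>x\<^sup>i V\<^sub>l\<close> identified with the twist of \<open>V\<^sub>l\<close>.\<close>
  then obtain \<phi> where \<phi>: "\<And>v. v \<in> carrier (V j) \<Longrightarrow> \<phi> v \<in> carrier (V l)"
    "\<And>v. v \<in> carrier (V j) \<Longrightarrow> f (A.ind.emb v) = B.ind.xe i (\<phi> v)" by metis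
  let ?T = "restrict_scalars (tw i) (V l)"
  have T: "simple_fd kG ?T" by (rule tw_simple_fd[OF V_simple[OF I(2)]])
  then have T': "simple_module kG ?T" by (simp add: simple_fd_def)
  have "inj_on (B.ind.xe i) (carrier ?T)"
    by (rule module_map_inj[OF simple_moduleD(1)[OF T'] res_left_module[OF B.ind.Q.left_module_axioms] B.ind.xe_module_map])
      (use B.xe_injective[OF _ i(1)] in simp)
  then have xe_eq: "w = w'" if "w \<in> carrier (V l)" "w' \<in> carrier (V l)" "B.ind.xe i w = B.ind.xe i w'" for w w'
    using that by (simp add: inj_on_def)
  have comp: "module_map kG (V j) (res B.ind.Q) (f \<circ> A.ind.emb)"
  proof (rule module_map_comp[OF A.ind.emb_module_map])
    show "module_map kG (res A.ind.Q) (res B.ind.Q) f"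
      unfolding res_def by (rule restrict_scalars_module_map[OF f(1) algebra_map_hom[OF group_to_ore_algebra_map]])
  qed
  have \<phi>_map: "module_map kG (V j) ?T \<phi>"
  proof (rule module_mapI)
    fix v w assume vw: "v \<in> carrier (V j)" "w \<in> carrier (V j)"
    have "\<phi> (v \<oplus>\<^bsub>V j\<^esub> w) = \<phi> v \<oplus>\<^bsub>V l\<^esub> \<phi> w"
      using vw module_mapD(2)[OF comp vw]
      by (intro xe_eq) (simp_all add: \<phi>(1) \<phi>(2)[symmetric] B.ind.xe_simps)
    then show "\<phi> (v \<oplus>\<^bsub>V j\<^esub> w) = \<phi> v \<oplus>\<^bsub>?T\<^esub> \<phi> w" by simp
  next
    fix u v assume uv: "u \<in> carrier kG" "v \<in> carrier (V j)"
    have "\<phi> (u \<odot>\<^bsub>V j\<^esub> v) = tw i u \<odot>\<^bsub>V l\<^esub> \<phi> v"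
      using uv module_mapD(3)[OF comp uv(2,1)] B.ind.xe_simps(3)[OF \<phi>(1)[OF uv(2)] uv(1), of i]
      by (intro xe_eq)
        (simp_all add: \<phi>(1) \<phi>(2)[symmetric] A.ind.V.smult_closed B.ind.V.smult_closed tw_closed)
    then show "\<phi> (u \<odot>\<^bsub>V j\<^esub> v) = u \<odot>\<^bsub>?T\<^esub> \<phi> v" by simp
  qed (simp add: \<phi>)
  have "\<phi> v0 \<noteq> \<zero>\<^bsub>?T\<^esub>"
    using y(2) \<phi>(2)[OF v0(1)] B.ind.xe_zero[of i] by (auto simp: y_def)
  then have "module_isomorphic kG (V j) ?T"
    by (intro simple_module_map_iso[OF A.Vj(1) T' \<phi>_map v0(1)])
  then have "module_isomorphic kG (V j) (V ((\<sigma> ^^ i) l))"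
    using twist_perm_pow[OF I(2), of i] by (blast intro: module_isomorphic_trans)
  then have "j = (\<sigma> ^^ i) l" using twist_perm_pow[OF I(2), of i] I by (intro V_iso) auto
  then have "(j, l) \<in> orbit_rel I \<sigma>" using pow_orbit_rel[OF I(2), of i] by simp
  then show ?thesis using transversal_unique[OF J jl] \<open>\<beta> = \<gamma>\<close> by blast
qed

text \<open>
  A simple \<open>kG\<close>-submodule of \<open>M\<close> is some \<open>V\<^sub>i\<close>, whose index need not belong to the transversal. For
  \<open>j = \<sigma>\<^sup>n(i)\<close> in the transversal, \<open>x\<^sup>n\<close> maps it onto a copy of \<open>V\<^sub>j\<close> in \<open>M\<close>.
\<close>

lemma induced_complete:
  fixes M :: "('g \<times> nat \<Rightarrow>\<^sub>0 'k, 'm) module"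
  assumes J: "transversal I (orbit_rel I \<sigma>) J" and M: "simple_fd H M"
    and m: "m \<in> carrier M" "xpow 1 \<odot>\<^bsub>M\<^esub> m \<noteq> \<zero>\<^bsub>M\<^esub>"
  shows "\<exists>j\<in>J. \<exists>\<beta>\<in>UNIV - {0}. module_isomorphic H M (induced_quotient G H s (V j) \<beta>)"
proof -
  have M': "simple_module H M" "finite_dim H M" using M by (auto simp: simple_fd_def)
  note LM = simple_moduleD(1)[OF M'(1)]
  interpret M: left_module H M by fact
  have inj: "n = \<zero>\<^bsub>M\<^esub>" if "n \<in> carrier M" "xpow i \<odot>\<^bsub>M\<^esub> n = \<zero>\<^bsub>M\<^esub>" for n i
    using xpow_injective[OF LM simple_x_injective[OF M'(1) m]] that by blast
  have "module_map H M M (\<lambda>n. xpow s \<odot>\<^bsub>M\<^esub> n)"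
    by (rule module_mapI)
      (simp_all add: M.smult_closed xpow_closed M.smult_r_distr xpow_central char_pow flip: M.smult_assoc)
  then obtain \<beta> where \<beta>: "\<And>n. n \<in> carrier M \<Longrightarrow> xpow s \<odot>\<^bsub>M\<^esub> n = (\<beta> \<odot>\<^bsub>H\<^esub> \<one>\<^bsub>H\<^esub>) \<odot>\<^bsub>M\<^esub> n"
    using simple_endomorphism_scalar[OF H.scalar_ring_axioms M] by blast
  have m0: "m \<noteq> \<zero>\<^bsub>M\<^esub>" using m M.smult_zero_right[OF xpow_closed] by auto
  have "\<beta> \<noteq> 0"
  proof
    assume "\<beta> = 0"
    then have "xpow s \<odot>\<^bsub>M\<^esub> m = \<zero>\<^bsub>M\<^esub>" using \<beta>[OF m(1)] M.smult_zero_left[OF m(1)] by (simp add: hopf_ore_simps)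
    then show False using inj[OF m(1)] m0 by blast
  qed
  note LR = res_left_module[OF LM]
  interpret R: left_module kG "res M" by (rule LR)
  obtain U where U: "submodule U kG (res M)" "simple_fd kG ((res M)\<lparr>carrier := U\<rparr>)"
    using kG.simple_submodule_exists[OF LR] M'(2) m(1) m0 by (auto simp: res_finite_dim)
  obtain i where i: "i \<in> I" "module_isomorphic kG ((res M)\<lparr>carrier := U\<rparr>) (V i)"
    using V_complete[OF U(2)] by blast
  have "module_isomorphic kG (V i) ((res M)\<lparr>carrier := U\<rparr>)"
    using R.left_module_submodule[OF U(1)] i(2) by (rule module_isomorphic_sym)
  then obtain f where f: "module_map kG (V i) ((res M)\<lparr>carrier := U\<rparr>) f" "bij_betw f (carrier (V i)) U"
    by (auto simp: module_isomorphic_iff)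
  have fM: "module_map kG (V i) (res M) f"
    using f(1) submodule_subset[OF U(1)] by (auto simp: module_map_def)
  obtain j where j: "j \<in> J" "(i, j) \<in> orbit_rel I \<sigma>" using transversal_representative[OF J i(1)] by blast
  then obtain n where n: "j = (\<sigma> ^^ n) i" using orbit_rel_pow by blast
  have jI: "j \<in> I" using J j(1) by (auto simp: transversal_def)
  interpret A: component_setting G \<chi> a I V s j \<beta> by unfold_locales (rule jI \<open>\<beta> \<noteq> 0\<close>)+
  let ?T = "restrict_scalars (tw n) (V i)"
  have T: "left_module kG ?T"
    using tw_simple_fd[OF V_simple[OF i(1)], of n] by (simp add: simple_fd_def simple_module_def)
  have "module_isomorphic kG (V j) ?T"
    using module_isomorphic_sym[OF T] twist_perm_pow[OF i(1), of n] n by blast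
  then obtain g where g: "module_map kG (V j) ?T g" "bij_betw g (carrier (V j)) (carrier ?T)"
    by (auto simp: module_isomorphic_iff)
  let ?h = "(\<lambda>v. xpow n \<odot>\<^bsub>M\<^esub> f v) \<circ> g"
  have h: "module_map kG (V j) (res M) ?h"
    by (rule module_map_comp[OF g(1) xpow_module_map[OF LM fM]])
  obtain F where F: "module_map H A.ind.Q M F" "\<forall>v\<in>carrier (V j). F (A.ind.emb v) = ?h v"
    using A.ind.Q_universal[OF LM \<beta> h] by blast
  obtain v where v: "v \<in> carrier (V j)" "v \<noteq> \<zero>\<^bsub>V j\<^esub>" using simple_moduleD(3)[OF A.Vj(1)] by blast
  have gv: "g v \<in> carrier (V i)" using module_mapD(1)[OF g(1) v(1)] by simp
  have "g v \<noteq> \<zero>\<^bsub>V i\<^esub>"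
    using module_map_zero[OF A.ind.V.left_module_axioms T g(1)] v A.ind.V.M.zero_closed
      inj_onD[OF bij_betw_imp_inj_on[OF g(2)], of v "\<zero>\<^bsub>V j\<^esub>"] by auto
  then have "f (g v) \<noteq> \<zero>\<^bsub>M\<^esub>"
    using module_map_zero[OF V_left_module[OF i(1)] LR fM] gv
      inj_onD[OF bij_betw_imp_inj_on[OF f(2)], of "g v" "\<zero>\<^bsub>V i\<^esub>"]
      submodule_zero[OF left_module.zero_submodule[OF V_left_module[OF i(1)]]]
      submodule_subset[OF left_module.zero_submodule[OF V_left_module[OF i(1)]]] by auto
  then have "?h v \<noteq> \<zero>\<^bsub>M\<^esub>"
    using inj[of "f (g v)" n] module_mapD(1)[OF fM gv] by auto
  then have "F (A.ind.emb v) \<noteq> \<zero>\<^bsub>M\<^esub>" using F(2) v(1) by simp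
  moreover have "A.ind.emb v \<in> carrier A.ind.Q" using module_mapD(1)[OF A.ind.emb_module_map v(1)] by simp
  moreover have "simple_module H A.ind.Q" using A.Q_simple by (simp add: simple_fd_def)
  ultimately have "module_isomorphic H A.ind.Q M"
    using simple_module_map_iso[OF _ M'(1) F(1)] by blast
  then have "module_isomorphic H M A.ind.Q"
    by (rule module_isomorphic_sym[OF A.ind.Q.left_module_axioms])
  then show ?thesis using j(1) \<open>\<beta> \<noteq> 0\<close> by blast
qed

end

lemma (in simples_setting) x_zero_complete:
  assumes M: "simple_fd H M" and x: "\<And>m. m \<in> carrier M \<Longrightarrow> xpow 1 \<odot>\<^bsub>M\<^esub> m = \<zero>\<^bsub>M\<^esub>"
  shows "\<exists>i\<in>I. module_isomorphic H M (inflate (V i))"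
proof -
  obtain i where "i \<in> I" "module_isomorphic kG (res M) (V i)"
    using V_complete[OF simple_x_zero(1)[OF M x]] by blast
  then show ?thesis
    using module_isomorphic_trans[OF simple_x_zero(2)[OF M x] inflate_iso'] by blast
qed

theorem corollary3p6:
  fixes G :: "('g, 'z) monoid_scheme"
    and \<chi> :: "'g \<Rightarrow> 'k::alg_closed_field"
    and a :: 'g
    and I :: "'i set"
    and V :: "'i \<Rightarrow> ('g \<Rightarrow>\<^sub>0 'k, 'v) module"
    and H :: "('k, 'g \<times> nat) hopf"
  assumes "group G"
    and "a \<in> carrier G" and "\<forall>g\<in>carrier G. a \<otimes>\<^bsub>G\<^esub> g = g \<otimes>\<^bsub>G\<^esub> a"
    and "\<chi> \<in> carrier (character_group G)"
    and "\<chi> a \<noteq> 1"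
    and "H = hopf_ore G \<chi> a"
    and "complete_simples TYPE(nat \<Rightarrow> 'k) (group_algebra G :: ('k, 'g) hopf) I V"
  shows
    "(group.ord (character_group G) \<chi> = 0 \<longrightarrow>
        complete_simples TYPE('m) H I (\<lambda>i. inflate (V i))) \<and>
     (\<forall>s J. group.ord (character_group G) \<chi> = s \<and>
        group.ord (mult_of (ring_of_type_algebra :: 'k ring)) (\<chi> a) = s \<and> s > 0 \<and>
        transversal I (orbit_rel I (twist_perm G \<chi> I V)) J \<longrightarrow>
        nonisomorphic_simples H I (\<lambda>i. inflate (V i)) \<and>
        nonisomorphic_simples H (J \<times> (UNIV - {0})) (\<lambda>(j, \<beta>). induced_quotient G H s (V j) \<beta>) \<and>
        (\<forall>i\<in>I. \<forall>j\<in>J. \<forall>\<beta>\<in>UNIV - {0}.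
           \<not> module_isomorphic H (inflate (V i)) (induced_quotient G H s (V j) \<beta>)) \<and>
        (\<forall>M :: ('g \<times> nat \<Rightarrow>\<^sub>0 'k, 'm) module. simple_fd H M \<longrightarrow>
           (\<exists>i\<in>I. module_isomorphic H M (inflate (V i))) \<or>
           (\<exists>j\<in>J. \<exists>\<beta>\<in>UNIV - {0}. module_isomorphic H M (induced_quotient G H s (V j) \<beta>))))"
proof -
  interpret S: simples_setting G \<chi> a I V
    using assms(1-4,7)
    by (intro simples_setting.intro hopf_ore_closed.intro hopf_ore_setting.intro
        hopf_ore_setting_axioms.intro simples_setting_axioms.intro) auto
  have noniso: "nonisomorphic_simples H I (\<lambda>i. inflate (V i))"
    using S.complete unfolding assms(6) complete_simples_def by (intro S.inflate_nonisomorphic) simp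
  have inf: "\<exists>i\<in>I. module_isomorphic H M (inflate (V i))"
    if M: "simple_fd H M" and ord: "group.ord (character_group G) \<chi> = 0"
    for M :: "('g \<times> nat \<Rightarrow>\<^sub>0 'k, 'm) module"
  proof -
    have M': "simple_module S.H M" "finite_dim S.H M" using M by (auto simp: simple_fd_def assms(6))
    have "S.xpow 1 \<odot>\<^bsub>M\<^esub> m = \<zero>\<^bsub>M\<^esub>" if m: "m \<in> carrier M" for m
    proof (rule ccontr)
      assume x: "S.xpow 1 \<odot>\<^bsub>M\<^esub> m \<noteq> \<zero>\<^bsub>M\<^esub>"
      obtain v where v: "v \<in> carrier M" "v \<noteq> \<zero>\<^bsub>M\<^esub>" using simple_moduleD(3)[OF M'(1)] by blast
      have "\<exists>N>0. \<forall>g\<in>carrier G. \<chi> g ^ N = 1"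
        by (rule S.injective_x_finite_order[OF simple_moduleD(1)[OF M'(1)] M'(2) v])
          (rule S.simple_x_injective[OF M'(1) m x])
      then obtain N where "N > 0" "\<forall>g\<in>carrier G. \<chi> g ^ N = 1" by blast
      then show False using character_pow_eq_one[OF assms(1,4), of N] ord by simp
    qed
    then show ?thesis using S.x_zero_complete[of M] M by (simp add: assms(6))
  qed
  show ?thesis
  proof (intro conjI impI allI)
    assume "group.ord (character_group G) \<chi> = 0"
    then show "complete_simples TYPE('m) H I (\<lambda>i. inflate (V i))"
      using noniso inf by (simp add: complete_simples_def)
  next
    fix s J
    assume *: "group.ord (character_group G) \<chi> = s \<and>
        group.ord (mult_of (ring_of_type_algebra :: 'k ring)) (\<chi> a) = s \<and> s > 0 \<and>
        transversal I (orbit_rel I (twist_perm G \<chi> I V)) J"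
    then have J: "transversal I (orbit_rel I S.\<sigma>) J" by simp
    interpret F: finite_order_setting G \<chi> a I V s
    proof
      show "s > 0" using * by simp
      show "\<chi> g ^ s = 1" if "g \<in> carrier G" for g
        using character_pow_eq_one[OF assms(1,4), of s] * that by simp
      show "s dvd n" if "\<chi> a ^ n = 1" for n
        using mult_of_pow_eq_one[OF character_nonzero[OF assms(4,2)], of n] * that by simp
    qed
    have comp: "component_setting G \<chi> a I V s j \<beta>" if "j \<in> J" "\<beta> \<noteq> 0" for j \<beta>
      using that J by unfold_locales (auto simp: transversal_def)
    show "nonisomorphic_simples H I (\<lambda>i. inflate (V i))" by (rule noniso)
    show "nonisomorphic_simples H (J \<times> (UNIV - {0})) (\<lambda>(j, \<beta>). induced_quotient G H s (V j) \<beta>)"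
      unfolding nonisomorphic_simples_def assms(6)
    proof (intro conjI ballI impI)
      fix p :: "'i \<times> 'k" assume "p \<in> J \<times> (UNIV - {0})"
      then show "simple_fd S.H (case p of (j, \<beta>) \<Rightarrow> induced_quotient G S.H s (V j) \<beta>)"
        using component_setting.Q_simple[OF comp] by auto
    next
      fix p r :: "'i \<times> 'k" assume "p \<in> J \<times> (UNIV - {0})" "r \<in> J \<times> (UNIV - {0})"
        "module_isomorphic S.H (case p of (j, \<beta>) \<Rightarrow> induced_quotient G S.H s (V j) \<beta>)
          (case r of (j, \<beta>) \<Rightarrow> induced_quotient G S.H s (V j) \<beta>)"
      then show "p = r" using F.induced_iso_unique[OF J, of "fst p" "fst r" "snd p" "snd r"] by (auto split: prod.splits)
    qed
    show "\<forall>i\<in>I. \<forall>j\<in>J. \<forall>\<beta>\<in>UNIV - {0}. \<not> module_isomorphic H (inflate (V i)) (induced_quotient G H s (V j) \<beta>)"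
      using component_setting.Q_not_inflate[OF comp S.V_simple] by (auto simp: assms(6))
    fix M :: "('g \<times> nat \<Rightarrow>\<^sub>0 'k, 'm) module" assume M: "simple_fd H M"
    show "(\<exists>i\<in>I. module_isomorphic H M (inflate (V i))) \<or>
        (\<exists>j\<in>J. \<exists>\<beta>\<in>UNIV - {0}. module_isomorphic H M (induced_quotient G H s (V j) \<beta>))"
    proof (cases "\<forall>m\<in>carrier M. S.xpow 1 \<odot>\<^bsub>M\<^esub> m = \<zero>\<^bsub>M\<^esub>")
      case True
      then show ?thesis using S.x_zero_complete[of M] M by (simp add: assms(6))
    next
      case False
      then show ?thesis using F.induced_complete[OF J, of M] M unfolding assms(6) by blast
    qed
  qed
qed

end
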